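(* Let $\mathcal{F}$ be any class of $n$-variate Boolean functions that is closed under restrictions. Suppose that $M_k(\mathcal{F})\le b^k$ for some $b\ge1$ and $k>2$. Then for any $\varepsilon>0$, there exists an explicit PRG for $\mathcal{F}$ with error $\varepsilon$ and seed length \[ O\left(\frac{b^{2+\frac{4}{k-2}}\cdot k\log n\cdot\log^{1+\frac{2}{k-2}}(n/\varepsilon)}{\varepsilon^{\frac{2}{k-2}}}\right). \] If it further holds that $L_{1,i}(\mathcal{F})\le b^i$ for all $1\le i<k$, then the seed length can be improved to \[ O\left(\frac{b^{2+\frac{4}{k-2}}\cdot(\log\log n+\log k+\log(b/\varepsilon))\cdot\log^{1+\frac{2}{k-2}}(n/\varepsilon)}{\varepsilon^{\frac{2}{k-2}}}\right). \]
   Context: Boolean functions $f:\{-1,1\}^n\to\{-1,1\}$ have multilinear expansions $f(\mathbf{x})=\sum_{S\subseteq[n]}\hat f(S)\mathbf{x}^S$, $\mathbf{x}^S=\prod_{i\in S}x_i$. Closed under restrictions: fixing any subset of variables to values in $\{-1,1\}$ yields a function in the class. $L_{1,i}(f)=\sum_{|S|=i}|\hat f(S)|$, $L_{1,i}(\mathcal{F})=\max_{f\in\mathcal{F}}L_{1,i}(f)$; $M_k(f)=\max_{\mathbf{x}\in\{-1,1\}^n}|\sum_{|S|=k}\hat f(S)\mathbf{x}^S|$, $M_k(\mathcal{F})=\max_{f\in\mathcal{F}}M_k(f)$. A PRG for $\mathcal{F}$ with error $\varepsilon$ is a random variable $\mathbf{X}\in\{-1,1\}^n$ with $|\mathbb{E}[f(\mathbf{X})]-\mathbb{E}[f(\mathbf{U}_n)]|\le\varepsilon$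 for all $f\in\mathcal{F}$, $\mathbf{U}_n$ uniform on $\{-1,1\}^n$; it is explicit with seed length $s$ if $\mathbf{X}=G(\mathbf{U}_s)$ for an explicit (efficiently computable) $G:\{-1,1\}^s\to\{-1,1\}^n$. *)

theory Defs
  imports
    "HOL-Probability.Probability"
    "HOL-Computational_Algebra.Polynomial"
    "HOL-Library.Log_Nat"
begin

subsection \<open>Boolean functions and their Fourier coefficients\<close>

text \<open>The index set \<open>[n]\<close> is \<open>{..<n}\<close>. Points and functions are extensional, so that a class of
  \<open>n\<close>-variate Boolean functions is a subset of the finite set \<open>boolean_functions n\<close>.\<close>

definition cube :: "nat \<Rightarrow> (nat \<Rightarrow> real) set" where
  "cube n = {..<n} \<rightarrow>\<^sub>E {-1, 1}"

definition boolean_functions :: "nat \<Rightarrow> ((nat \<Rightarrow> real) \<Rightarrow> real) set" where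
  "boolean_functions n = cube n \<rightarrow>\<^sub>E {-1, 1}"

definition monomial :: "nat set \<Rightarrow> (nat \<Rightarrow> real) \<Rightarrow> real" where
  "monomial S x = (\<Prod>i\<in>S. x i)"

text \<open>By \<open>fourier_expansion\<close> and \<open>fourier_unique\<close> below, these are the coefficients of
  the unique multilinear expansion of \<open>f\<close> on the cube.\<close>

definition fourier :: "nat \<Rightarrow> ((nat \<Rightarrow> real) \<Rightarrow> real) \<Rightarrow> nat set \<Rightarrow> real" where
  "fourier n f S = (\<Sum>x\<in>cube n. f x * monomial S x) / 2 ^ n"

definition L1 :: "nat \<Rightarrow> nat \<Rightarrow> ((nat \<Rightarrow> real) \<Rightarrow> real) \<Rightarrow> real" where
  "L1 n i f = (\<Sum>S | S \<subseteq> {..<n} \<and> card S = i. \<bar>fourier n f S\<bar>)"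

definition L1_class :: "nat \<Rightarrow> nat \<Rightarrow> ((nat \<Rightarrow> real) \<Rightarrow> real) set \<Rightarrow> real" where
  "L1_class n i F = Max (L1 n i ` F)"

definition M :: "nat \<Rightarrow> nat \<Rightarrow> ((nat \<Rightarrow> real) \<Rightarrow> real) \<Rightarrow> real" where
  "M n k f =
     Max ((\<lambda>x. \<bar>\<Sum>S | S \<subseteq> {..<n} \<and> card S = k. fourier n f S * monomial S x\<bar>) ` cube n)"

definition M_class :: "nat \<Rightarrow> nat \<Rightarrow> ((nat \<Rightarrow> real) \<Rightarrow> real) set \<Rightarrow> real" where
  "M_class n k F = Max (M n k ` F)"

text \<open>A restriction is again regarded as an \<open>n\<close>-variate function, which ignores the fixed
  variables.\<close>

definition closed_under_restrictions :: "nat \<Rightarrow> ((nat \<Rightarrow> real) \<Rightarrow> real) set \<Rightarrow> bool" where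
  "closed_under_restrictions n F \<longleftrightarrow>
     (\<forall>f\<in>F. \<forall>J\<subseteq>{..<n}. \<forall>a\<in>cube n. (\<lambda>x\<in>cube n. f (override_on x a J)) \<in> F)"

lemma finite_cube [simp]: "finite (cube n)"
  unfolding cube_def by (intro finite_PiE) auto

lemma finite_boolean_functions [simp]: "finite (boolean_functions n)"
  unfolding boolean_functions_def by (intro finite_PiE) auto

lemma sum_cube_prod:
  "(\<Sum>x\<in>cube n. \<Prod>i<n. h i (x i)) = (\<Prod>i<n. h i (-1) + h i 1 :: real)"
proof -
  have "(\<Prod>i<n. h i (-1) + h i 1) = (\<Prod>i<n. \<Sum>v\<in>{-1, 1::real}. h i v)"
    by simp
  also have "\<dots> = (\<Sum>x\<in>cube n. \<Prod>i<n. h i (x i))"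
    unfolding cube_def by (subst prod_sum_PiE) auto
  finally show ?thesis ..
qed

lemma monomial_alt:
  assumes "S \<subseteq> {..<n}"
  shows "monomial S x = (\<Prod>i<n. if i \<in> S then x i else 1)"
proof -
  have "{..<n} \<inter> S = S" using assms by blast
  then show ?thesis by (simp add: monomial_def prod.If_cases)
qed

lemma monomial_orthogonal:
  assumes "S \<subseteq> {..<n}" "T \<subseteq> {..<n}"
  shows "(\<Sum>x\<in>cube n. monomial S x * monomial T x) = (if S = T then 2 ^ n else 0)"
proof -
  let ?h = "\<lambda>i v. (if i \<in> S then v else 1) * (if i \<in> T then v else 1 :: real)"
  have "(\<Sum>x\<in>cube n. monomial S x * monomial T x) = (\<Sum>x\<in>cube n. \<Prod>i<n. ?h i (x i))"
    using assms by (simp add: monomial_alt prod.distrib)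
  also have "\<dots> = (\<Prod>i<n. ?h i (-1) + ?h i 1)"
    by (rule sum_cube_prod)
  also have "\<dots> = (if S = T then 2 ^ n else 0)"
  proof (cases "S = T")
    case False
    then obtain j where "j < n" "(j \<in> S) \<noteq> (j \<in> T)"
      using assms by blast
    then show ?thesis
      using False by (auto intro!: prod_zero bexI[of _ j])
  next
    case True
    have "(\<Prod>i<n. ?h i (-1) + ?h i 1) = (\<Prod>i<n. 2)"
      by (rule prod.cong) (auto simp: True)
    then show ?thesis using True by simp
  qed
  finally show ?thesis .
qed

lemma fourier_expansion:
  assumes "x \<in> cube n"
  shows "f x = (\<Sum>S | S \<subseteq> {..<n}. fourier n f S * monomial S x)"
proof -
  have kernel: "(\<Sum>S\<in>Pow {..<n}. monomial S x * monomial S y) = (if x = y then 2 ^ n else 0)"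
    if y: "y \<in> cube n" for y
  proof -
    have "(\<Sum>S\<in>Pow {..<n}. monomial S x * monomial S y) =
        (\<Sum>S\<in>Pow {..<n}. (\<Prod>i\<in>S. x i * y i) * (\<Prod>i\<in>{..<n} - S. 1))"
      by (simp add: monomial_def prod.distrib)
    also have "\<dots> = (\<Prod>i<n. x i * y i + 1)"
      by (rule prod_add [symmetric]) simp
    also have "\<dots> = (if x = y then 2 ^ n else 0)"
    proof (cases "x = y")
      case True
      have "x i * x i + 1 = 2" if "i < n" for i
        using assms that by (auto simp: cube_def PiE_iff dest!: bspec[of _ _ i])
      then show ?thesis using True by simp
    next
      case False
      then obtain j where j: "j < n" "x j \<noteq> y j"
        using assms y unfolding cube_def by (metis PiE_ext lessThan_iff)
      then have "x j * y j + 1 = 0"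
        using assms y by (auto simp: cube_def PiE_iff dest!: bspec[of _ _ j])
      then show ?thesis using False j by (auto intro!: prod_zero bexI[of _ j])
    qed
    finally show ?thesis .
  qed
  have "(\<Sum>S | S \<subseteq> {..<n}. fourier n f S * monomial S x) =
      (\<Sum>S\<in>Pow {..<n}. \<Sum>y\<in>cube n. f y * (monomial S x * monomial S y) / 2 ^ n)"
    by (simp add: fourier_def Pow_def sum_divide_distrib sum_distrib_left sum_distrib_right mult_ac)
  also have "\<dots> = (\<Sum>y\<in>cube n. f y * (\<Sum>S\<in>Pow {..<n}. monomial S x * monomial S y) / 2 ^ n)"
    by (subst sum.swap) (simp add: sum_divide_distrib sum_distrib_left)
  also have "\<dots> = (\<Sum>y\<in>cube n. if x = y then f y else 0)"
    by (rule sum.cong) (auto simp: kernel)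
  also have "\<dots> = f x"
    using assms by simp
  finally show ?thesis ..
qed

lemma fourier_unique:
  assumes "\<And>x. x \<in> cube n \<Longrightarrow> f x = (\<Sum>S | S \<subseteq> {..<n}. c S * monomial S x)"
    and T: "T \<subseteq> {..<n}"
  shows "fourier n f T = c T"
proof -
  have "(\<Sum>x\<in>cube n. f x * monomial T x) =
      (\<Sum>x\<in>cube n. \<Sum>S | S \<subseteq> {..<n}. c S * (monomial S x * monomial T x))"
    by (rule sum.cong) (simp_all add: assms(1) sum_distrib_left sum_distrib_right mult_ac)
  also have "\<dots> = (\<Sum>S | S \<subseteq> {..<n}. c S * (\<Sum>x\<in>cube n. monomial S x * monomial T x))"
    by (subst sum.swap) (simp add: sum_distrib_left)
  also have "\<dots> = (\<Sum>S | S \<subseteq> {..<n}. if S = T then c S * 2 ^ n else 0)"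
    using T by (intro sum.cong) (auto simp: monomial_orthogonal)
  also have "\<dots> = c T * 2 ^ n"
    using T by (simp add: sum.delta finite_Collect_subsets)
  finally show ?thesis
    by (simp add: fourier_def)
qed

subsection \<open>Pseudorandom generators\<close>

definition is_prg ::
    "nat \<Rightarrow> ((nat \<Rightarrow> real) \<Rightarrow> real) set \<Rightarrow> real \<Rightarrow> (nat \<Rightarrow> real) pmf \<Rightarrow> bool" where
  "is_prg n F \<epsilon> X \<longleftrightarrow> set_pmf X \<subseteq> cube n \<and>
     (\<forall>f\<in>F. \<bar>measure_pmf.expectation X f
              - measure_pmf.expectation (pmf_of_set (cube n)) f\<bar> \<le> \<epsilon>)"

subsection \<open>Explicitness\<close>

text \<open>Random access machines with addition, truncated subtraction and indirect addressing,
  in structured form. All instructions and tests have unit cost. As there is no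
  multiplication, the bit length of the numbers grows by at most one per step, so polynomial time
  (with the input numbers measured by their bit length) coincides with polynomial time on Turing
  machines. The input is a read-only list; reading past its end yields \<open>0\<close>.\<close>

datatype ram =
    Skip
  | Const nat nat
  | Add nat nat nat
  | Sub nat nat nat
  | Load nat nat
  | Store nat nat
  | Read nat nat
  | Seq ram ram
  | Cond nat ram ram
  | While nat ram

text \<open>\<open>ram_run inp P m t m'\<close>: on input \<open>inp\<close> and memory \<open>m\<close>, the program \<open>P\<close> halts after \<open>t\<close>
  steps with memory \<open>m'\<close>.\<close>

inductive ram_run ::
    "nat list \<Rightarrow> ram \<Rightarrow> (nat \<Rightarrow> nat) \<Rightarrow> nat \<Rightarrow> (nat \<Rightarrow> nat) \<Rightarrow> bool" for inp where
  Skip: "ram_run inp Skip m 1 m"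
| Const: "ram_run inp (Const r c) m 1 (m(r := c))"
| Add: "ram_run inp (Add r p q) m 1 (m(r := m p + m q))"
| Sub: "ram_run inp (Sub r p q) m 1 (m(r := m p - m q))"
| Load: "ram_run inp (Load r p) m 1 (m(r := m (m p)))"
| Store: "ram_run inp (Store r p) m 1 (m(m r := m p))"
| Read: "ram_run inp (Read r p) m 1 (m(r := nth_default 0 inp (m p)))"
| Seq: "ram_run inp P m t m' \<Longrightarrow> ram_run inp Q m' t' m'' \<Longrightarrow>
    ram_run inp (Seq P Q) m (t + t') m''"
| Cond_True: "m r \<noteq> 0 \<Longrightarrow> ram_run inp P m t m' \<Longrightarrow> ram_run inp (Cond r P Q) m (1 + t) m'"
| Cond_False: "m r = 0 \<Longrightarrow> ram_run inp Q m t m' \<Longrightarrow> ram_run inp (Cond r P Q) m (1 + t) m'"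
| While_True: "m r \<noteq> 0 \<Longrightarrow> ram_run inp P m t m' \<Longrightarrow> ram_run inp (While r P) m' t' m'' \<Longrightarrow>
    ram_run inp (While r P) m (1 + t + t') m''"
| While_False: "m r = 0 \<Longrightarrow> ram_run inp (While r P) m 1 m"

text \<open>A sign is stored as a bit, \<open>1\<close> as \<open>0\<close> and \<open>-1\<close> as a nonzero number.

  The program is given the parameters \<open>n\<close>, \<open>k\<close>, \<open>b\<close>, \<open>\<epsilon>\<close> and the seed \<open>y\<close>, but neither the class
  of functions nor the seed length. The real parameters enter through integers: rounding \<open>b\<close> up to
  \<open>\<lceil>b\<rceil> \<le> 2 * b\<close> and \<open>\<epsilon>\<close> down to \<open>8 / \<lceil>8 / \<epsilon>\<rceil>\<close>, which is at least \<open>4/5 * \<epsilon>\<close> for \<open>\<epsilon> \<le> 2\<close>, changes a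
  seed length bound by a constant factor only. (Errors \<open>\<epsilon> \<ge> 2\<close> are trivial; \<open>\<lceil>1 / \<epsilon>\<rceil>\<close> would be too
  coarse, since it does not tell \<open>1\<close> from such \<open>\<epsilon>\<close>.)\<close>

definition ram_input :: "nat \<Rightarrow> nat \<Rightarrow> real \<Rightarrow> real \<Rightarrow> nat \<Rightarrow> (nat \<Rightarrow> real) \<Rightarrow> nat list" where
  "ram_input n k b \<epsilon> s y =
     [n, k, nat \<lceil>b\<rceil>, nat \<lceil>8 / \<epsilon>\<rceil>] @ map (\<lambda>i. if y i = 1 then 0 else 1) [0..<s]"

text \<open>Polynomial time means time polynomial in the output length \<open>n\<close>, the seed length \<open>s\<close> and the
  bit lengths of the remaining parameters. The output is read off from the cells starting at the
  address in cell \<open>0\<close>. To be explicit is a property of families: the program \<open>P\<close> and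
  the polynomial \<open>q\<close> have to be chosen independently of all parameters.\<close>

definition explicit_generator ::
    "ram \<Rightarrow> nat poly \<Rightarrow> nat \<Rightarrow> nat \<Rightarrow> real \<Rightarrow> real \<Rightarrow> nat
       \<Rightarrow> ((nat \<Rightarrow> real) \<Rightarrow> nat \<Rightarrow> real) \<Rightarrow> bool" where
  "explicit_generator P q n k b \<epsilon> s G \<longleftrightarrow> G \<in> cube s \<rightarrow> cube n \<and>
     (\<forall>y\<in>cube s. \<exists>t m.
        ram_run (ram_input n k b \<epsilon> s y) P (\<lambda>_. 0) t m \<and>
        t \<le> poly q (n + s + floorlog 2 k + floorlog 2 (nat \<lceil>b\<rceil>) + floorlog 2 (nat \<lceil>8 / \<epsilon>\<rceil>)) \<and>
        (\<forall>i<n. G y i = (if m (m 0 + i) = 0 then 1 else -1)))"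

lemma ram_run_deterministic:
  "ram_run inp P m t m' \<Longrightarrow> ram_run inp P m u m'' \<Longrightarrow> t = u \<and> m' = m''"
proof (induction arbitrary: u m'' rule: ram_run.induct)
  case (Seq P m t m' Q t' m'' u n'')
  from Seq.prems show ?case
    by (cases rule: ram_run.cases) (auto dest: Seq.IH)
next
  case (Cond_True m r P t m' Q u n'')
  from Cond_True.prems Cond_True.hyps show ?case
    by (cases rule: ram_run.cases) (auto dest: Cond_True.IH)
next
  case (Cond_False m r Q t m' P u n'')
  from Cond_False.prems Cond_False.hyps show ?case
    by (cases rule: ram_run.cases) (auto dest: Cond_False.IH)
next
  case (While_True m r P t m' t' m'' u n'')
  from While_True.prems While_True.hyps show ?case
    by (cases rule: ram_run.cases) (auto dest: While_True.IH)
qed (erule ram_run.cases; simp)+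

end

theory Submission
  imports
    Defs
    "HOL-Number_Theory.Cong"
    "HOL-Computational_Algebra.Field_as_Ring"
    "HOL-Computational_Algebra.Polynomial_Factorial"
    "HOL-Library.Z2"
begin

text \<open>The generator rounds a polarizing random walk on \<open>[-1, 1] ^ n\<close> to the signs of its end point. A step moves
  the coordinate \<open>X i\<close> by \<open>(1 - \<bar>X i\<bar>) * \<alpha> * \<xi> i\<close>, where the sign vector \<open>\<xi>\<close> is drawn from a small-bias
  distribution. Around \<open>X\<close>, the multilinear extension of \<open>f\<close> is an average of extensions of restrictions of
  \<open>f\<close> at the point \<open>\<alpha> \<xi>\<close>. There, the small bias takes care of the levels below \<open>k\<close>, and all levels from
  \<open>k\<close> on together contribute at most \<open>(2 \<alpha> b) ^ k\<close>: by Taylor's formula, this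
  amounts to a bound on the \<open>k\<close>-th Taylor coefficient in direction \<open>\<xi>\<close> at an intermediate point, which is, up
  to scaling, an average of level \<open>k\<close> parts of restrictions. As
  \<open>sqrt (1 - \<bar>X i\<bar>)\<close> shrinks by a factor \<open>1 - \<alpha>\<^sup>2 / 32\<close> per step on average, \<open>O(log (n / \<epsilon>) / \<alpha>\<^sup>2)\<close>
  steps suffice, and \<open>\<alpha>\<close> is the largest power \<open>1 / 2 ^ a\<close> for which the step errors sum up to
  \<open>O(\<epsilon>)\<close>.

  The sign vectors come from the powering construction over the field with \<open>2 ^ (2 * 3 ^ l)\<close>
  elements, defined by the explicit irreducible trinomial \<open>X ^ (2 * 3 ^ l) + X ^ 3 ^ l + 1\<close>. If the resulting
  seed would be longer than \<open>n\<close>, the generator is the identity. For errors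
  \<open>\<epsilon>\<close> that every constant generator achieves, the seed is empty.\<close>

subsection \<open>Irreducible trinomials over the field with two elements\<close>

text \<open>A coordinate of the walk has almost no drift, so the mean of the gap
  \<open>1 - \<bar>X i\<bar>\<close> gives no progress; the concave square root gains a second-order
  term, whence the \<open>\<alpha>\<^sup>2\<close> in the number of steps. That number grows like
  \<open>4 ^ a\<close>, while the error of a step shrinks like \<open>2 ^ (- a * k)\<close>: only
  \<open>a * (k - 2)\<close> bits are gained on balance, which is the origin of the exponents with
  \<open>k - 2\<close>. For a seed with log log n, the bias may depend on \<open>n\<close> only
  through its bit length. Therefore an index is hashed by evaluating the polynomial of its binary
  digits, and only sets of size below \<open>k\<close> are fooled, for which about \<open>k\<close>
  powers suffice. The admissible field degrees grow by factors of three, which costs a constant and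
  spares any search for an irreducible polynomial. The machine cannot multiply and has to cope with
  all parameters. Steps are powers of two because these are shifts; \<open>k\<close> is replaced by
  \<open>min k (n + 1)\<close>, as level \<open>n + 1\<close> is empty; and all loops after the
  set-up are clipped. The one count that may exceed the clip, the number of steps, drives a loop
  only when the seed is shorter than \<open>n\<close>.\<close>

instantiation bit ::
  "{unique_euclidean_ring, normalization_euclidean_semiring, normalization_semidom_multiplicative}"
begin

definition [simp]: "normalize_bit = (normalize_field :: bit \<Rightarrow> _)"
definition [simp]: "unit_factor_bit = (unit_factor_field :: bit \<Rightarrow> _)"
definition [simp]: "euclidean_size_bit = (euclidean_size_field :: bit \<Rightarrow> _)"
definition [simp]: "division_segment (x :: bit) = 1"

instance
  by standard (simp_all add: dvd_field_iff field_split_simps split: if_splits)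

end

instantiation bit :: euclidean_ring_gcd
begin

definition gcd_bit :: "bit \<Rightarrow> bit \<Rightarrow> bit" where
  "gcd_bit = Euclidean_Algorithm.gcd"
definition lcm_bit :: "bit \<Rightarrow> bit \<Rightarrow> bit" where
  "lcm_bit = Euclidean_Algorithm.lcm"
definition Gcd_bit :: "bit set \<Rightarrow> bit" where
  "Gcd_bit = Euclidean_Algorithm.Gcd"
definition Lcm_bit :: "bit set \<Rightarrow> bit" where
  "Lcm_bit = Euclidean_Algorithm.Lcm"

instance
  by standard (simp_all add: gcd_bit_def lcm_bit_def Gcd_bit_def Lcm_bit_def)

end

text \<open>This turns \<open>bit poly\<close> into a Euclidean ring with gcds, which supplies
  irreducible divisors and Bezout coefficients below.\<close>

instance bit :: field_gcd ..

text \<open>Representatives of the residues modulo a polynomial of degree \<open>d\<close>; they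
  double as the values of \<open>d\<close> seed bits.\<close>

definition bit_polys :: "nat \<Rightarrow> bit poly set" where
  "bit_polys d = {g. \<forall>j\<ge>d. coeff g j = 0}"

lemma coeff_sum_monom:
  "coeff (\<Sum>j<d. monom (c j) j) i = (if i < d then c i else 0)"
  by (simp add: coeff_sum coeff_monom sum.delta)

lemma bij_betw_bit_polys:
  "bij_betw (\<lambda>A. \<Sum>j<d. monom (of_bool (j \<in> A)) j) (Pow {..<d}) (bit_polys d)"
proof (rule bij_betw_byWitness[where f' = "\<lambda>g. {j. coeff g j = 1}"])
  show "\<forall>A\<in>Pow {..<d}. {j. coeff (\<Sum>j<d. monom (of_bool (j \<in> A)) j :: bit poly) j = 1} = A"
    by (auto simp: coeff_sum_monom split: if_splits)
  show "\<forall>g\<in>bit_polys d. (\<Sum>j<d. monom (of_bool (j \<in> {j. coeff g j = 1})) j) = g"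
  proof
    fix g assume "g \<in> bit_polys d"
    then show "(\<Sum>j<d. monom (of_bool (j \<in> {j. coeff g j = 1})) j) = g"
      by (intro poly_eqI) (auto simp: coeff_sum_monom bit_polys_def)
  qed
  show "(\<lambda>A. \<Sum>j<d. monom (of_bool (j \<in> A)) j) ` Pow {..<d} \<subseteq> bit_polys d"
    by (auto simp: coeff_sum_monom bit_polys_def)
  show "(\<lambda>g. {j. coeff g j = 1}) ` bit_polys d \<subseteq> Pow {..<d}"
    by (auto simp: bit_polys_def not_le[symmetric])
qed

lemma finite_bit_polys [simp]: "finite (bit_polys d)"
  using bij_betw_finite[OF bij_betw_bit_polys, of d] by simp

lemma card_bit_polys [simp]: "card (bit_polys d) = 2 ^ d"
  using bij_betw_same_card[OF bij_betw_bit_polys, of d] by (simp add: card_Pow)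

lemma bit_polys_eq_degree: "d > 0 \<Longrightarrow> bit_polys d = {g. degree g < d}"
  by (auto simp: bit_polys_def coeff_eq_0 intro: le_less_trans[OF degree_le, of "d - 1"])

lemma bit_polys_add: "g \<in> bit_polys d \<Longrightarrow> h \<in> bit_polys d \<Longrightarrow> g + h \<in> bit_polys d"
  by (simp add: bit_polys_def)

lemma bit_double: "x + x = (0 :: bit)"
  by (cases x) simp_all

lemma bit_poly_double [simp]: "g + g = (0 :: bit poly)"
  by (rule poly_eqI) (simp only: coeff_add coeff_0 bit_double)

lemma bit_poly_minus [simp]: "g - h = (g + h :: bit poly)"
  by (simp add: poly_eq_iff)

lemma mod_mem_bit_polys: "degree p > 0 \<Longrightarrow> g mod p \<in> bit_polys (degree p)"
  using degree_mod_less'[of p g]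
  by (cases "g mod p = 0"; cases "p = 0") (auto simp: bit_polys_eq_degree)

text \<open>In characteristic two \<open>g + h\<close> is the difference, and its degree is too
  small for a nonzero multiple of \<open>p\<close>.\<close>

lemma dvd_bit_polys_eq:
  assumes "g \<in> bit_polys d" "h \<in> bit_polys d" "degree p = d" "d > 0" "p dvd g + h"
  shows "g = h"
proof (rule ccontr)
  assume "g \<noteq> h"
  then have "g + h \<noteq> 0"
    by (metis add_eq_0_iff bit_poly_double)
  with assms(5) have "degree p \<le> degree (g + h)"
    by (rule dvd_imp_degree_le)
  moreover have "degree (g + h) < d"
    using bit_polys_add[OF assms(1,2)] assms(4) by (simp add: bit_polys_eq_degree)
  ultimately show False
    using assms(3) by simp
qed

text \<open>Multiplication by \<open>h\<close> permutes the nonzero residues modulo \<open>p\<close>, so their product does not change.\<close>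

lemma fermat_bit_poly:
  fixes p h :: "bit poly"
  assumes p: "prime_elem p" "degree p = d" "d > 0" and h: "\<not> p dvd h"
  shows "[h ^ (2 ^ d - 1) = 1] (mod p)"
proof -
  define R where "R = bit_polys d - {0}"
  have zero: "0 \<in> bit_polys d" by (simp add: bit_polys_def)
  have R: "finite R" "card R = 2 ^ d - 1"
    using zero by (simp_all add: R_def)
  have ndvd: "\<not> p dvd g" if "g \<in> R" for g
    using dvd_bit_polys_eq[of g d 0 p] that p zero by (auto simp: R_def)
  have inj: "inj_on (\<lambda>g. (h * g) mod p) R"
  proof (rule inj_onI)
    fix g g' assume g: "g \<in> R" "g' \<in> R" "h * g mod p = h * g' mod p"
    then have "p dvd h * (g + g')"
      by (metis bit_poly_minus distrib_left mod_eq_dvd_iff)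
    with p h have "p dvd g + g'"
      by (simp add: prime_elem_dvd_mult_iff)
    then show "g = g'"
      using dvd_bit_polys_eq[of g d g' p] g p by (simp add: R_def)
  qed
  have "(\<lambda>g. (h * g) mod p) ` R \<subseteq> R"
  proof
    fix r assume "r \<in> (\<lambda>g. (h * g) mod p) ` R"
    then obtain g where g: "g \<in> R" "r = h * g mod p" by blast
    have "\<not> p dvd h * g"
      using ndvd[OF g(1)] h p by (simp add: prime_elem_dvd_mult_iff)
    then have "r \<noteq> 0" using g by (simp add: mod_eq_0_iff_dvd)
    then show "r \<in> R"
      using mod_mem_bit_polys[of p "h * g"] p g by (simp add: R_def)
  qed
  then have img: "(\<lambda>g. (h * g) mod p) ` R = R"
    using inj R(1) by (simp add: endo_inj_surj)
  have "[(\<Prod>g\<in>R. h * g) = (\<Prod>g\<in>R. (h * g) mod p)] (mod p)"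
    by (intro cong_prod) simp
  also have "(\<Prod>g\<in>R. (h * g) mod p) = \<Prod>R"
    using prod.reindex[OF inj, of "\<lambda>x. x"] img by simp
  finally have "[h ^ card R * \<Prod>R = \<Prod>R] (mod p)"
    by (simp add: prod.distrib)
  then have "p dvd (h ^ card R - 1) * \<Prod>R"
    by (metis cong_iff_dvd_diff left_diff_distrib mult_1)
  moreover have "\<not> p dvd \<Prod>R"
    using R(1) ndvd
  proof (induction R rule: finite_induct)
    case empty
    then show ?case using p(1) by (simp add: prime_elem_def)
  next
    case (insert g G)
    then show ?case using p(1) by (simp add: prime_elem_dvd_mult_iff)
  qed
  ultimately have "p dvd h ^ card R - 1"
    using p by (simp add: prime_elem_dvd_mult_iff del: bit_poly_minus)
  then show ?thesis
    using R by (simp add: cong_iff_dvd_diff)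
qed

section \<open>Powers of two modulo powers of three\<close>

lemma one_plus_power_expansion: "\<exists>w. (1 + v) ^ c = 1 + c * v + v ^ 2 * (w :: nat)"
proof (induction c)
  case (Suc c)
  then obtain w where "(1 + v) ^ c = 1 + c * v + v ^ 2 * w" by blast
  then have "(1 + v) ^ Suc c = 1 + Suc c * v + v ^ 2 * (c + w + v * w)"
    by (simp add: algebra_simps power2_eq_square)
  then show ?case by blast
qed auto

text \<open>Lifting the exponent: the cube of \<open>1 + 3 ^ Suc l * z\<close> with \<open>z\<close>
  congruent to 1 modulo 3 has the same shape one level up. The factor \<open>3 * u + 1\<close>
  records that \<open>2 ^ (2 * 3 ^ l) - 1\<close> contains no further factor three.\<close>

lemma power_2_3_expansion: "\<exists>u. 2 ^ (2 * 3 ^ l) = 1 + 3 ^ Suc l * (3 * u + 1 :: nat)"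
proof (induction l)
  case 0
  show ?case by (rule exI[of _ 0]) simp
next
  case (Suc l)
  then obtain u where u: "2 ^ (2 * 3 ^ l) = 1 + 3 ^ Suc l * (3 * u + 1 :: nat)" by blast
  define z where "z = 3 * u + (1 :: nat)"
  have "(2 :: nat) ^ (2 * 3 ^ Suc l) = (2 ^ (2 * 3 ^ l)) ^ 3"
    by (simp add: power_mult[symmetric] mult_ac)
  also have "\<dots> = (1 + 3 ^ Suc l * z) ^ 3"
    using u by (simp add: z_def)
  also have "\<dots> = 1 + 3 ^ Suc (Suc l) * (3 * (u + 3 ^ l * z\<^sup>2 + 3 ^ (2 * l) * z ^ 3) + 1)"
    by (simp add: algebra_simps power2_eq_square power3_eq_cube power_add mult_2 mult_2_right z_def)
  finally show ?case by blast
qed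

text \<open>This is the primitive root property of 2. With \<open>d = 2 * 3 ^ l * c\<close>, the
  number \<open>2 ^ d - 1\<close> is \<open>c * v\<close> to first order, where \<open>v\<close>
  contains exactly \<open>l + 1\<close> factors three; one more has to come from
  \<open>c\<close>.\<close>

lemma order_2_mod_power_3: "3 ^ Suc l dvd (2 ^ d - 1 :: nat) \<Longrightarrow> 2 * 3 ^ l dvd d"
proof (induction l)
  case 0
  have "even d"
  proof (rule ccontr)
    assume "odd d"
    then obtain c where "d = 2 * c + 1" by (elim oddE)
    then have "(2 :: nat) ^ d = 2 * 4 ^ c"
      by (simp add: power_mult)
    moreover have "[4 ^ c = 1 ^ c] (mod (3 :: nat))"
      by (rule cong_pow) (simp add: cong_def)
    then have "[2 * 4 ^ c = 2 * 1 ^ c] (mod (3 :: nat))"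
      by (rule cong_scalar_left)
    ultimately have "[2 ^ d = 2] (mod (3 :: nat))"
      by simp
    moreover have "[2 ^ d = 1] (mod (3 :: nat))"
      using 0 cong_altdef_nat[of 1 "2 ^ d" 3] by (simp add: cong_sym_eq)
    ultimately show False
      by (simp add: cong_def)
  qed
  then show ?case by simp
next
  case (Suc l)
  have "3 ^ Suc l dvd (3 ^ Suc (Suc l) :: nat)" by simp
  then have "2 * 3 ^ l dvd d"
    using Suc by (meson dvd_trans)
  then obtain c where c: "d = 2 * 3 ^ l * c" by blast
  obtain u where u: "2 ^ (2 * 3 ^ l) = 1 + 3 ^ Suc l * (3 * u + 1 :: nat)"
    using power_2_3_expansion by blast
  define v where "v = 3 ^ Suc l * (3 * u + 1)"
  obtain w where "(1 + v) ^ c = 1 + c * v + v ^ 2 * w"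
    using one_plus_power_expansion by blast
  then have "2 ^ d - 1 = c * v + v ^ 2 * w"
    using u c by (simp add: power_mult v_def)
  moreover have "3 ^ Suc (Suc l) dvd v ^ 2 * w"
  proof -
    have "v ^ 2 * w = 3 ^ Suc (Suc l) * (3 ^ l * (3 * u + 1) ^ 2 * w)"
      unfolding v_def power_mult_distrib by (simp add: power2_eq_square algebra_simps)
    then show ?thesis by (simp only: dvd_triv_left)
  qed
  ultimately have "3 ^ Suc (Suc l) dvd c * v"
    using Suc.prems dvd_add_left_iff[of "3 ^ Suc (Suc l)" "v ^ 2 * w" "c * v"] by simp
  moreover have "3 ^ Suc (Suc l) = 3 ^ Suc l * (3 :: nat)"
    by simp
  moreover have "c * v = 3 ^ Suc l * (c * (3 * u + 1))"
    unfolding v_def by (rule mult.left_commute)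
  ultimately have "3 ^ Suc l * 3 dvd 3 ^ Suc l * (c * (3 * u + 1))"
    by (simp only:)
  then have "3 dvd c * (3 * u + 1)"
    using dvd_times_left_cancel_iff[of "3 ^ Suc l" 3 "c * (3 * u + 1)"]
    by (metis power_not_zero zero_neq_numeral)
  moreover have "prime (3 :: nat)" "\<not> 3 dvd 3 * u + 1"
    by simp presburger
  ultimately have "3 dvd c"
    by (simp only: prime_dvd_mult_iff) simp
  then show ?case
    using c by (auto simp: dvd_def)
qed

text \<open>The cyclotomic polynomial of index \<open>3 ^ (l + 1)\<close>, reduced modulo
  two.\<close>

definition trinomial :: "nat \<Rightarrow> bit poly" where
  "trinomial l = monom 1 (2 * 3 ^ l) + monom 1 (3 ^ l) + 1"

lemma degree_trinomial: "degree (trinomial l) = 2 * 3 ^ l"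
proof -
  have "degree (monom 1 (3 ^ l) + 1 :: bit poly) \<le> 3 ^ l"
    by (intro degree_add_le) (auto simp: degree_monom_eq)
  also have "\<dots> < 2 * 3 ^ l" by simp
  finally show ?thesis
    unfolding trinomial_def add.assoc
    by (subst degree_add_eq_left) (auto simp: degree_monom_eq)
qed

lemma trinomial_altdef: "trinomial l = (monom 1 1 ^ 3 ^ l) ^ 2 + monom 1 1 ^ 3 ^ l + 1"
  by (simp add: trinomial_def monom_power power_mult[symmetric] mult.commute)

text \<open>Modulo an irreducible factor \<open>p\<close>, the element \<open>X\<close> has order exactly \<open>3 ^ (l + 1)\<close>, and
  \<open>2\<close> is a primitive root modulo this power of three, so the degree of \<open>p\<close> is at least
  that of the trinomial.\<close>

lemma degree_factor_trinomial:
  assumes p: "prime_elem p" "p dvd trinomial l"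
  shows "degree p \<ge> 2 * 3 ^ l"
proof -
  define x :: "bit poly" where "x = monom 1 1"
  define d where "d = degree p"
  have dpos: "d > 0"
    using p(1) by (metis d_def prime_elem_def is_unit_iff_degree gr0I)
  have f: "p dvd (x ^ 3 ^ l)\<^sup>2 + x ^ 3 ^ l + 1"
    using p(2) by (simp add: trinomial_altdef x_def)
  have "(x ^ 3 ^ l) ^ 3 - 1 = (x ^ 3 ^ l - 1) * ((x ^ 3 ^ l)\<^sup>2 + x ^ 3 ^ l + 1)"
    by (simp add: algebra_simps power2_eq_square power3_eq_cube del: bit_poly_minus)
  with f have "p dvd (x ^ 3 ^ l) ^ 3 - 1"
    by (metis dvd_mult)
  then have one: "[x ^ 3 ^ Suc l = 1] (mod p)"
    by (simp add: cong_iff_dvd_diff power_mult[symmetric] mult.commute del: bit_poly_minus)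
  have ndvd: "\<not> p dvd 1"
    using p(1) by (simp add: prime_elem_def)
  have "\<not> p dvd x"
  proof
    assume "p dvd x"
    then have "p dvd x ^ 3 ^ Suc l"
      by (meson dvd_trans dvd_power zero_less_power zero_less_numeral)
    then show False
      using one ndvd by (metis cong_dvd_iff)
  qed
  then have "[x ^ (2 ^ d - 1) = 1] (mod p)"
    using fermat_bit_poly[OF p(1)] dpos d_def by simp
  \<comment> \<open>The order of \<open>x\<close> divides both \<open>3 ^ Suc l\<close> and
    \<open>2 ^ d - 1\<close>, hence their gcd, which is a power of three.\<close>
  obtain r where r: "r \<le> Suc l" "gcd (3 ^ Suc l) (2 ^ d - 1) = (3 ^ r :: nat)"
    using divides_primepow_nat[of 3 "gcd (3 ^ Suc l) (2 ^ d - 1)" "Suc l"] by auto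
  obtain u v where uv: "3 ^ Suc l * u = (2 ^ d - 1) * v + (3 ^ r :: nat)"
    using bezout_nat[of "3 ^ Suc l" "2 ^ d - 1"] r(2) by auto
  have "[x ^ 3 ^ r = x ^ ((2 ^ d - 1) * v) * x ^ 3 ^ r] (mod p)"
    using cong_mult[OF cong_pow[OF \<open>[x ^ (2 ^ d - 1) = 1] (mod p)\<close>, of v] cong_refl[of "x ^ 3 ^ r" p]]
    by (simp add: power_mult cong_sym_eq)
  also have "x ^ ((2 ^ d - 1) * v) * x ^ 3 ^ r = (x ^ 3 ^ Suc l) ^ u"
    by (simp only: power_add[symmetric] uv[symmetric] power_mult[symmetric])
  also have "[\<dots> = 1] (mod p)"
    using cong_pow[OF one, of u] by simp
  finally have r1: "[x ^ 3 ^ r = 1] (mod p)" .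
  \<comment> \<open>For \<open>r \<le> l\<close>, the power \<open>x ^ 3 ^ l\<close> would be 1
    modulo \<open>p\<close>, and the trinomial would be \<open>1 + 1 + 1 = 1\<close> there instead
    of 0.\<close>
  have "r = Suc l"
  proof (rule ccontr)
    assume "r \<noteq> Suc l"
    then obtain t where "l = r + t" using r(1) by (metis le_Suc_eq nat_le_iff_add)
    then have "x ^ 3 ^ l = (x ^ 3 ^ r) ^ 3 ^ t"
      by (simp add: power_mult[symmetric] power_add)
    then have l1: "[x ^ 3 ^ l = 1] (mod p)"
      using cong_pow[OF r1, of "3 ^ t"] by simp
    have "[(x ^ 3 ^ l)\<^sup>2 + x ^ 3 ^ l + 1 = 1\<^sup>2 + 1 + 1] (mod p)"
      by (intro cong_add cong_pow l1 cong_refl)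
    then have "[(x ^ 3 ^ l)\<^sup>2 + x ^ 3 ^ l + 1 = 1] (mod p)"
      by (simp add: add.assoc)
    with f ndvd show False
      by (metis cong_dvd_iff)
  qed
  then have "3 ^ Suc l dvd (2 ^ d - 1 :: nat)"
    using r(2) by (metis gcd_dvd2)
  then have "2 * 3 ^ l dvd d"
    by (rule order_2_mod_power_3)
  then show ?thesis
    using dpos by (auto simp: d_def dest: dvd_imp_le)
qed

text \<open>An irreducible factor already has the full degree, so its cofactor is constant.\<close>

theorem prime_trinomial: "prime_elem (trinomial l)"
proof -
  have "trinomial l \<noteq> 0"
    using degree_trinomial[of l] by auto
  then have "\<not> is_unit (trinomial l)"
    using degree_trinomial[of l] by (simp add: is_unit_iff_degree)
  with \<open>trinomial l \<noteq> 0\<close> obtain p where p: "p dvd trinomial l" "prime p"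
    using prime_divisor_exists[of "trinomial l"] by auto
  then obtain c where c: "trinomial l = p * c" by blast
  have "c \<noteq> 0" "p \<noteq> 0"
    using c \<open>trinomial l \<noteq> 0\<close> by auto
  then have "degree p + degree c = 2 * 3 ^ l"
    using degree_trinomial[of l] c by (simp add: degree_mult_eq)
  moreover have "degree p \<ge> 2 * 3 ^ l"
    using degree_factor_trinomial p by (simp add: prime_def)
  ultimately have "degree c = 0" by simp
  then have "is_unit c"
    using \<open>c \<noteq> 0\<close> by (simp add: is_unit_iff_degree)
  then show ?thesis
    using p c by (simp add: prime_def prime_elem_mult_unit_left mult.commute)
qed

text \<open>The factor theorem modulo \<open>p\<close>, phrased by divisibility so that no quotient
  ring has to be formed: \<open>inj\<close> says that \<open>A\<close> consists of distinct
  residues, and the last assumption that \<open>P\<close> is not zero modulo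
  \<open>p\<close>.\<close>

lemma card_roots_mod_prime_elem:
  fixes P :: "'a :: idom_divide poly"
  assumes p: "prime_elem p" and "finite A" and inj: "\<And>a b. a \<in> A \<Longrightarrow> b \<in> A \<Longrightarrow> p dvd a - b \<Longrightarrow> a = b"
    and "\<not> [:p:] dvd P"
  shows "card {a \<in> A. p dvd poly P a} \<le> degree P"
  using \<open>\<not> [:p:] dvd P\<close>
proof (induction "degree P" arbitrary: P)
  case 0
  then obtain c where "P = [:c:]"
    by (metis degree_eq_zeroE)
  with 0 have "{a \<in> A. p dvd poly P a} = {}"
    by (auto simp: const_poly_dvd_const_poly_iff)
  then show ?case by (simp only: card.empty)
next
  case (Suc d)
  show ?case
  proof (cases "{a \<in> A. p dvd poly P a} = {}")
    case True
    then show ?thesis by (simp only: card.empty)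
  next
    case False
    then obtain a where a: "a \<in> A" "p dvd poly P a" by blast
    define Q where "Q = synthetic_div P a"
    have P: "P = [:- a, 1:] * Q + [:poly P a:]"
      unfolding Q_def by (rule synthetic_div_correct'[symmetric])
    have "\<not> [:p:] dvd Q"
    proof
      assume "[:p:] dvd Q"
      then have "[:p:] dvd [:- a, 1:] * Q + [:poly P a:]"
        using a by (intro dvd_add dvd_mult) (simp_all add: const_poly_dvd_const_poly_iff)
      then show False using Suc.prems P by simp
    qed
    moreover have Q: "d = degree Q"
      using Suc.hyps(2) by (simp add: Q_def degree_synthetic_div)
    ultimately have "card {b \<in> A. p dvd poly Q b} \<le> d"
      using Suc.hyps(1) by blast
    moreover have "{b \<in> A. p dvd poly P b} \<subseteq> insert a {b \<in> A. p dvd poly Q b}"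
    proof
      fix b assume b: "b \<in> {b \<in> A. p dvd poly P b}"
      have "poly P b = (b - a) * poly Q b + poly P a"
        by (subst P) (simp add: algebra_simps)
      then have "p dvd (b - a) * poly Q b"
        using a b by (metis (no_types, lifting) dvd_add_left_iff mem_Collect_eq)
      then show "b \<in> insert a {b \<in> A. p dvd poly Q b}"
        using p b a inj by (auto simp: prime_elem_dvd_mult_iff)
    qed
    then have "card {b \<in> A. p dvd poly P b} \<le> card (insert a {b \<in> A. p dvd poly Q b})"
      by (intro card_mono) (simp_all add: \<open>finite A\<close>)
    ultimately show ?thesis
      using Suc.hyps(2) card_insert_le_m1[of "Suc d" "{b \<in> A. p dvd poly Q b}" a]
      by (simp add: card_insert_if \<open>finite A\<close> split: if_splits)
  qed
qed

text \<open>A Vandermonde argument: the polynomial vanishing at all the other points is a linear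
  combination of the powers.\<close>

lemma power_sum_not_dvd:
  fixes c :: "'i \<Rightarrow> 'a :: idom"
  assumes p: "prime_elem p" and S: "finite S" "i0 \<in> S"
    and sep: "\<And>i. i \<in> S - {i0} \<Longrightarrow> \<not> p dvd c i0 - c i"
  shows "\<exists>e<card S. \<not> p dvd (\<Sum>i\<in>S. c i ^ e)"
proof (rule ccontr)
  assume *: "\<not> ?thesis"
  define Q where "Q = (\<Prod>i\<in>S - {i0}. [:- c i, 1:])"
  have deg: "degree Q = card S - 1"
    using S by (simp add: Q_def degree_prod_eq_sum_degree)
  then have deg': "degree Q < card S"
    using S by (metis card_gt_0_iff diff_less empty_iff zero_less_one)
  have zero: "poly Q (c i) = 0" if "i \<in> S - {i0}" for i
    using that S by (auto simp: Q_def poly_prod intro!: prod_zero bexI[of _ i])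
  have "\<not> p dvd (\<Prod>i\<in>T. c i0 - c i)" if "finite T" "T \<subseteq> S - {i0}" for T
    using that
  proof (induction T rule: finite_induct)
    case empty
    then show ?case using p by (simp add: prime_elem_def)
  next
    case (insert i T)
    then show ?case using p sep by (auto simp: prime_elem_dvd_mult_iff)
  qed
  then have "\<not> p dvd poly Q (c i0)"
    using S by (simp add: Q_def poly_prod)
  moreover have "(\<Sum>i\<in>S. poly Q (c i)) = poly Q (c i0)"
    using S zero by (simp add: sum.remove)
  moreover have "(\<Sum>i\<in>S. poly Q (c i)) = (\<Sum>e\<le>degree Q. coeff Q e * (\<Sum>i\<in>S. c i ^ e))"
    unfolding poly_altdef sum_distrib_left by (rule sum.swap)
  moreover have "p dvd (\<Sum>e\<le>degree Q. coeff Q e * (\<Sum>i\<in>S. c i ^ e))"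
  proof (rule dvd_sum)
    fix e assume "e \<in> {..degree Q}"
    then have "e < card S" using deg' by simp
    then show "p dvd coeff Q e * (\<Sum>i\<in>S. c i ^ e)" using * by (intro dvd_mult) blast
  qed
  ultimately show False by simp
qed

subsection \<open>A small-bias generator\<close>

text \<open>The functional \<open>bit_functional l\<close> is the constant coefficient of the reduction modulo
  \<open>trinomial l\<close>: since \<open>X ^ 3 ^ (l + 1) = 1\<close> there, only exponents modulo \<open>3 ^ (l + 1)\<close> matter.\<close>

definition good_exponent :: "nat \<Rightarrow> nat \<Rightarrow> bool" where
  "good_exponent l j \<longleftrightarrow> j mod 3 ^ Suc l = 0 \<or> j mod 3 ^ Suc l = 2 * 3 ^ l"

definition bit_functional :: "nat \<Rightarrow> bit poly \<Rightarrow> bit" where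
  "bit_functional l v = (\<Sum>j\<le>degree v. of_bool (good_exponent l j) * coeff v j)"

lemma bit_functional_eq:
  assumes "degree v < D"
  shows "bit_functional l v = (\<Sum>j<D. of_bool (good_exponent l j) * coeff v j)"
  unfolding bit_functional_def
proof (rule sum.mono_neutral_left)
  show "{..degree v} \<subseteq> {..<D}" using assms by auto
qed (simp_all add: coeff_eq_0)

lemma bit_functional_add: "bit_functional l (v + w) = bit_functional l v + bit_functional l w"
proof -
  define D where "D = Suc (max (degree v) (degree w))"
  have "degree v < D" "degree w < D" "degree (v + w) < D"
    by (auto simp: D_def less_Suc_eq_le degree_add_le)
  then show ?thesis
    by (simp only: bit_functional_eq sum.distrib[symmetric] coeff_add distrib_left)
qed

lemma bit_functional_0 [simp]: "bit_functional l 0 = 0"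
  by (simp add: bit_functional_def)

lemma bit_functional_sum: "bit_functional l (\<Sum>i\<in>S. g i) = (\<Sum>i\<in>S. bit_functional l (g i))"
  by (induction S rule: infinite_finite_induct) (simp_all add: bit_functional_add)

lemma bit_functional_monom: "bit_functional l (monom 1 j) = of_bool (good_exponent l j)"
  by (simp add: bit_functional_def degree_monom_eq coeff_monom sum.delta if_distrib cong: if_cong)

text \<open>With N = \<open>3 ^ l\<close>, modulo the trinomial X^(2 N) equals X^N + 1, which
  explains the second good residue 2 N. Of \<open>j\<close>, \<open>j\<close> + N and
  \<open>j\<close> + 2 N, taken modulo 3 N, either none or exactly two are good, and two ones
  cancel.\<close>

lemma bit_functional_shifted_trinomial: "bit_functional l (monom 1 j * trinomial l) = 0"
proof -
  define N where "N = (3 :: nat) ^ l"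
  have N: "N > 0" by (simp add: N_def)
  have "monom 1 j * trinomial l = monom 1 (j + 2 * N) + monom 1 (j + N) + monom 1 j"
    by (simp add: trinomial_def N_def distrib_left mult_monom)
  then have eq: "bit_functional l (monom 1 j * trinomial l) =
      of_bool (good_exponent l (j + 2 * N)) + of_bool (good_exponent l (j + N)) + of_bool (good_exponent l j)"
    by (simp only: bit_functional_add bit_functional_monom)
  define r where "r = j mod (3 * N)"
  have r: "r < 3 * N" using N by (simp add: r_def)
  have mod: "(j + t) mod (3 * N) = (r + t) mod (3 * N)" for t
    by (simp add: r_def mod_add_left_eq)
  have wrap: "(r + t) mod (3 * N) = (if r + t < 3 * N then r + t else r + t - 3 * N)" if "t \<le> 2 * N" for t
    using that r by (auto simp: mod_if le_mod_geq)
  have *: "good_exponent l (j + t) \<longleftrightarrow> (let s = if r + t < 3 * N then r + t else r + t - 3 * N in s = 0 \<or> s = 2 * N)"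
    if "t \<le> 2 * N" for t
    using that unfolding good_exponent_def power_Suc N_def[symmetric] mod wrap[OF that] by (simp add: Let_def)
  have "good_exponent l j \<longleftrightarrow> r = 0 \<or> r = 2 * N"
    using *[of 0] r by simp
  moreover have "good_exponent l (j + N) \<longleftrightarrow> r = N \<or> r = 2 * N"
    using *[of N] r N by (auto simp: Let_def split: if_splits)
  moreover have "good_exponent l (j + 2 * N) \<longleftrightarrow> r = N \<or> r = 0"
    using *[of "2 * N"] r N by (auto simp: Let_def split: if_splits)
  ultimately show ?thesis
    unfolding eq using N by auto
qed

text \<open>Hence the functional is well defined on residues, although it is evaluated on unreduced
  products.\<close>

lemma bit_functional_dvd:
  assumes "trinomial l dvd v"
  shows "bit_functional l v = 0"
proof -
  obtain q where q: "v = trinomial l * q" using assms by blast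
  have "v = (\<Sum>j\<le>degree q. monom (coeff q j) j * trinomial l)"
    by (subst q, subst poly_as_sum_of_monoms[of q, symmetric]) (simp add: sum_distrib_left sum_distrib_right mult.commute)
  moreover have "bit_functional l (monom c j * trinomial l) = 0" for c j
    by (cases c) (simp_all add: bit_functional_shifted_trinomial)
  ultimately show ?thesis
    by (simp add: bit_functional_sum)
qed

section \<open>Additive characters of the residue field\<close>

definition bit_sign :: "bit \<Rightarrow> real" where
  "bit_sign b = (if b = 0 then 1 else -1)"

lemma bit_sign_add: "bit_sign (a + b) = bit_sign a * bit_sign b"
  by (cases a; cases b) (simp_all add: bit_sign_def)

lemma bit_sign_sum: "finite S \<Longrightarrow> bit_sign (\<Sum>i\<in>S. g i) = (\<Prod>i\<in>S. bit_sign (g i))"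
proof (induction S rule: finite_induct)
  case empty
  then show ?case by (simp add: bit_sign_def)
next
  case (insert i S)
  then show ?case by (simp only: sum.insert prod.insert bit_sign_add simp_thms)
qed

lemma abs_bit_sign [simp]: "\<bar>bit_sign b\<bar> = 1"
  by (simp add: bit_sign_def)

text \<open>Bezout yields a \<open>u0\<close> at which the functional of \<open>u * w\<close> is 1.
  Translation by \<open>u0\<close> permutes the residues and flips every sign, so the sum equals its
  own negative.\<close>

lemma sum_bit_sign_functional:
  assumes "\<not> trinomial l dvd w"
  shows "(\<Sum>u\<in>bit_polys (2 * 3 ^ l). bit_sign (bit_functional l (u * w))) = 0"
proof -
  let ?p = "trinomial l" and ?R = "bit_polys (2 * 3 ^ l)"
  have "coprime ?p w"
    using assms prime_trinomial by (simp add: prime_elem_imp_coprime)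
  then obtain a b where ab: "a * ?p + b * w = 1"
    using bezout_coefficients_fst_snd[of ?p w] by auto
  define u0 where "u0 = b mod ?p"
  have u0: "u0 \<in> ?R"
    using mod_mem_bit_polys[of ?p b] by (simp add: degree_trinomial u0_def)
  have "bit_functional l (a * ?p) + bit_functional l (b * w) = bit_functional l (monom 1 0)"
    by (simp only: bit_functional_add[symmetric] ab monom_eq_1)
  moreover have "bit_functional l (a * ?p) = 0"
    by (simp add: bit_functional_dvd)
  ultimately have bw: "bit_functional l (b * w) = 1"
    by (simp only: bit_functional_monom) (simp add: good_exponent_def)
  have "(b div ?p * ?p + u0) * w = b * w"
    by (simp only: u0_def div_mult_mod_eq)
  then have bw_split: "b * w = (b div ?p * w) * ?p + u0 * w"
    by (simp only: distrib_right mult.assoc mult.commute[of w])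
  have "bit_functional l (b * w) = bit_functional l ((b div ?p * w) * ?p) + bit_functional l (u0 * w)"
    by (simp only: bw_split bit_functional_add)
  then have u0w: "bit_functional l (u0 * w) = 1"
    by (simp add: bw bit_functional_dvd)
  let ?f = "\<lambda>u. bit_sign (bit_functional l (u * w))"
  have bij: "bij_betw (\<lambda>u. u + u0) ?R ?R"
    by (rule bij_betw_byWitness[where f' = "\<lambda>u. u + u0"])
       (auto simp: add.assoc u0 bit_polys_add)
  have "sum ?f ?R = (\<Sum>u\<in>?R. ?f (u + u0))"
    using sum.reindex_bij_betw[OF bij, of ?f] by simp
  also have "\<dots> = - sum ?f ?R"
  proof -
    have "?f (u + u0) = - ?f u" for u
      by (simp only: distrib_right bit_functional_add bit_sign_add u0w) (simp add: bit_sign_def)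
    then show ?thesis by (simp only: sum_negf)
  qed
  finally show ?thesis by simp
qed

text \<open>A hash of \<open>i\<close>: its binary digits become the coefficients of a polynomial
  that is evaluated at a random \<open>x\<close>. The type is left open because the formula is used
  over \<open>nat\<close>, \<open>nat poly\<close> and \<open>bit poly\<close>.\<close>

definition index_value :: "nat \<Rightarrow> nat \<Rightarrow> 'a \<Rightarrow> 'a :: comm_semiring_1" where
  "index_value L i x = (\<Sum>j<L. of_bool (odd (i div 2 ^ j)) * x ^ j)"

text \<open>The first \<open>K\<close> powers of the hash value, compressed by a random
  \<open>y\<close> into a single field element.\<close>

definition power_column :: "nat \<Rightarrow> nat \<Rightarrow> nat \<Rightarrow> 'a \<Rightarrow> 'a \<Rightarrow> 'a :: comm_semiring_1" where
  "power_column K L i x y = (\<Sum>e<K. (index_value L i x * y) ^ e)"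

lemma binary_digits_differ:
  fixes i i' :: nat
  assumes "i < 2 ^ L" "i' < 2 ^ L" "i \<noteq> i'"
  obtains j where "j < L" "odd (i div 2 ^ j) \<noteq> odd (i' div 2 ^ j)"
proof -
  obtain j where j: "odd (i div 2 ^ j) \<noteq> odd (i' div 2 ^ j)"
    using assms(3) bit_eqI[of i i'] by (auto simp: bit_iff_odd)
  have "j < L"
  proof (rule ccontr)
    assume "\<not> j < L"
    then have "(2 :: nat) ^ L \<le> 2 ^ j" by simp
    then have "i < 2 ^ j" "i' < 2 ^ j" using assms by linarith+
    then show False using j by simp
  qed
  with j that show ?thesis by blast
qed

text \<open>As a polynomial in \<open>x\<close>, the difference has the coefficient 1 wherever the
  binary digits differ, and its degree is at most \<open>L\<close>.\<close>

lemma card_index_collisions: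
  assumes "i < 2 ^ L" "i' < 2 ^ L" "i \<noteq> i'"
  shows "card {x \<in> bit_polys (2 * 3 ^ l). trinomial l dvd index_value L i x - index_value L i' x} \<le> L"
proof -
  let ?p = "trinomial l"
  define P :: "bit poly poly" where
    "P = (\<Sum>j<L. monom (of_bool (odd (i div 2 ^ j)) - of_bool (odd (i' div 2 ^ j))) j)"
  have coeff: "coeff P j = (if j < L then of_bool (odd (i div 2 ^ j)) - of_bool (odd (i' div 2 ^ j)) else 0)" for j
    unfolding P_def by (rule coeff_sum_monom)
  have eval: "poly P x = index_value L i x - index_value L i' x" for x
    unfolding P_def index_value_def poly_sum poly_monom sum_subtractf[symmetric] left_diff_distrib ..
  obtain j where j: "j < L" "odd (i div 2 ^ j) \<noteq> odd (i' div 2 ^ j)"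
    using binary_digits_differ assms by metis
  then have "coeff P j = 1"
    by (cases "odd (i div 2 ^ j)") (auto simp: coeff)
  then have ndvd: "\<not> [:?p:] dvd P"
    using prime_trinomial[of l] by (metis const_poly_dvd_iff prime_elem_def)
  have "degree P \<le> L"
    by (rule degree_le) (simp add: coeff)
  moreover have "card {x \<in> bit_polys (2 * 3 ^ l). ?p dvd poly P x} \<le> degree P"
    by (rule card_roots_mod_prime_elem[OF prime_trinomial _ _ ndvd])
       (auto intro: dvd_bit_polys_eq[where p = ?p] simp: degree_trinomial)
  ultimately show ?thesis by (simp add: eval del: bit_poly_minus)
qed

text \<open>As a polynomial in \<open>y\<close>, the sum has the power sums of the hash values as
  coefficients; by the Vandermonde argument, one with exponent below \<open>card S\<close> does not
  vanish.\<close>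

lemma card_column_roots:
  assumes S: "finite S" "i0 \<in> S" "card S \<le> K"
    and sep: "\<And>i. i \<in> S - {i0} \<Longrightarrow> \<not> trinomial l dvd index_value L i0 x - index_value L i x"
  shows "card {y \<in> bit_polys (2 * 3 ^ l). trinomial l dvd (\<Sum>i\<in>S. power_column K L i x y)} \<le> K"
proof -
  let ?p = "trinomial l"
  define P :: "bit poly poly" where "P = (\<Sum>e<K. monom (\<Sum>i\<in>S. index_value L i x ^ e) e)"
  have coeff: "coeff P e = (if e < K then \<Sum>i\<in>S. index_value L i x ^ e else 0)" for e
    unfolding P_def by (rule coeff_sum_monom)
  have eval: "poly P y = (\<Sum>i\<in>S. power_column K L i x y)" for y
  proof -
    have "poly P y = (\<Sum>e<K. \<Sum>i\<in>S. (index_value L i x * y) ^ e)"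
      by (simp add: P_def poly_sum poly_monom sum_distrib_right power_mult_distrib)
    also have "\<dots> = (\<Sum>i\<in>S. power_column K L i x y)"
      unfolding power_column_def by (rule sum.swap)
    finally show ?thesis .
  qed
  have "\<exists>e<card S. \<not> ?p dvd (\<Sum>i\<in>S. index_value L i x ^ e)"
  proof (rule power_sum_not_dvd)
    show "prime_elem ?p" by (rule prime_trinomial)
    show "finite S" "i0 \<in> S" by fact+
    show "\<not> ?p dvd index_value L i0 x - index_value L i x" if "i \<in> S - {i0}" for i
      using that by (rule sep)
  qed
  then obtain e where e: "e < card S" "\<not> ?p dvd (\<Sum>i\<in>S. index_value L i x ^ e)"
    by (elim exE conjE) (rule that)
  have ndvd: "\<not> [:?p:] dvd P"
  proof
    assume "[:?p:] dvd P"
    then have "?p dvd coeff P e"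
      by (simp only: const_poly_dvd_iff)
    moreover have "coeff P e = (\<Sum>i\<in>S. index_value L i x ^ e)"
      unfolding coeff using e(1) S(3) by simp
    ultimately show False using e(2) by simp
  qed
  have "degree P \<le> K"
    by (rule degree_le) (simp add: coeff)
  moreover have "card {y \<in> bit_polys (2 * 3 ^ l). ?p dvd poly P y} \<le> degree P"
    by (rule card_roots_mod_prime_elem[OF prime_trinomial _ _ ndvd])
       (auto intro: dvd_bit_polys_eq[where p = ?p] simp: degree_trinomial)
  ultimately show ?thesis by (simp add: eval)
qed

definition bias_sign :: "nat \<Rightarrow> nat \<Rightarrow> nat \<Rightarrow> bit poly \<Rightarrow> bit poly \<Rightarrow> bit poly \<Rightarrow> nat \<Rightarrow> real" where
  "bias_sign l K L x y u i = bit_sign (bit_functional l (u * power_column K L i x y))"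

text \<open>Three layers: at most \<open>K * L\<close> points \<open>x\<close> let the hash of
  \<open>i0\<close> collide with another one; for any other \<open>x\<close>, at most
  \<open>K\<close> values \<open>y\<close> annihilate the column sum; and if that sum is nonzero,
  the sum over \<open>u\<close> cancels. With q residues this leaves at most \<open>K * L\<close> q
  + \<open>K\<close> q exceptional pairs, each contributing at most q.\<close>

theorem small_bias:
  fixes K L l :: nat
  assumes S: "S \<subseteq> {..<2 ^ L}" "S \<noteq> {}" "card S \<le> K"
  defines "R \<equiv> bit_polys (2 * 3 ^ l)"
  shows "\<bar>\<Sum>x\<in>R. \<Sum>y\<in>R. \<Sum>u\<in>R. \<Prod>i\<in>S. bias_sign l K L x y u i\<bar> \<le> K * (L + 1) * (2 ^ (2 * 3 ^ l)) ^ 2"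
proof -
  let ?p = "trinomial l" and ?q = "2 ^ (2 * 3 ^ l) :: real"
  have finS: "finite S" using S(1) finite_subset by blast
  obtain i0 where i0: "i0 \<in> S" using S(2) by blast
  define W where "W x y = (\<Sum>i\<in>S. power_column K L i x y)" for x y :: "bit poly"
  \<comment> \<open>Only collisions with the single index \<open>i0\<close> count, since the
    Vandermonde argument isolates one point; considering all pairs would cost another factor
    \<open>K\<close>.\<close>
  define B where "B = (\<Union>i\<in>S - {i0}. {x \<in> R. ?p dvd index_value L i0 x - index_value L i x})"
  have R: "finite R" "card R = 2 ^ (2 * 3 ^ l)" by (simp_all add: R_def)
  have "card B \<le> (\<Sum>i\<in>S - {i0}. card {x \<in> R. ?p dvd index_value L i0 x - index_value L i x})"
    unfolding B_def by (rule card_UN_le) (simp add: finS)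
  also have "\<dots> \<le> (\<Sum>i\<in>S - {i0}. L)"
    unfolding R_def using i0 S(1) by (intro sum_mono card_index_collisions) auto
  also have "\<dots> \<le> K * L"
    using S(3) by (simp add: card_Diff_singleton_if i0) arith
  finally have cardB: "card B \<le> K * L" .
  have "B \<subseteq> R" by (auto simp: B_def)
  have inner: "\<bar>\<Sum>u\<in>R. \<Prod>i\<in>S. bias_sign l K L x y u i\<bar> \<le> (if ?p dvd W x y then ?q else 0)" for x y
  proof -
    have "(\<Sum>u\<in>R. \<Prod>i\<in>S. bias_sign l K L x y u i) = (\<Sum>u\<in>R. bit_sign (bit_functional l (u * W x y)))"
      by (simp add: bias_sign_def W_def sum_distrib_left bit_functional_sum bit_sign_sum finS)
    moreover have "\<bar>\<Sum>u\<in>R. bit_sign (bit_functional l (u * W x y))\<bar> \<le> (\<Sum>u\<in>R. \<bar>bit_sign (bit_functional l (u * W x y))\<bar>)"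
      by (rule sum_abs)
    ultimately show ?thesis
      using sum_bit_sign_functional[of l "W x y"] by (simp add: R) (simp add: R_def)
  qed
  have row: "(\<Sum>y\<in>R. if ?p dvd W x y then ?q else 0) \<le> (if x \<in> B then ?q * ?q else K * ?q)" if "x \<in> R" for x
  proof -
    have eq: "(\<Sum>y\<in>R. if ?p dvd W x y then ?q else 0) = card {y \<in> R. ?p dvd W x y} * ?q"
      using R(1) by (simp add: sum.If_cases Int_def)
    show ?thesis
    proof (cases "x \<in> B")
      case True
      have "card {y \<in> R. ?p dvd W x y} \<le> card R"
        using R(1) by (intro card_mono) auto
      then have "real (card {y \<in> R. ?p dvd W x y}) \<le> ?q"
        using R(2) by (metis of_nat_le_iff of_nat_numeral of_nat_power)
      then show ?thesis using True eq by simp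
    next
      case False
      then have "card {y \<in> R. ?p dvd W x y} \<le> K"
        unfolding R_def W_def using that i0 finS S(3) by (intro card_column_roots[where ?i0.0 = i0]) (auto simp: B_def R_def)
      then show ?thesis using False eq by simp
    qed
  qed
  have "\<bar>\<Sum>x\<in>R. \<Sum>y\<in>R. \<Sum>u\<in>R. \<Prod>i\<in>S. bias_sign l K L x y u i\<bar> \<le>
      (\<Sum>x\<in>R. \<Sum>y\<in>R. \<bar>\<Sum>u\<in>R. \<Prod>i\<in>S. bias_sign l K L x y u i\<bar>)"
    by (rule order_trans[OF sum_abs]) (intro sum_mono sum_abs)
  also have "\<dots> \<le> (\<Sum>x\<in>R. \<Sum>y\<in>R. if ?p dvd W x y then ?q else 0)"
    by (intro sum_mono inner)
  also have "\<dots> \<le> (\<Sum>x\<in>R. if x \<in> B then ?q * ?q else K * ?q)"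
    by (intro sum_mono row)
  also have "\<dots> \<le> (\<Sum>x\<in>R. (if x \<in> B then ?q * ?q else 0) + K * ?q)"
    by (intro sum_mono) auto
  also have "\<dots> = card B * (?q * ?q) + ?q * (K * ?q)"
    using R \<open>B \<subseteq> R\<close> by (simp add: sum.distrib sum.If_cases Int_absorb1)
  also have "\<dots> \<le> (K * L) * (?q * ?q) + ?q * (K * ?q)"
    using cardB by (intro add_right_mono mult_right_mono) (simp_all flip: of_nat_mult)
  also have "\<dots> = K * (L + 1) * ?q ^ 2"
    by (simp add: algebra_simps power2_eq_square)
  finally show ?thesis by simp
qed

section \<open>Elementary facts about the cube\<close>

lemma card_cube: "card (cube n) = 2 ^ n"
  unfolding cube_def by (simp add: card_PiE numeral_2_eq_2)

lemma cube_nonempty: "cube n \<noteq> {}"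
  using card_cube[of n] by (metis card.empty power_not_zero zero_neq_numeral)

lemma cubeD: "x \<in> cube n \<Longrightarrow> i < n \<Longrightarrow> x i = 1 \<or> x i = -1"
  by (auto simp: cube_def PiE_iff)

lemma cube_abs: "x \<in> cube n \<Longrightarrow> i < n \<Longrightarrow> \<bar>x i\<bar> = 1"
  using cubeD by fastforce

lemma cubeI: "(\<And>i. i < n \<Longrightarrow> x i = 1 \<or> x i = -1) \<Longrightarrow> (\<And>i. i \<ge> n \<Longrightarrow> x i = undefined) \<Longrightarrow> x \<in> cube n"
  by (force simp: cube_def PiE_iff extensional_def)

subsection \<open>Multilinear extensions and restrictions\<close>

definition multilinear_ext :: "nat \<Rightarrow> ((nat \<Rightarrow> real) \<Rightarrow> real) \<Rightarrow> (nat \<Rightarrow> real) \<Rightarrow> real" where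
  "multilinear_ext n f x = (\<Sum>S | S \<subseteq> {..<n}. fourier n f S * monomial S x)"

definition restriction ::
    "nat \<Rightarrow> ((nat \<Rightarrow> real) \<Rightarrow> real) \<Rightarrow> (nat \<Rightarrow> real) \<Rightarrow> nat set \<Rightarrow> (nat \<Rightarrow> real) \<Rightarrow> real" where
  "restriction n f a J = (\<lambda>x\<in>cube n. f (override_on x a J))"

lemma multilinear_ext_cube: "x \<in> cube n \<Longrightarrow> multilinear_ext n f x = f x"
  unfolding multilinear_ext_def by (rule fourier_expansion[symmetric])

lemma monomial_cong: "S \<subseteq> {..<n} \<Longrightarrow> (\<And>i. i < n \<Longrightarrow> x i = y i) \<Longrightarrow> monomial S x = monomial S y"
  unfolding monomial_def by (intro prod.cong) auto

lemma multilinear_ext_cong: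
  "(\<And>i. i < n \<Longrightarrow> x i = y i) \<Longrightarrow> multilinear_ext n f x = multilinear_ext n f y"
  unfolding multilinear_ext_def by (intro sum.cong refl arg_cong2[where f = "(*)"] monomial_cong) auto

text \<open>For \<open>x\<close> in the solid cube, the product is the probability of
  \<open>w\<close> under independent signs with means \<open>x i\<close>, so the extension is an
  expectation of \<open>f\<close>.\<close>

lemma multilinear_ext_kernel:
  "multilinear_ext n f x = (\<Sum>w\<in>cube n. f w * (\<Prod>i<n. (1 + x i * w i) / 2))"
proof -
  have kernel: "(\<Sum>S\<in>Pow {..<n}. monomial S w * monomial S x) = (\<Prod>i<n. 1 + x i * w i)" for w :: "nat \<Rightarrow> real"
  proof -
    have "(\<Prod>i<n. x i * w i + 1) = (\<Sum>S\<in>Pow {..<n}. (\<Prod>i\<in>S. x i * w i) * (\<Prod>i\<in>{..<n} - S. 1))"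
      by (rule prod_add) simp
    then show ?thesis
      by (simp add: monomial_def prod.distrib mult.commute add.commute)
  qed
  have "multilinear_ext n f x = (\<Sum>S\<in>Pow {..<n}. \<Sum>w\<in>cube n. f w * (monomial S w * monomial S x) / 2 ^ n)"
    by (simp add: multilinear_ext_def fourier_def Pow_def sum_divide_distrib sum_distrib_left sum_distrib_right mult_ac)
  also have "\<dots> = (\<Sum>w\<in>cube n. f w * (\<Sum>S\<in>Pow {..<n}. monomial S w * monomial S x) / 2 ^ n)"
    by (subst sum.swap) (simp add: sum_divide_distrib sum_distrib_left)
  also have "\<dots> = (\<Sum>w\<in>cube n. f w * (\<Prod>i<n. (1 + x i * w i) / 2))"
    by (simp only: kernel prod_dividef) (simp add: algebra_simps)
  finally show ?thesis .
qed

lemma monomial_override: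
  assumes "finite S"
  shows "monomial S (override_on z a J) = monomial (S \<inter> J) a * monomial (S - J) z"
proof -
  have "monomial S (override_on z a J) =
      (\<Prod>i\<in>S \<inter> J. override_on z a J i) * (\<Prod>i\<in>S - J. override_on z a J i)"
    unfolding monomial_def by (metis assms prod.Int_Diff)
  then show ?thesis
    by (simp add: monomial_def override_on_def)
qed

lemma override_on_cube:
  "x \<in> cube n \<Longrightarrow> a \<in> cube n \<Longrightarrow> override_on x a J \<in> cube n"
  by (auto simp: cube_def PiE_iff override_on_def extensional_def)

text \<open>Sorting the monomials of \<open>f\<close> by their part outside \<open>J\<close> gives a
  multilinear polynomial in \<open>z\<close> that agrees with the restriction on the cube;
  uniqueness of the expansion does the rest.\<close>

lemma multilinear_ext_restriction:
  assumes "a \<in> cube n"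
  shows "multilinear_ext n (restriction n f a J) z = multilinear_ext n f (override_on z a J)"
proof -
  define c where "c T = (\<Sum>S | S \<in> Pow {..<n} \<and> S - J = T. fourier n f S * monomial (S \<inter> J) a)" for T
  have eq: "multilinear_ext n f (override_on z a J) = (\<Sum>T | T \<subseteq> {..<n}. c T * monomial T z)" for z
  proof -
    have "multilinear_ext n f (override_on z a J) =
        (\<Sum>S\<in>Pow {..<n}. fourier n f S * monomial (S \<inter> J) a * monomial (S - J) z)"
      unfolding multilinear_ext_def Pow_def
      by (intro sum.cong refl) (auto simp: monomial_override finite_subset[of _ "{..<n}"])
    also have "\<dots> = (\<Sum>T\<in>Pow {..<n}. \<Sum>S | S \<in> Pow {..<n} \<and> S - J = T.
        fourier n f S * monomial (S \<inter> J) a * monomial (S - J) z)"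
      by (rule sum.group[symmetric]) auto
    also have "\<dots> = (\<Sum>T\<in>Pow {..<n}. c T * monomial T z)"
      unfolding c_def sum_distrib_right by (intro sum.cong refl) auto
    finally show ?thesis by (simp add: Pow_def)
  qed
  have "fourier n (restriction n f a J) T = c T" if "T \<subseteq> {..<n}" for T
  proof (rule fourier_unique[OF _ that])
    fix x assume x: "x \<in> cube n"
    then show "restriction n f a J x = (\<Sum>S | S \<subseteq> {..<n}. c S * monomial S x)"
      using eq[of x] multilinear_ext_cube[OF override_on_cube[OF x assms]]
      by (simp add: restriction_def)
  qed
  then show ?thesis
    unfolding eq by (simp add: multilinear_ext_def)
qed

text \<open>The probability of drawing exactly \<open>J\<close> when every \<open>i < n\<close> is
  included independently with probability \<open>p i\<close>.\<close>

definition mixture_weight :: "nat \<Rightarrow> (nat \<Rightarrow> real) \<Rightarrow> nat set \<Rightarrow> real" where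
  "mixture_weight n p J = (\<Prod>i\<in>J. p i) * (\<Prod>i\<in>{..<n} - J. 1 - p i)"

lemma sum_mixture_weight: "(\<Sum>J\<in>Pow {..<n}. mixture_weight n p J) = 1"
  unfolding mixture_weight_def by (subst prod_add[symmetric]) simp_all

lemma mixture_weight_nonneg:
  "(\<And>i. i < n \<Longrightarrow> 0 \<le> p i \<and> p i \<le> 1) \<Longrightarrow> J \<subseteq> {..<n} \<Longrightarrow> 0 \<le> mixture_weight n p J"
  unfolding mixture_weight_def by (intro mult_nonneg_nonneg prod_nonneg) auto

text \<open>Each factor of the kernel is affine in its coordinate, so the product expands into one
  term per set \<open>J\<close> of coordinates that follow \<open>a\<close>. With different
  \<open>p\<close> and \<open>a\<close> this serves the Taylor bound, the step of the walk and the
  rounding.\<close>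

lemma multilinear_ext_mixture:
  "multilinear_ext n f (\<lambda>i. p i * a i + (1 - p i) * z i) =
     (\<Sum>J\<in>Pow {..<n}. mixture_weight n p J * multilinear_ext n f (override_on z a J))"
proof -
  have prod: "(\<Prod>i<n. (1 + (p i * a i + (1 - p i) * z i) * w i) / 2) =
      (\<Sum>J\<in>Pow {..<n}. mixture_weight n p J * (\<Prod>i<n. (1 + override_on z a J i * w i) / 2))" for w
  proof -
    have "(\<Prod>i<n. (1 + (p i * a i + (1 - p i) * z i) * w i) / 2) =
        (\<Prod>i<n. p i * ((1 + a i * w i) / 2) + (1 - p i) * ((1 + z i * w i) / 2))"
      by (intro prod.cong) (auto simp: field_simps)
    also have "\<dots> = (\<Sum>J\<in>Pow {..<n}. (\<Prod>i\<in>J. p i * ((1 + a i * w i) / 2)) *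
        (\<Prod>i\<in>{..<n} - J. (1 - p i) * ((1 + z i * w i) / 2)))"
      by (rule prod_add) simp
    also have "\<dots> = (\<Sum>J\<in>Pow {..<n}. mixture_weight n p J * (\<Prod>i<n. (1 + override_on z a J i * w i) / 2))"
    proof (intro sum.cong refl)
      fix J assume "J \<in> Pow {..<n}"
      then have J: "{..<n} \<inter> J = J" by blast
      have "(\<Prod>i<n. (1 + override_on z a J i * w i) / 2) =
          (\<Prod>i\<in>J. (1 + override_on z a J i * w i) / 2) * (\<Prod>i\<in>{..<n} - J. (1 + override_on z a J i * w i) / 2)"
        using prod.Int_Diff[of "{..<n}" "\<lambda>i. (1 + override_on z a J i * w i) / 2" J] J by simp
      also have "\<dots> = (\<Prod>i\<in>J. (1 + a i * w i) / 2) * (\<Prod>i\<in>{..<n} - J. (1 + z i * w i) / 2)"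
      proof -
        have "(\<Prod>i\<in>J. (1 + override_on z a J i * w i) / 2) = (\<Prod>i\<in>J. (1 + a i * w i) / 2)"
          by (rule prod.cong) (simp_all add: override_on_def)
        moreover have "(\<Prod>i\<in>{..<n} - J. (1 + override_on z a J i * w i) / 2) = (\<Prod>i\<in>{..<n} - J. (1 + z i * w i) / 2)"
          by (rule prod.cong) (simp_all add: override_on_def)
        ultimately show ?thesis by (simp only:)
      qed
      finally show "(\<Prod>i\<in>J. p i * ((1 + a i * w i) / 2)) * (\<Prod>i\<in>{..<n} - J. (1 - p i) * ((1 + z i * w i) / 2)) =
          mixture_weight n p J * (\<Prod>i<n. (1 + override_on z a J i * w i) / 2)"
        by (simp only: mixture_weight_def prod.distrib mult_ac)
    qed
    finally show ?thesis .
  qed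
  show ?thesis
    unfolding multilinear_ext_kernel prod sum_distrib_left
    by (subst sum.swap) (simp add: mult_ac)
qed

text \<open>The kernel weights are nonnegative and sum to 1.\<close>

lemma abs_multilinear_ext_le_1:
  assumes f: "f \<in> boolean_functions n" and x: "\<And>i. i < n \<Longrightarrow> \<bar>x i\<bar> \<le> 1"
  shows "\<bar>multilinear_ext n f x\<bar> \<le> 1"
proof -
  have nonneg: "(\<Prod>i<n. (1 + x i * w i) / 2) \<ge> 0" if "w \<in> cube n" for w
  proof (intro prod_nonneg ballI)
    fix i assume "i \<in> {..<n}"
    then have "\<bar>x i * w i\<bar> \<le> 1" using x cube_abs[OF that] by (simp add: abs_mult)
    then show "0 \<le> (1 + x i * w i) / 2" by simp
  qed
  have "\<bar>multilinear_ext n f x\<bar> \<le> (\<Sum>w\<in>cube n. \<bar>f w * (\<Prod>i<n. (1 + x i * w i) / 2)\<bar>)"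
    unfolding multilinear_ext_kernel by (rule sum_abs)
  also have "\<dots> = (\<Sum>w\<in>cube n. \<Prod>i<n. (1 + x i * w i) / 2)"
  proof (intro sum.cong refl)
    fix w assume w: "w \<in> cube n"
    then have "\<bar>f w\<bar> = 1" using f by (fastforce simp: boolean_functions_def PiE_iff)
    then show "\<bar>f w * (\<Prod>i<n. (1 + x i * w i) / 2)\<bar> = (\<Prod>i<n. (1 + x i * w i) / 2)"
      using nonneg[OF w] by (simp add: abs_mult)
  qed
  also have "\<dots> = (\<Prod>i<n. (1 + x i * -1) / 2 + (1 + x i * 1) / 2)"
    by (rule sum_cube_prod[of "\<lambda>i v. (1 + x i * v) / 2"])
  also have "\<dots> = 1"
    by (rule prod.neutral) (auto simp: field_simps)
  finally show ?thesis .
qed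

subsection \<open>The Taylor remainder\<close>

definition level_part :: "nat \<Rightarrow> ((nat \<Rightarrow> real) \<Rightarrow> real) \<Rightarrow> nat \<Rightarrow> (nat \<Rightarrow> real) \<Rightarrow> real" where
  "level_part n f k x = (\<Sum>S | S \<subseteq> {..<n} \<and> card S = k. fourier n f S * monomial S x)"

text \<open>The extension along the line through 0 and \<open>x\<close>; the levels are its Taylor
  coefficients at 0.\<close>

definition level_poly :: "nat \<Rightarrow> ((nat \<Rightarrow> real) \<Rightarrow> real) \<Rightarrow> (nat \<Rightarrow> real) \<Rightarrow> real poly" where
  "level_poly n f x = (\<Sum>k<Suc n. monom (level_part n f k x) k)"

lemma level_part_gt:
  assumes "k > n"
  shows "level_part n f k x = 0"
proof -
  have "\<not> (S \<subseteq> {..<n} \<and> card S = k)" for S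
    using card_mono[of "{..<n}" S] assms by auto
  then have "{S. S \<subseteq> {..<n} \<and> card S = k} = {}"
    by blast
  then show ?thesis
    by (simp only: level_part_def sum.empty)
qed

lemma coeff_level_poly: "coeff (level_poly n f x) k = level_part n f k x"
  by (simp add: level_poly_def coeff_sum coeff_monom sum.delta level_part_gt del: sum.lessThan_Suc)

lemma poly_level_poly: "poly (level_poly n f x) t = multilinear_ext n f (\<lambda>i. t * x i)"
proof -
  have "multilinear_ext n f (\<lambda>i. t * x i) = (\<Sum>S\<in>Pow {..<n}. fourier n f S * monomial S x * t ^ card S)"
    by (simp add: multilinear_ext_def monomial_def Pow_def prod.distrib mult_ac)
  also have "\<dots> = (\<Sum>k<Suc n. \<Sum>S | S \<in> Pow {..<n} \<and> card S = k. fourier n f S * monomial S x * t ^ card S)"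
  proof (rule sum.group[symmetric])
    show "card ` Pow {..<n} \<subseteq> {..<Suc n}"
      using card_mono[OF finite_lessThan[of n]] by (auto simp: less_Suc_eq_le)
  qed auto
  also have "\<dots> = (\<Sum>k<Suc n. level_part n f k x * t ^ k)"
    unfolding level_part_def sum_distrib_right by (intro sum.cong refl) auto
  also have "\<dots> = poly (level_poly n f x) t"
    by (simp add: level_poly_def poly_sum poly_monom)
  finally show ?thesis ..
qed

lemma higher_pderiv_pcompose_linear:
  "(pderiv ^^ k) (pcompose P [:c, d:]) = smult (d ^ k) (pcompose ((pderiv ^^ k) P) [:c, d:])"
proof (induction k)
  case (Suc k)
  have "pderiv [:c, d:] = [:d:]" by (simp add: pderiv_pCons)
  then show ?case
    by (simp add: Suc pderiv_smult pderiv_pcompose mult_ac)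
qed simp

lemma poly_higher_pderiv_0: "poly ((pderiv ^^ k) Q) 0 = fact k * coeff Q k"
  for Q :: "real poly"
  by (simp add: poly_0_coeff_0 coeff_higher_pderiv pochhammer_fact)

text \<open>The chain rule for the substitution that sends \<open>s\<close> to
  \<open>t + (1 - t) * s\<close>: each derivative at 0 gains a factor \<open>1 - t\<close>.\<close>

lemma higher_pderiv_linear:
  fixes P :: "real poly"
  shows "(1 - t) ^ k * poly ((pderiv ^^ k) P) t = fact k * coeff (pcompose P [:t, 1 - t:]) k"
proof -
  have "fact k * coeff (pcompose P [:t, 1 - t:]) k = poly ((pderiv ^^ k) (pcompose P [:t, 1 - t:])) 0"
    by (simp only: poly_higher_pderiv_0)
  also have "\<dots> = (1 - t) ^ k * poly ((pderiv ^^ k) P) t"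
    by (simp add: higher_pderiv_pcompose_linear poly_pcompose)
  finally show ?thesis ..
qed

lemma restriction_closed:
  "closed_under_restrictions n F \<Longrightarrow> f \<in> F \<Longrightarrow> J \<subseteq> {..<n} \<Longrightarrow> a \<in> cube n \<Longrightarrow> restriction n f a J \<in> F"
  unfolding closed_under_restrictions_def restriction_def by blast

text \<open>At the point \<open>t x\<close>, the degree \<open>k\<close> part of \<open>f\<close> is, up to the factor \<open>(1 - t) ^ k\<close>,
  the average of the degree \<open>k\<close> parts of random restrictions of \<open>f\<close>, in which every variable is fixed
  with probability \<open>t\<close>.\<close>

lemma taylor_remainder:
  assumes closed: "closed_under_restrictions n F" and f: "f \<in> F" and x: "x \<in> cube n"
    and bound: "\<And>h. h \<in> F \<Longrightarrow> \<bar>level_part n h k x\<bar> \<le> b ^ k"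
    and "k > 0" and \<alpha>: "0 < \<alpha>" "\<alpha> \<le> 1 / 2"
  shows "\<bar>multilinear_ext n f (\<lambda>i. \<alpha> * x i) - (\<Sum>j<k. level_part n f j x * \<alpha> ^ j)\<bar> \<le> (2 * \<alpha> * b) ^ k"
proof -
  define P where "P = level_poly n f x"
  have deriv: "\<forall>m t. m < k \<and> 0 \<le> t \<and> t \<le> \<alpha> \<longrightarrow>
      DERIV (poly ((pderiv ^^ m) P)) t :> poly ((pderiv ^^ Suc m) P) t"
    by (auto intro: poly_DERIV)
  obtain t where t: "0 < t" "t < \<alpha>"
    and eq: "poly P \<alpha> = (\<Sum>m<k. poly ((pderiv ^^ m) P) 0 / fact m * \<alpha> ^ m) + poly ((pderiv ^^ k) P) t / fact k * \<alpha> ^ k"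
    using Maclaurin[of \<alpha> k "\<lambda>m. poly ((pderiv ^^ m) P)" "poly P"] \<alpha>(1) \<open>k > 0\<close> deriv by auto
  have "pcompose P [:t, 1 - t:] =
      (\<Sum>J\<in>Pow {..<n}. smult (mixture_weight n (\<lambda>_. t) J) (level_poly n (restriction n f x J) x))"
  proof (rule poly_eq_poly_eq_iff[THEN iffD1], rule ext)
    fix s
    have "poly (pcompose P [:t, 1 - t:]) s = multilinear_ext n f (\<lambda>i. t * x i + (1 - t) * (s * x i))"
      by (simp add: P_def poly_pcompose poly_level_poly algebra_simps)
    also have "\<dots> = (\<Sum>J\<in>Pow {..<n}. mixture_weight n (\<lambda>_. t) J * multilinear_ext n f (override_on (\<lambda>i. s * x i) x J))"
      by (rule multilinear_ext_mixture)
    also have "\<dots> = poly (\<Sum>J\<in>Pow {..<n}. smult (mixture_weight n (\<lambda>_. t) J) (level_poly n (restriction n f x J) x)) s"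
      by (simp add: poly_sum poly_level_poly multilinear_ext_restriction[OF x])
    finally show "poly (pcompose P [:t, 1 - t:]) s = \<dots>" .
  qed
  then have "\<bar>coeff (pcompose P [:t, 1 - t:]) k\<bar> =
      \<bar>\<Sum>J\<in>Pow {..<n}. mixture_weight n (\<lambda>_. t) J * level_part n (restriction n f x J) k x\<bar>"
    by (simp add: coeff_sum coeff_level_poly)
  also have "\<dots> \<le> (\<Sum>J\<in>Pow {..<n}. \<bar>mixture_weight n (\<lambda>_. t) J * level_part n (restriction n f x J) k x\<bar>)"
    by (rule sum_abs)
  also have "\<dots> \<le> (\<Sum>J\<in>Pow {..<n}. mixture_weight n (\<lambda>_. t) J * b ^ k)"
  proof (intro sum_mono)
    fix J assume J: "J \<in> Pow {..<n}"
    have "0 \<le> mixture_weight n (\<lambda>_. t) J"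
      using J t \<alpha> by (intro mixture_weight_nonneg) auto
    moreover have "\<bar>level_part n (restriction n f x J) k x\<bar> \<le> b ^ k"
      using J by (intro bound restriction_closed[OF closed f _ x]) auto
    ultimately show "\<bar>mixture_weight n (\<lambda>_. t) J * level_part n (restriction n f x J) k x\<bar> \<le> mixture_weight n (\<lambda>_. t) J * b ^ k"
      by (simp add: abs_mult mult_left_mono)
  qed
  also have "\<dots> = b ^ k"
    by (simp add: sum_distrib_right[symmetric] sum_mixture_weight)
  finally have coeff: "\<bar>coeff (pcompose P [:t, 1 - t:]) k\<bar> \<le> b ^ k" .
  \<comment> \<open>As \<open>t < \<alpha> \<le> 1 / 2\<close>, dividing by
    \<open>(1 - t) ^ k\<close> costs at most \<open>2 ^ k\<close>; this is the 2 in
    \<open>2 * \<alpha> * b\<close>.\<close>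
  have t1: "(1 - t) ^ k \<ge> (1 / 2) ^ k" "(1 - t) ^ k > 0"
    using t \<alpha> by (auto intro!: power_mono)
  have "\<bar>poly ((pderiv ^^ k) P) t / fact k\<bar> = \<bar>coeff (pcompose P [:t, 1 - t:]) k\<bar> / (1 - t) ^ k"
  proof -
    have "poly ((pderiv ^^ k) P) t / fact k = coeff (pcompose P [:t, 1 - t:]) k / (1 - t) ^ k"
    proof -
      have "p / fa = c / A" if "A * p = fa * c" "0 < A" "0 < fa" for A p fa c :: real
        using that by (simp add: field_simps)
      from this[OF higher_pderiv_linear t1(2)] show ?thesis by simp
    qed
    then show ?thesis using t1(2) by (simp add: abs_divide del: zero_less_power)
  qed
  also have "\<dots> \<le> b ^ k / (1 / 2) ^ k"
  proof (rule frac_le)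
    show "0 \<le> b ^ k" using coeff by linarith
    show "(0 :: real) < (1 / 2) ^ k" by simp
  qed (fact coeff t1)+
  also have "\<dots> = (2 * b) ^ k"
    by (simp add: power_mult_distrib power_divide)
  finally have "\<bar>poly ((pderiv ^^ k) P) t / fact k\<bar> * \<alpha> ^ k \<le> (2 * b) ^ k * \<alpha> ^ k"
    using \<alpha> by (intro mult_right_mono) auto
  then have "\<bar>poly ((pderiv ^^ k) P) t / fact k * \<alpha> ^ k\<bar> \<le> (2 * \<alpha> * b) ^ k"
    using \<alpha> by (simp add: abs_mult power_mult_distrib mult_ac)
  moreover have "(\<Sum>m<k. poly ((pderiv ^^ m) P) 0 / fact m * \<alpha> ^ m) = (\<Sum>j<k. level_part n f j x * \<alpha> ^ j)"
    by (simp add: poly_higher_pderiv_0 P_def coeff_level_poly)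
  ultimately show ?thesis
    using eq by (simp add: P_def poly_level_poly)
qed

subsection \<open>One step of the walk\<close>

lemma level_part_0: "level_part n f 0 x = fourier n f {}"
proof -
  have "{S. S \<subseteq> {..<n} \<and> card S = 0} = {{}}"
    by (auto dest: finite_subset)
  then show ?thesis by (simp add: level_part_def monomial_def)
qed

lemma multilinear_ext_0: "multilinear_ext n f (\<lambda>i. 0) = fourier n f {}"
  using poly_level_poly[of n f "\<lambda>i. 0" 0] by (simp add: poly_0_coeff_0 coeff_level_poly level_part_0)

lemma abs_sum_level_part_le:
  assumes "\<And>S. S \<subseteq> {..<n} \<Longrightarrow> card S = j \<Longrightarrow> \<bar>\<Sum>v\<in>V. monomial S (\<xi> v)\<bar> \<le> c"
  shows "\<bar>\<Sum>v\<in>V. level_part n f j (\<xi> v)\<bar> \<le> L1 n j f * c"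
proof -
  have "(\<Sum>v\<in>V. level_part n f j (\<xi> v)) =
      (\<Sum>S | S \<subseteq> {..<n} \<and> card S = j. fourier n f S * (\<Sum>v\<in>V. monomial S (\<xi> v)))"
    unfolding level_part_def sum_distrib_left by (rule sum.swap)
  also have "\<bar>\<dots>\<bar> \<le> (\<Sum>S | S \<subseteq> {..<n} \<and> card S = j. \<bar>fourier n f S * (\<Sum>v\<in>V. monomial S (\<xi> v))\<bar>)"
    by (rule sum_abs)
  also have "\<dots> \<le> (\<Sum>S | S \<subseteq> {..<n} \<and> card S = j. \<bar>fourier n f S\<bar> * c)"
    using assms by (intro sum_mono) (auto simp: abs_mult intro: mult_left_mono)
  finally show ?thesis
    by (simp add: L1_def sum_distrib_right)
qed

text \<open>Fooling at the origin: below level \<open>k\<close> the small bias is used, from level \<open>k\<close> on the Taylor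
  bound.\<close>

lemma fractional_generator_origin:
  fixes \<alpha> b \<delta> A :: real and \<xi> :: "'v \<Rightarrow> nat \<Rightarrow> real"
  assumes closed: "closed_under_restrictions n F" and f: "f \<in> F"
    and bound: "\<And>h x. h \<in> F \<Longrightarrow> x \<in> cube n \<Longrightarrow> \<bar>level_part n h k x\<bar> \<le> b ^ k"
    and k: "k > 0" and \<alpha>: "0 < \<alpha>" "\<alpha> \<le> 1 / 2"
    and V: "\<And>v. v \<in> V \<Longrightarrow> \<xi> v \<in> cube n"
    and bias: "\<And>S. S \<subseteq> {..<n} \<Longrightarrow> S \<noteq> {} \<Longrightarrow> card S < k \<Longrightarrow>
      \<bar>\<Sum>v\<in>V. monomial S (\<xi> v)\<bar> \<le> \<delta> * card V"
    and A: "(\<Sum>j=1..<k. L1 n j f * \<alpha> ^ j) \<le> A" and "\<delta> \<ge> 0"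
  shows "\<bar>(\<Sum>v\<in>V. multilinear_ext n f (\<lambda>i. \<alpha> * \<xi> v i)) - card V * multilinear_ext n f (\<lambda>i. 0)\<bar>
      \<le> card V * ((2 * \<alpha> * b) ^ k + \<delta> * A)"
proof -
  let ?T = "\<lambda>v. \<Sum>j<k. level_part n f j (\<xi> v) * \<alpha> ^ j"
  have rem: "\<bar>multilinear_ext n f (\<lambda>i. \<alpha> * \<xi> v i) - ?T v\<bar> \<le> (2 * \<alpha> * b) ^ k" if "v \<in> V" for v
    using that by (intro taylor_remainder[OF closed f] V bound k \<alpha>)
  \<comment> \<open>Level 0 is the value at the origin and cancels exactly.\<close>
  have "{..<k} = insert 0 {1..<k}" using k by auto
  then have split: "?T v = multilinear_ext n f (\<lambda>i. 0) + (\<Sum>j=1..<k. level_part n f j (\<xi> v) * \<alpha> ^ j)" for v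
    by (simp add: level_part_0 multilinear_ext_0)
  have "(\<Sum>v\<in>V. ?T v) - card V * multilinear_ext n f (\<lambda>i. 0) =
      (\<Sum>v\<in>V. \<Sum>j=1..<k. level_part n f j (\<xi> v) * \<alpha> ^ j)"
    unfolding split sum.distrib by simp
  also have "\<dots> = (\<Sum>j=1..<k. (\<Sum>v\<in>V. level_part n f j (\<xi> v)) * \<alpha> ^ j)"
    unfolding sum_distrib_right by (rule sum.swap)
  also have "\<bar>\<dots>\<bar> \<le> (\<Sum>j=1..<k. \<bar>(\<Sum>v\<in>V. level_part n f j (\<xi> v)) * \<alpha> ^ j\<bar>)"
    by (rule sum_abs)
  also have "\<dots> \<le> (\<Sum>j=1..<k. (L1 n j f * \<alpha> ^ j) * (\<delta> * card V))"
  proof (rule sum_mono)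
    fix j assume j: "j \<in> {1..<k}"
    have "\<bar>\<Sum>v\<in>V. level_part n f j (\<xi> v)\<bar> \<le> L1 n j f * (\<delta> * card V)"
      using j by (intro abs_sum_level_part_le bias) auto
    then have "\<bar>\<Sum>v\<in>V. level_part n f j (\<xi> v)\<bar> * \<alpha> ^ j \<le> L1 n j f * (\<delta> * card V) * \<alpha> ^ j"
      using \<alpha> by (intro mult_right_mono) auto
    then show "\<bar>(\<Sum>v\<in>V. level_part n f j (\<xi> v)) * \<alpha> ^ j\<bar> \<le> (L1 n j f * \<alpha> ^ j) * (\<delta> * card V)"
      using \<alpha> by (simp add: abs_mult mult_ac)
  qed
  also have "\<dots> \<le> A * (\<delta> * card V)"
    unfolding sum_distrib_right[symmetric] using A \<open>\<delta> \<ge> 0\<close> by (intro mult_right_mono) auto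
  finally have low: "\<bar>(\<Sum>v\<in>V. ?T v) - card V * multilinear_ext n f (\<lambda>i. 0)\<bar> \<le> A * (\<delta> * card V)" .
  have "\<bar>\<Sum>v\<in>V. multilinear_ext n f (\<lambda>i. \<alpha> * \<xi> v i) - ?T v\<bar> \<le> (\<Sum>v\<in>V. (2 * \<alpha> * b) ^ k)"
    by (rule order_trans[OF sum_abs]) (intro sum_mono rem)
  then have "\<bar>(\<Sum>v\<in>V. multilinear_ext n f (\<lambda>i. \<alpha> * \<xi> v i)) - (\<Sum>v\<in>V. ?T v)\<bar> \<le> card V * (2 * \<alpha> * b) ^ k"
    by (simp add: sum_subtractf)
  with low show ?thesis
    by (simp add: algebra_simps abs_le_iff)
qed

definition walk_step :: "real \<Rightarrow> (nat \<Rightarrow> real) \<Rightarrow> (nat \<Rightarrow> real) \<Rightarrow> nat \<Rightarrow> real" where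
  "walk_step \<alpha> X \<xi> i = X i + (1 - \<bar>X i\<bar>) * (\<alpha> * \<xi> i)"

text \<open>Around any other point, \<open>f\<close> is an average of its restrictions.\<close>

lemma fractional_generator_step:
  fixes \<alpha> b \<delta> A :: real and \<xi> :: "'v \<Rightarrow> nat \<Rightarrow> real"
  assumes closed: "closed_under_restrictions n F" and f: "f \<in> F"
    and bound: "\<And>h x. h \<in> F \<Longrightarrow> x \<in> cube n \<Longrightarrow> \<bar>level_part n h k x\<bar> \<le> b ^ k"
    and k: "k > 0" and \<alpha>: "0 < \<alpha>" "\<alpha> \<le> 1 / 2"
    and V: "\<And>v. v \<in> V \<Longrightarrow> \<xi> v \<in> cube n"
    and bias: "\<And>S. S \<subseteq> {..<n} \<Longrightarrow> S \<noteq> {} \<Longrightarrow> card S < k \<Longrightarrow>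
      \<bar>\<Sum>v\<in>V. monomial S (\<xi> v)\<bar> \<le> \<delta> * card V"
    and A: "\<And>h. h \<in> F \<Longrightarrow> (\<Sum>j=1..<k. L1 n j h * \<alpha> ^ j) \<le> A" and "\<delta> \<ge> 0"
    and X: "\<And>i. i < n \<Longrightarrow> \<bar>X i\<bar> \<le> 1"
  shows "\<bar>(\<Sum>v\<in>V. multilinear_ext n f (walk_step \<alpha> X (\<xi> v))) - card V * multilinear_ext n f X\<bar>
      \<le> card V * ((2 * \<alpha> * b) ^ k + \<delta> * A)"
proof -
  \<comment> \<open>\<open>X i\<close> is a mixture of its sign, with weight
    \<open>\<bar>X i\<bar>\<close>, and of 0 with the remaining weight. In the same mixture the step
    acts on the unfixed coordinates only, where it is \<open>\<alpha> * \<xi> i\<close> at the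
    origin of a restriction.\<close>
  define a where "a = (\<lambda>i\<in>{..<n}. if X i \<ge> 0 then 1 else -1 :: real)"
  define p where "p i = \<bar>X i\<bar>" for i
  let ?w = "mixture_weight n p" and ?h = "\<lambda>J. restriction n f a J"
  have a: "a \<in> cube n"
    by (auto simp: a_def cube_def)
  have Xi: "X i = p i * a i" if "i < n" for i
    using that by (simp add: a_def p_def)
  have mix: "multilinear_ext n f (\<lambda>i. X i + (1 - \<bar>X i\<bar>) * z i) = (\<Sum>J\<in>Pow {..<n}. ?w J * multilinear_ext n (?h J) z)" for z
  proof -
    have "multilinear_ext n f (\<lambda>i. X i + (1 - \<bar>X i\<bar>) * z i) = multilinear_ext n f (\<lambda>i. p i * a i + (1 - p i) * z i)"
    proof (rule multilinear_ext_cong)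
      fix i assume "i < n"
      then show "X i + (1 - \<bar>X i\<bar>) * z i = p i * a i + (1 - p i) * z i"
        using Xi[of i] by (simp only: p_def)
    qed
    then show ?thesis
      by (simp add: multilinear_ext_mixture multilinear_ext_restriction[OF a])
  qed
  let ?E = "(2 * \<alpha> * b) ^ k + \<delta> * A"
  let ?D = "\<lambda>J. (\<Sum>v\<in>V. multilinear_ext n (?h J) (\<lambda>i. \<alpha> * \<xi> v i)) - card V * multilinear_ext n (?h J) (\<lambda>i. 0)"
  have D: "\<bar>?D J\<bar> \<le> card V * ?E" if "J \<in> Pow {..<n}" for J
  proof -
    have h: "?h J \<in> F" using that by (intro restriction_closed[OF closed f _ a]) auto
    show ?thesis
      by (rule fractional_generator_origin[OF closed h bound k \<alpha> V bias A[OF h] \<open>\<delta> \<ge> 0\<close>])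
  qed
  have "(\<Sum>v\<in>V. multilinear_ext n f (walk_step \<alpha> X (\<xi> v))) - card V * multilinear_ext n f X =
      (\<Sum>v\<in>V. \<Sum>J\<in>Pow {..<n}. ?w J * multilinear_ext n (?h J) (\<lambda>i. \<alpha> * \<xi> v i))
        - card V * (\<Sum>J\<in>Pow {..<n}. ?w J * multilinear_ext n (?h J) (\<lambda>i. 0))"
    using mix[of "\<lambda>i. 0"] by (simp add: walk_step_def[abs_def] mix)
  also have "\<dots> = (\<Sum>J\<in>Pow {..<n}. ?w J * ?D J)"
    by (subst sum.swap) (simp add: sum_distrib_left sum_subtractf right_diff_distrib mult_ac)
  finally have eq: "(\<Sum>v\<in>V. multilinear_ext n f (walk_step \<alpha> X (\<xi> v))) - card V * multilinear_ext n f X =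
      (\<Sum>J\<in>Pow {..<n}. ?w J * ?D J)" .
  have "\<bar>\<Sum>J\<in>Pow {..<n}. ?w J * ?D J\<bar> \<le> (\<Sum>J\<in>Pow {..<n}. \<bar>?w J * ?D J\<bar>)"
    by (rule sum_abs)
  also have "\<dots> \<le> (\<Sum>J\<in>Pow {..<n}. ?w J * (card V * ?E))"
  proof (rule sum_mono)
    fix J assume J: "J \<in> Pow {..<n}"
    have "0 \<le> ?w J"
    proof (rule mixture_weight_nonneg)
      show "0 \<le> p i \<and> p i \<le> 1" if "i < n" for i
        using X[OF that] by (simp add: p_def)
      show "J \<subseteq> {..<n}" using J by simp
    qed
    then show "\<bar>?w J * ?D J\<bar> \<le> ?w J * (card V * ?E)"
      unfolding abs_mult by (simp only: abs_of_nonneg) (rule mult_left_mono[OF D[OF J]])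
  qed
  also have "\<dots> = card V * ?E"
    by (simp only: sum_distrib_right[symmetric] sum_mixture_weight mult_1)
  finally show ?thesis
    unfolding eq .
qed

section \<open>Polarization and rounding\<close>

lemma walk_step_bounded:
  assumes "\<bar>X i\<bar> \<le> 1" "\<bar>\<xi> i\<bar> = 1" "0 < \<alpha>" "\<alpha> \<le> 1 / 2"
  shows "\<bar>walk_step \<alpha> X \<xi> i\<bar> \<le> 1"
proof -
  define P where "P = (1 - \<bar>X i\<bar>) * (\<alpha> * \<xi> i)"
  have "\<bar>P\<bar> \<le> (1 - \<bar>X i\<bar>) * 1"
    unfolding P_def abs_mult using assms by (intro mult_mono) (auto simp: abs_mult)
  then show ?thesis
    using abs_triangle_ineq[of "X i" P] unfolding walk_step_def P_def[symmetric] by simp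
qed

text \<open>Taylor's second-order term is \<open>v\<^sup>2 / 8\<close>, but with it the bound fails
  for negative \<open>v\<close>; half of it works on the whole interval.\<close>

lemma sqrt_one_minus_le:
  fixes v :: real
  assumes "\<bar>v\<bar> \<le> 1"
  shows "sqrt (1 - v) \<le> 1 - v / 2 - v\<^sup>2 / 16"
proof (rule real_le_lsqrt)
  have "v\<^sup>2 \<le> 1" using assms by (simp add: abs_square_le_1)
  then show "0 \<le> 1 - v / 2 - v\<^sup>2 / 16" using assms by (simp add: abs_le_iff)
  have "(1 - v / 2 - v\<^sup>2 / 16)\<^sup>2 = 1 - v + v\<^sup>2 * (2 + v) / 16 + v\<^sup>2 / 16 * v\<^sup>2 / 16"
    by (simp add: power2_eq_square field_simps)
  moreover have "v\<^sup>2 * (2 + v) / 16 \<ge> 0" using assms by (simp add: abs_le_iff)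
  moreover have "v\<^sup>2 / 16 * v\<^sup>2 / 16 \<ge> 0" by simp
  ultimately show "1 - v \<le> (1 - v / 2 - v\<^sup>2 / 16)\<^sup>2" by linarith
qed

text \<open>The potential \<open>sqrt (1 - \<bar>X i\<bar>)\<close> shrinks on average.\<close>

lemma walk_step_contraction:
  fixes \<alpha> \<delta> :: real and \<xi> :: "'v \<Rightarrow> nat \<Rightarrow> real"
  assumes X: "\<bar>X i\<bar> \<le> 1" and \<xi>: "\<And>v. v \<in> V \<Longrightarrow> \<bar>\<xi> v i\<bar> = 1" and \<alpha>: "0 < \<alpha>" "\<alpha> \<le> 1 / 2"
    and bias: "\<bar>\<Sum>v\<in>V. \<xi> v i\<bar> \<le> \<delta> * card V" and \<delta>: "\<delta> \<le> \<alpha> / 16"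
  shows "(\<Sum>v\<in>V. sqrt (1 - \<bar>walk_step \<alpha> X (\<xi> v) i\<bar>)) \<le> card V * (sqrt (1 - \<bar>X i\<bar>) * (1 - \<alpha>\<^sup>2 / 32))"
proof -
  define a where "a = (if X i \<ge> 0 then 1 else -1 :: real)"
  define u where "u = 1 - \<bar>X i\<bar>"
  have u: "0 \<le> u" using X by (simp add: u_def)
  have a: "a * a = 1" "\<bar>a\<bar> = 1" "a * X i = \<bar>X i\<bar>" by (simp_all add: a_def)
  have pt: "sqrt (1 - \<bar>walk_step \<alpha> X (\<xi> v) i\<bar>) \<le> sqrt u * (1 - \<alpha> * a / 2 * \<xi> v i - \<alpha>\<^sup>2 / 16)" if v: "v \<in> V" for v
  proof -
    define w where "w = \<alpha> * a * \<xi> v i"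
    have w: "\<bar>w\<bar> \<le> 1" "w\<^sup>2 = \<alpha>\<^sup>2"
    proof -
      have "\<bar>w\<bar> = \<alpha>" using a \<xi>[OF v] \<alpha> by (simp add: w_def abs_mult)
      then show "\<bar>w\<bar> \<le> 1" "w\<^sup>2 = \<alpha>\<^sup>2" using \<alpha> by (auto simp: power2_eq_square abs_if split: if_splits)
    qed
    have "a * walk_step \<alpha> X (\<xi> v) i = \<bar>X i\<bar> + u * w"
      using a by (simp add: walk_step_def u_def w_def algebra_simps)
    \<comment> \<open>For a step across zero the left side is negative, so no case distinction
      arises.\<close>
    moreover have "a * walk_step \<alpha> X (\<xi> v) i \<le> \<bar>walk_step \<alpha> X (\<xi> v) i\<bar>"
      by (simp add: a_def abs_if)
    ultimately have "1 - \<bar>walk_step \<alpha> X (\<xi> v) i\<bar> \<le> u * (1 - w)"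
      by (simp add: u_def algebra_simps)
    then have "sqrt (1 - \<bar>walk_step \<alpha> X (\<xi> v) i\<bar>) \<le> sqrt (u * (1 - w))"
      by (rule real_sqrt_le_mono)
    also have "\<dots> \<le> sqrt u * (1 - w / 2 - w\<^sup>2 / 16)"
      unfolding real_sqrt_mult by (intro mult_left_mono sqrt_one_minus_le w) (simp add: u)
    also have "1 - w / 2 - w\<^sup>2 / 16 = 1 - \<alpha> * a / 2 * \<xi> v i - \<alpha>\<^sup>2 / 16"
      unfolding w by (simp add: w_def)
    finally show ?thesis .
  qed
  have "(\<Sum>v\<in>V. sqrt (1 - \<bar>walk_step \<alpha> X (\<xi> v) i\<bar>)) \<le> (\<Sum>v\<in>V. sqrt u * (1 - \<alpha> * a / 2 * \<xi> v i - \<alpha>\<^sup>2 / 16))"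
    by (intro sum_mono pt)
  also have "\<dots> = sqrt u * (card V * (1 - \<alpha>\<^sup>2 / 16) - \<alpha> * a / 2 * (\<Sum>v\<in>V. \<xi> v i))"
    by (simp only: sum_distrib_left[symmetric] sum_subtractf) (simp add: right_diff_distrib)
  also have "\<dots> \<le> sqrt u * (card V * (1 - \<alpha>\<^sup>2 / 32))"
  proof (rule mult_left_mono)
    \<comment> \<open>The linear term would vanish for uniform signs. Here it averages to at most
      \<open>\<alpha> * \<delta> / 2 \<le> \<alpha>\<^sup>2 / 32\<close>, half of the second-order
      gain.\<close>
    have "- (\<alpha> * a / 2 * (\<Sum>v\<in>V. \<xi> v i)) \<le> \<bar>\<alpha> * a / 2 * (\<Sum>v\<in>V. \<xi> v i)\<bar>" by simp
    also have "\<dots> = \<alpha> / 2 * \<bar>\<Sum>v\<in>V. \<xi> v i\<bar>" using \<alpha> a by (simp add: abs_mult)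
    also have "\<dots> \<le> \<alpha> / 2 * (\<delta> * card V)" using \<alpha> bias by (intro mult_left_mono) auto
    also have "\<dots> \<le> \<alpha> / 2 * (\<alpha> / 16 * card V)" using \<alpha> \<delta> by (intro mult_left_mono mult_right_mono) auto
    finally show "card V * (1 - \<alpha>\<^sup>2 / 16) - \<alpha> * a / 2 * (\<Sum>v\<in>V. \<xi> v i) \<le> card V * (1 - \<alpha>\<^sup>2 / 32)"
      by (simp add: power2_eq_square algebra_simps)
  qed (simp add: u)
  finally show ?thesis by (simp add: u_def mult_ac)
qed

lemma one_minus_prod_le:
  fixes p :: "nat \<Rightarrow> real"
  assumes "\<And>i. i < n \<Longrightarrow> 0 \<le> p i \<and> p i \<le> 1"
  shows "1 - (\<Prod>i<n. p i) \<le> (\<Sum>i<n. 1 - p i)"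
  using assms
proof (induction n)
  case (Suc n)
  then have IH: "1 - (\<Prod>i<n. p i) \<le> (\<Sum>i<n. 1 - p i)" by simp
  have "(\<Prod>i<n. p i) * (1 - p n) \<le> 1 * (1 - p n)"
    using Suc.prems by (intro mult_right_mono prod_le_1) auto
  with IH show ?case by (simp add: algebra_simps)
qed simp

text \<open>\<open>X\<close> is a mixture of \<open>a\<close> and the origin. If all coordinates
  follow \<open>a\<close> there is no error; otherwise it is at most 2, and a union bound controls
  the probability of that case.\<close>

lemma rounding_error:
  assumes f: "f \<in> boolean_functions n" and a: "a \<in> cube n"
    and p: "\<And>i. i < n \<Longrightarrow> 0 \<le> p i \<and> p i \<le> 1" and X: "\<And>i. i < n \<Longrightarrow> X i = p i * a i"
  shows "\<bar>f a - multilinear_ext n f X\<bar> \<le> 2 * (\<Sum>i<n. 1 - p i)"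
proof -
  let ?w = "mixture_weight n p" and ?g = "\<lambda>J. multilinear_ext n f (override_on (\<lambda>i. 0) a J)"
  have "multilinear_ext n f X = multilinear_ext n f (\<lambda>i. p i * a i + (1 - p i) * 0)"
    by (intro multilinear_ext_cong) (simp add: X)
  also have "\<dots> = (\<Sum>J\<in>Pow {..<n}. ?w J * ?g J)"
    by (rule multilinear_ext_mixture)
  finally have ext: "multilinear_ext n f X = (\<Sum>J\<in>Pow {..<n}. ?w J * ?g J)" .
  have "f a = (\<Sum>J\<in>Pow {..<n}. ?w J * f a)"
    by (simp add: sum_distrib_right[symmetric] sum_mixture_weight)
  with ext have "f a - multilinear_ext n f X = (\<Sum>J\<in>Pow {..<n}. ?w J * (f a - ?g J))"
    by (simp add: sum_subtractf right_diff_distrib)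
  also have "\<dots> = (\<Sum>J\<in>Pow {..<n} - {{..<n}}. ?w J * (f a - ?g J))"
  proof (rule sum.mono_neutral_right)
    have "?g {..<n} = multilinear_ext n f a"
      by (intro multilinear_ext_cong) simp
    then show "\<forall>J\<in>Pow {..<n} - (Pow {..<n} - {{..<n}}). ?w J * (f a - ?g J) = 0"
      by (auto simp: multilinear_ext_cube[OF a])
  qed auto
  also have "\<bar>\<dots>\<bar> \<le> (\<Sum>J\<in>Pow {..<n} - {{..<n}}. \<bar>?w J * (f a - ?g J)\<bar>)"
    by (rule sum_abs)
  also have "\<dots> \<le> (\<Sum>J\<in>Pow {..<n} - {{..<n}}. ?w J * 2)"
  proof (rule sum_mono)
    fix J assume "J \<in> Pow {..<n} - {{..<n}}"
    then have w: "0 \<le> ?w J" using p by (intro mixture_weight_nonneg) auto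
    have "\<bar>?g J\<bar> \<le> 1"
      using cube_abs[OF a] by (intro abs_multilinear_ext_le_1[OF f]) (auto simp: override_on_def)
    moreover have "\<bar>f a\<bar> = 1" using f a by (fastforce simp: boolean_functions_def PiE_iff)
    ultimately have "\<bar>f a - ?g J\<bar> \<le> 2" by linarith
    then show "\<bar>?w J * (f a - ?g J)\<bar> \<le> ?w J * 2"
      using w by (simp add: abs_mult mult_left_mono)
  qed
  also have "\<dots> = ((\<Sum>J\<in>Pow {..<n}. ?w J) - ?w {..<n}) * 2"
    by (subst sum_diff) (auto simp: sum_distrib_right)
  also have "\<dots> = 2 * (1 - (\<Prod>i<n. p i))"
    by (simp only: sum_mixture_weight) (simp add: mixture_weight_def)
  also have "\<dots> \<le> 2 * (\<Sum>i<n. 1 - p i)"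
    using one_minus_prod_le[of n p] p by simp
  finally show ?thesis .
qed

subsection \<open>The polarizing walk\<close>

primrec walk :: "real \<Rightarrow> (nat \<Rightarrow> nat \<Rightarrow> real) \<Rightarrow> nat \<Rightarrow> nat \<Rightarrow> real" where
  "walk \<alpha> \<xi> 0 = (\<lambda>i. 0)"
| "walk \<alpha> \<xi> (Suc t) = walk_step \<alpha> (walk \<alpha> \<xi> t) (\<xi> t)"

definition block :: "nat \<Rightarrow> nat \<Rightarrow> (nat \<Rightarrow> real) \<Rightarrow> nat \<Rightarrow> real" where
  "block B t y = (\<lambda>j\<in>{..<B}. y (B * t + j))"

definition join :: "nat \<Rightarrow> nat \<Rightarrow> (nat \<Rightarrow> real) \<Rightarrow> (nat \<Rightarrow> real) \<Rightarrow> nat \<Rightarrow> real" where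
  "join a b u v = (\<lambda>i\<in>{..<a + b}. if i < a then u i else v (i - a))"

lemma join_cube:
  assumes "u \<in> cube a" "v \<in> cube b"
  shows "join a b u v \<in> cube (a + b)"
proof (rule cubeI)
  fix i assume "i < a + b"
  then show "join a b u v i = 1 \<or> join a b u v i = -1"
    using cubeD[OF assms(1), of i] cubeD[OF assms(2), of "i - a"] by (cases "i < a") (simp_all add: join_def)
qed (simp add: join_def)

lemma bij_betw_join: "bij_betw (\<lambda>(u, v). join a b u v) (cube a \<times> cube b) (cube (a + b))"
proof (rule bij_betw_byWitness[where f' = "\<lambda>y. (\<lambda>i\<in>{..<a}. y i, \<lambda>i\<in>{..<b}. y (a + i))"])
  show "\<forall>p\<in>cube a \<times> cube b. (\<lambda>y. (\<lambda>i\<in>{..<a}. y i, \<lambda>i\<in>{..<b}. y (a + i))) ((\<lambda>(u, v). join a b u v) p) = p"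
    by (auto simp: join_def cube_def PiE_iff extensional_def restrict_def fun_eq_iff)
  show "\<forall>y\<in>cube (a + b). (\<lambda>(u, v). join a b u v) (\<lambda>i\<in>{..<a}. y i, \<lambda>i\<in>{..<b}. y (a + i)) = y"
    by (auto simp: join_def cube_def PiE_iff extensional_def restrict_def fun_eq_iff)
  show "(\<lambda>(u, v). join a b u v) ` (cube a \<times> cube b) \<subseteq> cube (a + b)"
    by (auto intro: join_cube)
  have "(\<lambda>i\<in>{..<a}. y i) \<in> cube a \<and> (\<lambda>i\<in>{..<b}. y (a + i)) \<in> cube b" if y: "y \<in> cube (a + b)" for y
    by (intro conjI cubeI) (simp_all add: cubeD[OF y])
  then show "(\<lambda>y. (\<lambda>i\<in>{..<a}. y i, \<lambda>i\<in>{..<b}. y (a + i))) ` cube (a + b) \<subseteq> cube a \<times> cube b"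
    by blast
qed

lemma sum_cube_join: "(\<Sum>y\<in>cube (a + b). F y) = (\<Sum>u\<in>cube a. \<Sum>v\<in>cube b. F (join a b u v))"
  by (simp add: sum.reindex_bij_betw[OF bij_betw_join, symmetric] sum.cartesian_product case_prod_unfold)

lemma block_cube:
  assumes "y \<in> cube (B * T)" "t < T"
  shows "block B t y \<in> cube B"
proof (rule cubeI)
  fix i assume "i < B"
  have "B * t + i < B * Suc t" using \<open>i < B\<close> by simp
  also have "\<dots> \<le> B * T" using assms(2) by (intro mult_le_mono2) simp
  finally show "block B t y i = 1 \<or> block B t y i = -1"
    using cubeD[OF assms(1)] \<open>i < B\<close> by (simp add: block_def)
qed (simp add: block_def)

lemma block_join_low:
  assumes "t < T"
  shows "block B t (join (B * T) B u v) = block B t u"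
proof
  fix i
  show "block B t (join (B * T) B u v) i = block B t u i"
  proof (cases "i < B")
    case True
    then have "B * t + i < B * Suc t" by simp
    also have "\<dots> \<le> B * T" using assms by (intro mult_le_mono2) simp
    finally show ?thesis using True by (simp add: block_def join_def)
  qed (simp add: block_def)
qed

lemma block_join_top: "v \<in> cube B \<Longrightarrow> block B T (join (B * T) B u v) = v"
  by (auto simp: block_def join_def cube_def PiE_iff extensional_def restrict_def fun_eq_iff)

lemma walk_cong: "(\<And>t. t < T \<Longrightarrow> \<xi> t = \<xi>' t) \<Longrightarrow> walk \<alpha> \<xi> T = walk \<alpha> \<xi>' T"
  by (induction T) simp_all

text \<open>One step draws its signs \<open>\<Xi>\<close> from \<open>B\<close> seed bits.
  \<open>A\<close> bounds the weighted Fourier mass of the levels 1 to \<open>k - 1\<close>, so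
  \<open>\<delta> * A\<close> is the error of a step there. Polarization needs
  \<open>\<delta> \<le> \<alpha> / 16\<close> and \<open>k > 1\<close>, which puts singletons under
  the bias bound.\<close>

locale walk_generator =
  fixes n k B :: nat and F :: "((nat \<Rightarrow> real) \<Rightarrow> real) set" and \<alpha> b \<delta> A :: real
    and \<Xi> :: "(nat \<Rightarrow> real) \<Rightarrow> nat \<Rightarrow> real"
  assumes closed: "closed_under_restrictions n F" and F: "F \<subseteq> boolean_functions n"
    and bound: "\<And>h x. h \<in> F \<Longrightarrow> x \<in> cube n \<Longrightarrow> \<bar>level_part n h k x\<bar> \<le> b ^ k"
    and k: "k > 1" and \<alpha>: "0 < \<alpha>" "\<alpha> \<le> 1 / 2"
    and \<Xi>: "\<And>v. v \<in> cube B \<Longrightarrow> \<Xi> v \<in> cube n"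
    and bias: "\<And>S. S \<subseteq> {..<n} \<Longrightarrow> S \<noteq> {} \<Longrightarrow> card S < k \<Longrightarrow>
      \<bar>\<Sum>v\<in>cube B. monomial S (\<Xi> v)\<bar> \<le> \<delta> * 2 ^ B"
    and A: "\<And>h. h \<in> F \<Longrightarrow> (\<Sum>j=1..<k. L1 n j h * \<alpha> ^ j) \<le> A"
    and \<delta>: "0 \<le> \<delta>" "\<delta> \<le> \<alpha> / 16"
begin

definition position :: "nat \<Rightarrow> (nat \<Rightarrow> real) \<Rightarrow> nat \<Rightarrow> real" where
  "position T y = walk \<alpha> (\<lambda>t. \<Xi> (block B t y)) T"

lemma position_join:
  "v \<in> cube B \<Longrightarrow> position (Suc T) (join (B * T) B u v) = walk_step \<alpha> (position T u) (\<Xi> v)"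
  by (simp add: position_def block_join_top block_join_low cong: walk_cong)

lemma position_bounded: "y \<in> cube (B * T) \<Longrightarrow> t \<le> T \<Longrightarrow> i < n \<Longrightarrow> \<bar>position t y i\<bar> \<le> 1"
proof (induction t)
  case (Suc t)
  then show ?case
    unfolding position_def
    by (auto intro!: walk_step_bounded cube_abs[OF \<Xi>] block_cube \<alpha>)
qed (simp add: position_def)

lemma sum_cube_Suc:
  "(\<Sum>y\<in>cube (B * Suc T). G (position (Suc T) y)) =
     (\<Sum>u\<in>cube (B * T). \<Sum>v\<in>cube B. G (walk_step \<alpha> (position T u) (\<Xi> v)))"
proof -
  have "B * Suc T = B * T + B" by simp
  then show ?thesis
    by (simp only: sum_cube_join) (simp add: position_join)
qed

text \<open>Telescoping: from whatever position has been reached, one more step changes the average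
  of the extension by at most the error of a step. The walk starts at the origin, where the
  extension is the mean.\<close>

lemma position_fools:
  assumes f: "f \<in> F"
  shows "\<bar>(\<Sum>y\<in>cube (B * T). multilinear_ext n f (position T y)) - 2 ^ (B * T) * fourier n f {}\<bar>
    \<le> 2 ^ (B * T) * (T * ((2 * \<alpha> * b) ^ k + \<delta> * A))"
proof (induction T)
  case 0
  have "cube 0 = {\<lambda>_. undefined}" by (simp add: cube_def)
  then show ?case by (simp add: position_def multilinear_ext_0)
next
  case (Suc T)
  let ?E = "(2 * \<alpha> * b) ^ k + \<delta> * A" and ?N = "2 ^ (B * T) :: real" and ?b = "2 ^ B :: real"
  let ?g = "\<lambda>u. multilinear_ext n f (position T u)"
  let ?h = "\<lambda>u. \<Sum>v\<in>cube B. multilinear_ext n f (walk_step \<alpha> (position T u) (\<Xi> v))"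
  have "\<bar>?h u - ?b * ?g u\<bar> \<le> ?b * ?E" if u: "u \<in> cube (B * T)" for u
  proof -
    have "\<bar>?h u - card (cube B) * ?g u\<bar> \<le> card (cube B) * ?E"
      using bias k position_bounded[OF u order_refl]
      by (intro fractional_generator_step[OF closed f bound _ \<alpha> \<Xi> _ A]) (auto simp: card_cube \<delta>)
    then show ?thesis by (simp add: card_cube)
  qed
  then have "(\<Sum>u\<in>cube (B * T). \<bar>?h u - ?b * ?g u\<bar>) \<le> (\<Sum>u\<in>cube (B * T). ?b * ?E)"
    by (rule sum_mono)
  then have "(\<Sum>u\<in>cube (B * T). \<bar>?h u - ?b * ?g u\<bar>) \<le> ?N * (?b * ?E)"
    by (simp add: card_cube)
  then have "\<bar>\<Sum>u\<in>cube (B * T). ?h u - ?b * ?g u\<bar> \<le> ?N * (?b * ?E)"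
    by (rule order_trans[OF sum_abs])
  then have step: "\<bar>(\<Sum>u\<in>cube (B * T). ?h u) - ?b * (\<Sum>u\<in>cube (B * T). ?g u)\<bar> \<le> ?N * ?b * ?E"
    by (simp add: sum_subtractf sum_distrib_left mult_ac)
  have "\<bar>?b * ((\<Sum>u\<in>cube (B * T). ?g u) - ?N * fourier n f {})\<bar> \<le> ?b * (?N * (T * ?E))"
    unfolding abs_mult using Suc.IH by simp
  with step have "\<bar>(\<Sum>u\<in>cube (B * T). ?h u) - ?b * ?N * fourier n f {}\<bar> \<le> ?N * ?b * ?E + ?b * ?N * (T * ?E)"
    by (simp add: right_diff_distrib mult.assoc)
  then show ?case
    by (simp only: sum_cube_Suc[where G = "multilinear_ext n f"]) (simp add: power_add algebra_simps)
qed

lemma position_polarized: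
  assumes i: "i < n"
  shows "(\<Sum>y\<in>cube (B * T). sqrt (1 - \<bar>position T y i\<bar>)) \<le> 2 ^ (B * T) * (1 - \<alpha>\<^sup>2 / 32) ^ T"
proof (induction T)
  case 0
  have "cube 0 = {\<lambda>_. undefined}" by (simp add: cube_def)
  then show ?case by (simp add: position_def)
next
  case (Suc T)
  let ?c = "1 - \<alpha>\<^sup>2 / 32"
  have "\<alpha>\<^sup>2 \<le> 1" using \<alpha> by (simp add: abs_square_le_1)
  then have c: "0 \<le> ?c" by simp
  have bias1: "\<bar>\<Sum>v\<in>cube B. \<Xi> v i\<bar> \<le> \<delta> * card (cube B)"
    using bias[of "{i}"] i k by (simp add: monomial_def card_cube)
  have "(\<Sum>y\<in>cube (B * Suc T). sqrt (1 - \<bar>position (Suc T) y i\<bar>)) =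
      (\<Sum>u\<in>cube (B * T). \<Sum>v\<in>cube B. sqrt (1 - \<bar>walk_step \<alpha> (position T u) (\<Xi> v) i\<bar>))"
    by (rule sum_cube_Suc[where G = "\<lambda>X. sqrt (1 - \<bar>X i\<bar>)"])
  also have "\<dots> \<le> (\<Sum>u\<in>cube (B * T). card (cube B) * (sqrt (1 - \<bar>position T u i\<bar>) * ?c))"
  proof (rule sum_mono)
    fix u assume u: "u \<in> cube (B * T)"
    show "(\<Sum>v\<in>cube B. sqrt (1 - \<bar>walk_step \<alpha> (position T u) (\<Xi> v) i\<bar>))
        \<le> card (cube B) * (sqrt (1 - \<bar>position T u i\<bar>) * ?c)"
    proof (rule walk_step_contraction)
      show "\<bar>position T u i\<bar> \<le> 1" by (rule position_bounded[OF u order_refl i])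
      show "\<bar>\<Xi> v i\<bar> = 1" if "v \<in> cube B" for v by (rule cube_abs[OF \<Xi>[OF that] i])
    qed (fact \<alpha> bias1 \<delta>)+
  qed
  also have "\<dots> = 2 ^ B * ?c * (\<Sum>u\<in>cube (B * T). sqrt (1 - \<bar>position T u i\<bar>))"
    unfolding sum_distrib_left by (rule sum.cong) (simp_all add: card_cube)
  also have "\<dots> \<le> 2 ^ B * ?c * (2 ^ (B * T) * ?c ^ T)"
    using c Suc.IH by (intro mult_left_mono) auto
  finally show ?case by (simp add: power_add mult_ac)
qed

text \<open>The steps control the average of the extension, and the potential controls the rounding
  through \<open>1 - r \<le> sqrt (1 - r)\<close> for r between 0 and 1. The assumption
  \<open>sign\<close> leaves the output free at coordinates where the walk ends at zero.\<close>

theorem walk_fools: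
  assumes f: "f \<in> F" and out: "\<And>y. y \<in> cube (B * T) \<Longrightarrow> out y \<in> cube n"
    and sign: "\<And>y i. y \<in> cube (B * T) \<Longrightarrow> i < n \<Longrightarrow> position T y i = \<bar>position T y i\<bar> * out y i"
  shows "\<bar>(\<Sum>y\<in>cube (B * T). f (out y)) - 2 ^ (B * T) * fourier n f {}\<bar>
    \<le> 2 ^ (B * T) * (T * ((2 * \<alpha> * b) ^ k + \<delta> * A) + 2 * n * (1 - \<alpha>\<^sup>2 / 32) ^ T)"
proof -
  let ?N = "2 ^ (B * T) :: real" and ?c = "(1 - \<alpha>\<^sup>2 / 32) ^ T"
  have pt: "\<bar>f (out y) - multilinear_ext n f (position T y)\<bar> \<le> 2 * (\<Sum>i<n. sqrt (1 - \<bar>position T y i\<bar>))"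
    if y: "y \<in> cube (B * T)" for y
  proof -
    have b: "\<bar>position T y i\<bar> \<le> 1" if "i < n" for i
      using position_bounded[OF y order_refl that] .
    have "\<bar>f (out y) - multilinear_ext n f (position T y)\<bar> \<le> 2 * (\<Sum>i<n. 1 - \<bar>position T y i\<bar>)"
      using F f b by (intro rounding_error out y sign) auto
    also have "\<dots> \<le> 2 * (\<Sum>i<n. sqrt (1 - \<bar>position T y i\<bar>))"
      using b by (intro mult_left_mono sum_mono) (auto intro!: real_le_rsqrt power_le_one simp: power2_eq_square mult_left_le)
    finally show ?thesis .
  qed
  have "\<bar>(\<Sum>y\<in>cube (B * T). f (out y)) - (\<Sum>y\<in>cube (B * T). multilinear_ext n f (position T y))\<bar>
      \<le> (\<Sum>y\<in>cube (B * T). \<bar>f (out y) - multilinear_ext n f (position T y)\<bar>)"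
    unfolding sum_subtractf[symmetric] by (rule sum_abs)
  also have "\<dots> \<le> (\<Sum>y\<in>cube (B * T). 2 * (\<Sum>i<n. sqrt (1 - \<bar>position T y i\<bar>)))"
    by (intro sum_mono pt)
  also have "\<dots> = 2 * (\<Sum>i<n. \<Sum>y\<in>cube (B * T). sqrt (1 - \<bar>position T y i\<bar>))"
    unfolding sum_distrib_left[symmetric] by (subst sum.swap) (rule refl)
  also have "\<dots> \<le> 2 * (\<Sum>i<n. ?N * ?c)"
    by (intro mult_left_mono sum_mono position_polarized) auto
  finally have "\<bar>(\<Sum>y\<in>cube (B * T). f (out y)) - (\<Sum>y\<in>cube (B * T). multilinear_ext n f (position T y))\<bar>
      \<le> ?N * (2 * n * ?c)"
    by (simp add: mult_ac)
  with position_fools[OF f, of T] show ?thesis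
    by (simp add: distrib_left)
qed

end

section \<open>Averages over seeds and generators\<close>

lemma expectation_uniform_cube:
  "measure_pmf.expectation (pmf_of_set (cube n)) f = fourier n f {}"
  by (simp add: integral_pmf_of_set[OF cube_nonempty] card_cube fourier_def monomial_def)

lemma expectation_map_cube:
  fixes f :: "(nat \<Rightarrow> real) \<Rightarrow> real"
  shows
  "measure_pmf.expectation (map_pmf G (pmf_of_set (cube s))) f = (\<Sum>y\<in>cube s. f (G y)) / 2 ^ s"
  by (simp add: integral_map_pmf integral_pmf_of_set[OF cube_nonempty] card_cube)

lemma is_prg_cubeI:
  assumes "\<And>y. y \<in> cube s \<Longrightarrow> G y \<in> cube n"
    and "\<And>f. f \<in> F \<Longrightarrow> \<bar>(\<Sum>y\<in>cube s. f (G y)) - 2 ^ s * fourier n f {}\<bar> \<le> 2 ^ s * \<epsilon>"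
  shows "is_prg n F \<epsilon> (map_pmf G (pmf_of_set (cube s)))"
  unfolding is_prg_def expectation_uniform_cube expectation_map_cube
proof (intro conjI ballI)
  show "set_pmf (map_pmf G (pmf_of_set (cube s))) \<subseteq> cube n"
    using assms(1) by (auto simp: set_pmf_of_set[OF cube_nonempty])
  fix f assume "f \<in> F"
  then have "\<bar>(\<Sum>y\<in>cube s. f (G y)) - 2 ^ s * fourier n f {}\<bar> / 2 ^ s \<le> \<epsilon>"
    using assms(2)[of f] by (simp add: divide_le_eq mult.commute)
  moreover have "(\<Sum>y\<in>cube s. f (G y)) / 2 ^ s - fourier n f {} = ((\<Sum>y\<in>cube s. f (G y)) - 2 ^ s * fourier n f {}) / 2 ^ s"
    by (simp add: diff_divide_distrib)
  ultimately show "\<bar>(\<Sum>y\<in>cube s. f (G y)) / 2 ^ s - fourier n f {}\<bar> \<le> \<epsilon>"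
    by simp
qed

subsection \<open>A loop language on registers\<close>

text \<open>Cells below \<open>100\<close> are registers. Register \<open>0\<close> holds \<open>100\<close>, the address of the output,
  register \<open>1\<close> holds \<open>1\<close>, and register \<open>3\<close> is scratch. Register \<open>2\<close> clips the
  number of iterations of every loop, which bounds the running time by a polynomial in its value.
  The body of \<open>CFor r c\<close> runs with \<open>r\<close> counting down to \<open>0\<close>.\<close>

datatype cmd =
    CSkip
  | CConst nat nat
  | CMov nat nat
  | CAdd nat nat nat
  | CSub nat nat nat
  | CRead nat nat
  | COut nat nat
  | CSeq cmd cmd (infixr ";;" 60)
  | CIf nat cmd cmd
  | CFor nat cmd

text \<open>The loop overwrites \<open>r\<close> with its own count; that a compiled loop, which
  decrements the register, does the same relies on \<open>r \<notin> written c\<close> in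
  \<open>wf_cmd\<close>.\<close>

primrec for_loop :: "((nat \<Rightarrow> nat) \<Rightarrow> nat \<Rightarrow> nat) \<Rightarrow> nat \<Rightarrow> nat \<Rightarrow> (nat \<Rightarrow> nat) \<Rightarrow> nat \<Rightarrow> nat" where
  "for_loop f r 0 m = m"
| "for_loop f r (Suc v) m = for_loop f r v (f (m(r := v)))"

text \<open>The scratch register is tracked so that compiled code yields exactly this memory; in
  \<open>CFor\<close> the minimum is computed there by two truncated subtractions.\<close>

primrec sem :: "nat list \<Rightarrow> cmd \<Rightarrow> (nat \<Rightarrow> nat) \<Rightarrow> nat \<Rightarrow> nat" where
  "sem inp CSkip m = m"
| "sem inp (CConst r c) m = m(r := c)"
| "sem inp (CMov r p) m = m(3 := 0, r := m p)"
| "sem inp (CAdd r p q) m = m(r := m p + m q)"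
| "sem inp (CSub r p q) m = m(r := m p - m q)"
| "sem inp (CRead r p) m = m(r := nth_default 0 inp (m p))"
| "sem inp (COut i v) m = m(3 := m 0 + m i, m 0 + m i := m v)"
| "sem inp (c ;; d) m = sem inp d (sem inp c m)"
| "sem inp (CIf r c d) m = (if m r \<noteq> 0 then sem inp c m else sem inp d m)"
| "sem inp (CFor r c) m =
     for_loop (sem inp c) r (min (m r) (m 2)) (m(3 := m r - m 2, r := min (m r) (m 2)))"

text \<open>Registers only: the output cells that \<open>COut\<close> fills are not
  recorded.\<close>

primrec written :: "cmd \<Rightarrow> nat set" where
  "written CSkip = {}"
| "written (CConst r c) = {r}"
| "written (CMov r p) = {3, r}"
| "written (CAdd r p q) = {r}"
| "written (CSub r p q) = {r}"
| "written (CRead r p) = {r}"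
| "written (COut i v) = {3}"
| "written (c ;; d) = written c \<union> written d"
| "written (CIf r c d) = written c \<union> written d"
| "written (CFor r c) = {3, r} \<union> written c"

primrec output_free :: "cmd \<Rightarrow> bool" where
  "output_free CSkip = True"
| "output_free (CConst r c) = True"
| "output_free (CMov r p) = True"
| "output_free (CAdd r p q) = True"
| "output_free (CSub r p q) = True"
| "output_free (CRead r p) = True"
| "output_free (COut i v) = False"
| "output_free (c ;; d) = (output_free c \<and> output_free d)"
| "output_free (CIf r c d) = (output_free c \<and> output_free d)"
| "output_free (CFor r c) = output_free c"

primrec wf_cmd :: "cmd \<Rightarrow> bool" where
  "wf_cmd CSkip = True"
| "wf_cmd (CConst r c) = (4 \<le> r \<and> r < 100)"
| "wf_cmd (CMov r p) = (4 \<le> r \<and> r < 100 \<and> p \<noteq> 3)"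
| "wf_cmd (CAdd r p q) = (4 \<le> r \<and> r < 100)"
| "wf_cmd (CSub r p q) = (4 \<le> r \<and> r < 100)"
| "wf_cmd (CRead r p) = (4 \<le> r \<and> r < 100)"
| "wf_cmd (COut i v) = (v \<noteq> 3 \<and> v < 100 \<and> i \<noteq> 3)"
| "wf_cmd (c ;; d) = (wf_cmd c \<and> wf_cmd d)"
| "wf_cmd (CIf r c d) = (wf_cmd c \<and> wf_cmd d)"
| "wf_cmd (CFor r c) = (4 \<le> r \<and> r < 100 \<and> r \<notin> written c \<and> wf_cmd c)"

primrec compile :: "cmd \<Rightarrow> ram" where
  "compile CSkip = Skip"
| "compile (CConst r c) = Const r c"
| "compile (CMov r p) = Seq (Const 3 0) (Add r p 3)"
| "compile (CAdd r p q) = Add r p q"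
| "compile (CSub r p q) = Sub r p q"
| "compile (CRead r p) = Read r p"
| "compile (COut i v) = Seq (Add 3 0 i) (Store 3 v)"
| "compile (c ;; d) = Seq (compile c) (compile d)"
| "compile (CIf r c d) = Cond r (compile c) (compile d)"
| "compile (CFor r c) =
     Seq (Sub 3 r 2) (Seq (Sub r r 3) (While r (Seq (Sub r r 1) (compile c))))"

text \<open>Polynomials in the clip value. A loop pays two subtractions and the final test, and in
  each round a test and a decrement.\<close>

primrec cost :: "cmd \<Rightarrow> nat poly" where
  "cost CSkip = 1"
| "cost (CConst r c) = 1"
| "cost (CMov r p) = 2"
| "cost (CAdd r p q) = 1"
| "cost (CSub r p q) = 1"
| "cost (CRead r p) = 1"
| "cost (COut i v) = 2"
| "cost (c ;; d) = cost c + cost d"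
| "cost (CIf r c d) = 1 + cost c + cost d"
| "cost (CFor r c) = 3 + [:0, 1:] * (2 + cost c)"

definition ok :: "nat \<Rightarrow> (nat \<Rightarrow> nat) \<Rightarrow> bool" where
  "ok W m \<longleftrightarrow> m 0 = 100 \<and> m 1 = 1 \<and> m 2 = W"

lemma ok_upd [simp]: "r > 2 \<Longrightarrow> ok W (m(r := v)) = ok W m"
  by (auto simp: ok_def)

lemma for_loop_invariant:
  assumes "P v m" and "\<And>u m. u < v \<Longrightarrow> P (Suc u) m \<Longrightarrow> P u (f (m(r := u)))"
  shows "P 0 (for_loop f r v m)"
  using assms by (induction v arbitrary: m) auto

lemma written_range: "wf_cmd c \<Longrightarrow> a \<in> written c \<Longrightarrow> 3 \<le> a \<and> a < 100"
  by (induction c) auto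

text \<open>The value 100 of register 0 is carried through the induction because it keeps the writes
  of \<open>COut\<close> above all registers.\<close>

lemma sem_frame_gen:
  "wf_cmd c \<Longrightarrow> m 0 = 100 \<Longrightarrow> a < 100 \<Longrightarrow> a \<notin> written c \<Longrightarrow> sem inp c m a = m a \<and> sem inp c m 0 = 100"
proof (induction c arbitrary: m a)
  case (CSeq c d)
  from CSeq.prems have "sem inp c m a = m a \<and> sem inp c m 0 = 100"
    by (intro CSeq.IH(1)) simp_all
  with CSeq.prems show ?case
    using CSeq.IH(2)[of "sem inp c m" a] by simp
next
  case (CFor r c)
  let ?m = "m(3 := m r - m 2, r := min (m r) (m 2))"
  have "for_loop (sem inp c) r v m' a = m' a \<and> for_loop (sem inp c) r v m' 0 = 100" if "m' 0 = 100" for v m'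
    using that
  proof (induction v arbitrary: m')
    case (Suc v)
    have "sem inp c (m'(r := v)) a = (m'(r := v)) a \<and> sem inp c (m'(r := v)) 0 = 100"
      using CFor.prems Suc.prems by (intro CFor.IH) auto
    with Suc CFor.prems show ?case by simp
  qed simp
  from this[of ?m] CFor.prems show ?case by simp
qed auto

lemma sem_frame:
  "wf_cmd c \<Longrightarrow> ok W m \<Longrightarrow> a < 100 \<Longrightarrow> a \<notin> written c \<Longrightarrow> sem inp c m a = m a"
  using sem_frame_gen by (simp add: ok_def)

lemma sem_ok: "wf_cmd c \<Longrightarrow> ok W m \<Longrightarrow> ok W (sem inp c m)"
  using sem_frame[of c W m 0 inp] sem_frame[of c W m 1 inp] sem_frame[of c W m 2 inp]
    written_range[of c 0] written_range[of c 1] written_range[of c 2]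
  by (auto simp: ok_def)

lemma sem_output_frame:
  "wf_cmd c \<Longrightarrow> output_free c \<Longrightarrow> a \<ge> 100 \<Longrightarrow> sem inp c m a = m a"
proof (induction c arbitrary: m)
  case (CFor r c)
  have "for_loop (sem inp c) r v m' a = m' a" for v m'
    using CFor by (induction v arbitrary: m') auto
  with CFor.prems show ?case by simp
qed auto

lemma poly_nat_mono: "x \<le> y \<Longrightarrow> poly p x \<le> poly p y" for p :: "nat poly"
  by (simp add: poly_altdef sum_mono power_mono)

theorem compile_correct:
  "wf_cmd c \<Longrightarrow> ok W m \<Longrightarrow> \<exists>t\<le>poly (cost c) W. ram_run inp (compile c) m t (sem inp c m)"
proof (induction c arbitrary: m)
  case (CMov r p)
  have "ram_run inp (compile (CMov r p)) m (1 + 1) ((m(3 := 0))(r := (m(3 := 0)) p + (m(3 := 0)) 3))"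
    unfolding compile.simps by (rule ram_run.intros)+
  also have "(m(3 := 0))(r := (m(3 := 0)) p + (m(3 := 0)) 3) = sem inp (CMov r p) m"
    using CMov.prems by (simp add: fun_eq_iff)
  finally show ?case
    by (intro exI[of _ "1 + 1"] conjI) simp_all
next
  case (COut i v)
  let ?m = "m(3 := m 0 + m i)"
  have "ram_run inp (compile (COut i v)) m (1 + 1) (?m(?m 3 := ?m v))"
    unfolding compile.simps by (rule ram_run.intros)+
  also have "?m(?m 3 := ?m v) = sem inp (COut i v) m"
    using COut.prems by (simp add: fun_eq_iff)
  finally show ?case
    by (intro exI[of _ "1 + 1"] conjI) simp_all
next
  case (CSeq c d)
  then obtain t where t: "t \<le> poly (cost c) W" "ram_run inp (compile c) m t (sem inp c m)"
    by auto
  obtain t' where t': "t' \<le> poly (cost d) W" "ram_run inp (compile d) (sem inp c m) t' (sem inp d (sem inp c m))"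
    using CSeq.IH(2)[of "sem inp c m"] CSeq.prems sem_ok[of c W m inp] by auto
  have "ram_run inp (compile (c ;; d)) m (t + t') (sem inp (c ;; d) m)"
    using t t' by (auto intro: ram_run.Seq)
  then show ?case using t t' by (intro exI[of _ "t + t'"]) simp
next
  case (CIf r c d)
  show ?case
  proof (cases "m r = 0")
    case True
    obtain t where "t \<le> poly (cost d) W" "ram_run inp (compile d) m t (sem inp d m)"
      using CIf by auto
    with True show ?thesis by (auto intro!: exI[of _ "1 + t"] ram_run.Cond_False)
  next
    case False
    obtain t where "t \<le> poly (cost c) W" "ram_run inp (compile c) m t (sem inp c m)"
      using CIf by auto
    with False show ?thesis by (auto intro!: exI[of _ "1 + t"] ram_run.Cond_True)
  qed
next
  case (CFor r c)
  let ?L = "While r (Seq (Sub r r 1) (compile c))" and ?k = "poly (cost c) W"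
  have wfc: "wf_cmd c" using CFor.prems by simp
  have loop: "\<exists>t\<le>1 + v * (2 + ?k). ram_run inp ?L m' t (for_loop (sem inp c) r v m')"
    if "ok W m'" "m' r = v" for v m'
    using that
  proof (induction v arbitrary: m')
    case 0
    then show ?case by (auto intro!: exI[of _ 1] ram_run.While_False)
  next
    case (Suc v)
    let ?m = "m'(r := v)"
    have m: "ok W ?m" using Suc.prems CFor.prems by simp
    obtain t where t: "t \<le> ?k" "ram_run inp (compile c) ?m t (sem inp c ?m)"
      using CFor.IH[OF wfc m] by (elim exE conjE) (rule that)
    have "sem inp c ?m r = v"
      using sem_frame[of c W ?m r inp] CFor.prems m by simp
    then obtain t' where t': "t' \<le> 1 + v * (2 + ?k)" "ram_run inp ?L (sem inp c ?m) t' (for_loop (sem inp c) r v (sem inp c ?m))"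
      using Suc.IH[of "sem inp c ?m"] sem_ok[of c W ?m inp] CFor.prems m by auto
    have "ram_run inp (Sub r r 1) m' 1 ?m"
      using ram_run.Sub[of inp r r 1 m'] Suc.prems by (simp add: ok_def)
    then have run: "ram_run inp (Seq (Sub r r 1) (compile c)) m' (1 + t) (sem inp c ?m)"
      using t by (intro ram_run.Seq)
    have "m' r \<noteq> 0" using Suc.prems by simp
    then have "ram_run inp ?L m' (1 + (1 + t) + t') (for_loop (sem inp c) r (Suc v) m')"
      unfolding for_loop.simps by (rule ram_run.While_True[OF _ run t'(2)])
    then show ?case using t t' by (intro exI[of _ "1 + (1 + t) + t'"]) simp
  qed
  let ?m1 = "m(3 := m r - m 2)" and ?m2 = "m(3 := m r - m 2, r := min (m r) (m 2))"
  have r: "r \<noteq> 3" "r > 2" using CFor.prems by auto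
  have run1: "ram_run inp (Sub 3 r 2) m 1 ?m1"
    by (rule ram_run.Sub)
  have run2: "ram_run inp (Sub r r 3) ?m1 1 ?m2"
  proof -
    have "min (m r) (m 2) = m r - (m r - m 2)" by simp
    then show ?thesis using ram_run.Sub[of inp r r 3 ?m1] r by simp
  qed
  have "ok W ?m2" using CFor.prems r by simp
  from loop[OF this refl] obtain t where t: "t \<le> 1 + min (m r) (m 2) * (2 + ?k)"
    "ram_run inp ?L ?m2 t (for_loop (sem inp c) r (min (m r) (m 2)) ?m2)"
    by auto
  have "ram_run inp (compile (CFor r c)) m (1 + (1 + t)) (sem inp (CFor r c) m)"
    unfolding compile.simps sem.simps by (rule ram_run.Seq[OF run1 ram_run.Seq[OF run2 t(2)]])
  moreover have "t \<le> 1 + W * (2 + ?k)"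
  proof -
    have "min (m r) (m 2) * (2 + ?k) \<le> W * (2 + ?k)"
      using CFor.prems by (intro mult_le_mono1) (simp add: ok_def)
    with t(1) show ?thesis by linarith
  qed
  ultimately show ?case
    by (intro exI[of _ "1 + (1 + t)"]) simp
qed (auto intro!: exI[of _ 1] ram_run.intros)

text \<open>\<open>P u\<close> speaks of a state with \<open>u\<close> rounds left. The premises
  \<open>init\<close> and \<open>upd\<close> account for the writes of the loop itself, to the
  scratch register at the start and to the counter before each round.\<close>

lemma sem_for_invariant:
  assumes "wf_cmd (CFor r c)" "ok W m" "m r \<le> W"
    and init: "\<And>m'. (\<And>a. a < 100 \<Longrightarrow> a \<noteq> 3 \<Longrightarrow> m' a = m a) \<Longrightarrow> P (m r) m'"
    and step: "\<And>u m'. u < m r \<Longrightarrow> ok W m' \<Longrightarrow> (\<And>a. a < 100 \<Longrightarrow> a \<notin> written (CFor r c) \<Longrightarrow> m' a = m a) \<Longrightarrow>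
      m' r = u \<Longrightarrow> P (Suc u) m' \<Longrightarrow> P u (sem inp c m')"
    and upd: "\<And>u v m'. P u m' \<Longrightarrow> P u (m'(r := v))"
  shows "P 0 (sem inp (CFor r c) m)"
proof -
  let ?Q = "\<lambda>u m'. ok W m' \<and> (\<forall>a. a < 100 \<longrightarrow> a \<notin> written (CFor r c) \<longrightarrow> m' a = m a) \<and> P u m'"
  let ?m2 = "m(3 := m r - m 2, r := m r)"
  have mn: "min (m r) (m 2) = m r" using assms by (simp add: ok_def)
  have "?Q 0 (for_loop (sem inp c) r (m r) ?m2)"
  proof (rule for_loop_invariant[where P = ?Q])
    show "?Q (m r) ?m2"
      using assms(1,2) init[of ?m2] by auto
    fix u m' assume u: "u < m r" and Q: "?Q (Suc u) m'"
    let ?m = "m'(r := u)"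
    have ok: "ok W ?m" using Q assms(1) by simp
    have frame: "?m a = m a" if "a < 100" "a \<notin> written (CFor r c)" for a
      using that Q by auto
    have "P (Suc u) ?m" using Q by (intro upd) blast
    then have "P u (sem inp c ?m)"
      by (intro step u ok frame) simp_all
    moreover have "sem inp c ?m a = m a" if "a < 100" "a \<notin> written (CFor r c)" for a
      using sem_frame[of c W ?m a inp] frame[OF that] ok assms(1) that by simp
    ultimately show "?Q u (sem inp c ?m)"
      using sem_ok[of c W ?m] ok assms(1) by auto
  qed
  then show ?thesis by (simp add: mn)
qed

text \<open>Like \<open>ok\<close>, but without naming the clip value, which makes the frame rules
  usable as conditional rewrite rules.\<close>

definition regs_ok :: "(nat \<Rightarrow> nat) \<Rightarrow> bool" where
  "regs_ok m \<longleftrightarrow> m 0 = 100 \<and> m 1 = 1"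

lemma regs_okD: "regs_ok m \<Longrightarrow> m 0 = 100" "regs_ok m \<Longrightarrow> m 1 = 1" "regs_ok m \<Longrightarrow> m (Suc 0) = 1"
  by (simp_all add: regs_ok_def)

lemma regs_ok_ok: "regs_ok m \<Longrightarrow> ok (m 2) m"
  by (simp add: regs_ok_def ok_def)

lemma ok_regs_ok: "ok W m \<Longrightarrow> regs_ok m"
  by (simp add: regs_ok_def ok_def)

lemma regs_ok_upd [simp]: "r > 2 \<Longrightarrow> regs_ok (m(r := v)) = regs_ok m"
  by (auto simp: regs_ok_def)

lemma regs_ok_sem [simp]: "wf_cmd c \<Longrightarrow> regs_ok m \<Longrightarrow> regs_ok (sem inp c m)"
  using sem_ok regs_ok_ok ok_regs_ok by metis

lemma sem_frame' [simp]:
  "wf_cmd c \<Longrightarrow> regs_ok m \<Longrightarrow> a < 100 \<Longrightarrow> a \<notin> written c \<Longrightarrow> sem inp c m a = m a"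
  using sem_frame regs_ok_ok by metis

lemma sem_clip [simp]: "wf_cmd c \<Longrightarrow> regs_ok m \<Longrightarrow> sem inp c m 2 = m 2"
  using sem_frame[of c "m 2" m 2 inp] written_range[of c 2] regs_ok_ok[of m] by force

lemma sem_for_rule:
  assumes "wf_cmd (CFor r c)" "regs_ok m" "m r \<le> m 2"
    and init: "\<And>m'. regs_ok m' \<Longrightarrow> (\<And>a. a < 100 \<Longrightarrow> a \<noteq> 3 \<Longrightarrow> m' a = m a) \<Longrightarrow> P (m r) m'"
    and step: "\<And>u m'. u < m r \<Longrightarrow> regs_ok m' \<Longrightarrow> m' 2 = m 2 \<Longrightarrow>
      (\<And>a. a < 100 \<Longrightarrow> a \<notin> insert 3 (insert r (written c)) \<Longrightarrow> m' a = m a) \<Longrightarrow>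
      m' r = u \<Longrightarrow> P (Suc u) m' \<Longrightarrow> P u (sem inp c m')"
    and upd: "\<And>u v m'. P u m' \<Longrightarrow> P u (m'(r := v))"
  shows "P 0 (sem inp (CFor r c) m)"
proof (rule sem_for_invariant[where P = P, OF assms(1) regs_ok_ok[OF assms(2)] assms(3)])
  show "P (m r) m'" if "\<And>a. a < 100 \<Longrightarrow> a \<noteq> 3 \<Longrightarrow> m' a = m a" for m'
  proof (rule init)
    show "regs_ok m'" using that[of 0] that[of 1] assms(2) by (simp add: regs_ok_def)
  qed (rule that)
next
  fix u m' assume *: "u < m r" "ok (m 2) m'" "\<And>a. a < 100 \<Longrightarrow> a \<notin> written (CFor r c) \<Longrightarrow> m' a = m a"
    "m' r = u" "P (Suc u) m'"
  show "P u (sem inp c m')"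
  proof (rule step)
    show "regs_ok m'" "m' 2 = m 2" using *(2) by (simp_all add: ok_def regs_ok_def)
    show "m' a = m a" if "a < 100" "a \<notin> insert 3 (insert r (written c))" for a
      using that by (intro *(3)) auto
  qed (rule *)+
qed (rule upd)

section \<open>Arithmetic subroutines\<close>

definition mul_cmd :: "nat \<Rightarrow> nat \<Rightarrow> nat \<Rightarrow> nat \<Rightarrow> cmd" where
  "mul_cmd z x y c = (CConst z 0 ;; CMov c y ;; CFor c (CAdd z z x))"

lemma mul_cmd_simps [simp]:
  "written (mul_cmd z x y c) = {3, z, c}"
  "output_free (mul_cmd z x y c)"
  "4 \<le> z \<Longrightarrow> z < 100 \<Longrightarrow> 4 \<le> c \<Longrightarrow> c < 100 \<Longrightarrow> y \<noteq> 3 \<Longrightarrow> c \<noteq> z \<Longrightarrow> wf_cmd (mul_cmd z x y c)"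
  by (auto simp: mul_cmd_def)

text \<open>Only \<open>m y\<close>, the number of additions, has to respect the clip;
  \<open>m x\<close> may be exponentially large.\<close>

lemma sem_mul_cmd [simp]:
  assumes "regs_ok m" "4 \<le> z" "z < 100" "4 \<le> c" "c < 100" "c \<noteq> z" "x < 100" "y < 100"
    "x \<noteq> 3" "x \<noteq> z" "x \<noteq> c" "y \<noteq> 3" "y \<noteq> z" "m y \<le> m 2"
  shows "sem inp (mul_cmd z x y c) m z = m x * m y"
proof -
  let ?m = "m(z := 0, 3 := 0, c := m y)"
  have "(\<lambda>u m'. m' z + m x * u = m x * m y) 0 (sem inp (CFor c (CAdd z z x)) ?m)"
    by (rule sem_for_rule[where P = "\<lambda>u m'. m' z + m x * u = m x * m y"]) (use assms in auto)
  then show ?thesis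
    using assms by (simp add: mul_cmd_def)
qed

definition shift_cmd :: "nat \<Rightarrow> nat \<Rightarrow> nat \<Rightarrow> cmd" where
  "shift_cmd x y c = (CMov c y ;; CFor c (CAdd x x x))"

lemma shift_cmd_simps [simp]:
  "written (shift_cmd x y c) = {3, c, x}"
  "output_free (shift_cmd x y c)"
  "4 \<le> x \<Longrightarrow> x < 100 \<Longrightarrow> 4 \<le> c \<Longrightarrow> c < 100 \<Longrightarrow> y \<noteq> 3 \<Longrightarrow> c \<noteq> x \<Longrightarrow> wf_cmd (shift_cmd x y c)"
  by (auto simp: shift_cmd_def)

lemma sem_shift_cmd [simp]:
  assumes "regs_ok m" "4 \<le> x" "x < 100" "4 \<le> c" "c < 100" "c \<noteq> x" "y < 100"
    "y \<noteq> 3" "m y \<le> m 2"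
  shows "sem inp (shift_cmd x y c) m x = m x * 2 ^ m y"
proof -
  let ?m = "m(3 := 0, c := m y)"
  have "(\<lambda>u m'. m' x * 2 ^ u = m x * 2 ^ m y) 0 (sem inp (CFor c (CAdd x x x)) ?m)"
    by (rule sem_for_rule[where P = "\<lambda>u m'. m' x * 2 ^ u = m x * 2 ^ m y"]) (use assms in \<open>auto simp: algebra_simps\<close>)
  then show ?thesis
    using assms by (simp add: shift_cmd_def)
qed

text \<open>The binary logarithm rounded up, with value 0 at both 0 and 1.\<close>

definition clog :: "nat \<Rightarrow> nat" where
  "clog x = (LEAST c. x \<le> 2 ^ c)"

lemma le_clog: "x \<le> 2 ^ clog x"
  unfolding clog_def by (rule LeastI[of _ x]) (simp add: less_imp_le)

lemma clog_le_iff: "clog x \<le> c \<longleftrightarrow> x \<le> 2 ^ c"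
proof
  assume "clog x \<le> c"
  then have "(2 :: nat) ^ clog x \<le> 2 ^ c" by simp
  with le_clog[of x] show "x \<le> 2 ^ c" by linarith
qed (simp add: clog_def Least_le)

text \<open>The counter has reached its final value as soon as \<open>2 ^ y\<close> exceeds \<open>x\<close>.\<close>

definition clog_cmd :: "nat \<Rightarrow> nat \<Rightarrow> cmd" where
  "clog_cmd y x = (CConst 10 1 ;; CConst y 0 ;; CMov 11 2 ;;
     CFor 11 (CSub 12 x 10 ;; CIf 12 (CAdd 10 10 10 ;; CAdd y y 1) CSkip))"

lemma clog_cmd_simps [simp]:
  "written (clog_cmd y x) = {3, 10, 11, 12, y}"
  "output_free (clog_cmd y x)"
  "4 \<le> y \<Longrightarrow> y < 100 \<Longrightarrow> y \<noteq> 10 \<Longrightarrow> y \<noteq> 11 \<Longrightarrow> y \<noteq> 12 \<Longrightarrow> wf_cmd (clog_cmd y x)"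
  by (auto simp: clog_cmd_def)

lemma sem_clog_cmd [simp]:
  assumes "regs_ok m" "4 \<le> y" "y < 100" "y \<noteq> 10" "y \<noteq> 11" "y \<noteq> 12"
    "x < 100" "x \<noteq> 3" "x \<noteq> 10" "x \<noteq> 11" "x \<noteq> 12" "x \<noteq> y" "clog (m x) \<le> m 2"
  shows "sem inp (clog_cmd y x) m y = clog (m x)"
proof -
  let ?c = "CSub 12 x 10 ;; CIf 12 (CAdd 10 10 10 ;; CAdd y y 1) CSkip"
  let ?m = "m(10 := 1, y := 0, 3 := 0, 11 := m 2)"
  have "(\<lambda>u m'. m' 10 = 2 ^ m' y \<and> m' y \<le> clog (m x) \<and> clog (m x) \<le> m' y + u) 0 (sem inp (CFor 11 ?c) ?m)"
  proof (rule sem_for_rule[where P = "\<lambda>u m'. m' 10 = 2 ^ m' y \<and> m' y \<le> clog (m x) \<and> clog (m x) \<le> m' y + u"])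
    fix u m' assume *: "u < ?m 11" "regs_ok m'" "m' 2 = ?m 2"
      "\<And>a. a < 100 \<Longrightarrow> a \<notin> insert 3 (insert 11 (written ?c)) \<Longrightarrow> m' a = ?m a"
      "m' 11 = u" "m' 10 = 2 ^ m' y \<and> m' y \<le> clog (m x) \<and> clog (m x) \<le> m' y + Suc u"
    have "m' x = m x" using *(4)[of x] assms by simp
    moreover have "m x - 2 ^ m' y \<noteq> 0 \<longleftrightarrow> \<not> clog (m x) \<le> m' y"
      by (simp add: clog_le_iff)
    ultimately show "sem inp ?c m' 10 = 2 ^ sem inp ?c m' y \<and> sem inp ?c m' y \<le> clog (m x) \<and> clog (m x) \<le> sem inp ?c m' y + u"
      using *(6) regs_okD(2)[OF *(2)] assms(2-12) by auto
  qed (use assms in auto)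
  then have "sem inp (CFor 11 ?c) ?m y = clog (m x)"
    by (intro le_antisym) simp_all
  then show ?thesis
    using assms by (simp add: clog_cmd_def)
qed

definition ceil_div :: "nat \<Rightarrow> nat \<Rightarrow> nat" where
  "ceil_div x d = (LEAST a. x \<le> a * d)"

lemma ceil_div_le_iff: "d > 0 \<Longrightarrow> ceil_div x d \<le> c \<longleftrightarrow> x \<le> c * d"
proof
  assume d: "d > 0"
  assume "ceil_div x d \<le> c"
  then have "ceil_div x d * d \<le> c * d" by simp
  moreover have "x \<le> ceil_div x d * d"
    unfolding ceil_div_def by (rule LeastI[of _ x]) (use d in simp)
  ultimately show "x \<le> c * d" by linarith
qed (simp add: ceil_div_def Least_le)

definition ceil_div_cmd :: "nat \<Rightarrow> nat \<Rightarrow> nat \<Rightarrow> cmd" where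
  "ceil_div_cmd y x d = (CConst 10 0 ;; CConst y 0 ;; CMov 11 2 ;;
     CFor 11 (CSub 12 x 10 ;; CIf 12 (CAdd 10 10 d ;; CAdd y y 1) CSkip))"

lemma ceil_div_cmd_simps [simp]:
  "written (ceil_div_cmd y x d) = {3, 10, 11, 12, y}"
  "output_free (ceil_div_cmd y x d)"
  "4 \<le> y \<Longrightarrow> y < 100 \<Longrightarrow> y \<noteq> 10 \<Longrightarrow> y \<noteq> 11 \<Longrightarrow> y \<noteq> 12 \<Longrightarrow> wf_cmd (ceil_div_cmd y x d)"
  by (auto simp: ceil_div_cmd_def)

lemma sem_ceil_div_cmd [simp]:
  assumes "regs_ok m" "4 \<le> y" "y < 100" "y \<noteq> 10" "y \<noteq> 11" "y \<noteq> 12"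
    "x < 100" "x \<noteq> 3" "x \<noteq> 10" "x \<noteq> 11" "x \<noteq> 12" "x \<noteq> y"
    "d < 100" "d \<noteq> 3" "d \<noteq> 10" "d \<noteq> 11" "d \<noteq> 12" "d \<noteq> y" "m d > 0" "ceil_div (m x) (m d) \<le> m 2"
  shows "sem inp (ceil_div_cmd y x d) m y = ceil_div (m x) (m d)"
proof -
  let ?c = "CSub 12 x 10 ;; CIf 12 (CAdd 10 10 d ;; CAdd y y 1) CSkip"
  let ?m = "m(10 := 0, y := 0, 3 := 0, 11 := m 2)" and ?q = "ceil_div (m x) (m d)"
  have "(\<lambda>u m'. m' 10 = m' y * m d \<and> m' y \<le> ?q \<and> ?q \<le> m' y + u) 0 (sem inp (CFor 11 ?c) ?m)"
  proof (rule sem_for_rule[where P = "\<lambda>u m'. m' 10 = m' y * m d \<and> m' y \<le> ?q \<and> ?q \<le> m' y + u"])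
    fix u m' assume *: "u < ?m 11" "regs_ok m'" "m' 2 = ?m 2"
      "\<And>a. a < 100 \<Longrightarrow> a \<notin> insert 3 (insert 11 (written ?c)) \<Longrightarrow> m' a = ?m a"
      "m' 11 = u" "m' 10 = m' y * m d \<and> m' y \<le> ?q \<and> ?q \<le> m' y + Suc u"
    have "m' x = m x" "m' d = m d" using *(4)[of x] *(4)[of d] assms by simp_all
    moreover have "m x - m' y * m d \<noteq> 0 \<longleftrightarrow> \<not> ?q \<le> m' y"
      using assms by (simp add: ceil_div_le_iff)
    ultimately show "sem inp ?c m' 10 = sem inp ?c m' y * m d \<and> sem inp ?c m' y \<le> ?q \<and> ?q \<le> sem inp ?c m' y + u"
      using *(6) regs_okD(2)[OF *(2)] assms(2-18) by auto
  qed (use assms in auto)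
  then have "sem inp (CFor 11 ?c) ?m y = ?q"
    by (intro le_antisym) simp_all
  then show ?thesis
    using assms by (simp add: ceil_div_cmd_def)
qed

definition trinomial_exponent :: "nat \<Rightarrow> nat" where
  "trinomial_exponent x = (LEAST l. x \<le> 2 * 3 ^ l)"

lemma trinomial_exponent_le_iff: "trinomial_exponent x \<le> l \<longleftrightarrow> x \<le> 2 * 3 ^ l"
proof
  assume "trinomial_exponent x \<le> l"
  then have "(2 :: nat) * 3 ^ trinomial_exponent x \<le> 2 * 3 ^ l" by simp
  moreover have "x \<le> 2 * 3 ^ trinomial_exponent x"
  proof -
    have "x \<le> 3 ^ x" by (rule less_imp_le, rule less_le_trans[OF less_exp]) (rule power_mono, simp_all)
    then have "x \<le> 2 * 3 ^ x" by linarith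
    then show ?thesis unfolding trinomial_exponent_def by (rule LeastI)
  qed
  ultimately show "x \<le> 2 * 3 ^ l" by linarith
qed (simp add: trinomial_exponent_def Least_le)

definition power3_cmd :: "nat \<Rightarrow> nat \<Rightarrow> cmd" where
  "power3_cmd y x = (CConst y 1 ;; CMov 11 2 ;;
     CFor 11 (CAdd 10 y y ;; CSub 12 x 10 ;; CIf 12 (CAdd y 10 y) CSkip))"

lemma power3_cmd_simps [simp]:
  "written (power3_cmd y x) = {3, 10, 11, 12, y}"
  "output_free (power3_cmd y x)"
  "4 \<le> y \<Longrightarrow> y < 100 \<Longrightarrow> y \<noteq> 10 \<Longrightarrow> y \<noteq> 11 \<Longrightarrow> y \<noteq> 12 \<Longrightarrow> wf_cmd (power3_cmd y x)"
  by (auto simp: power3_cmd_def)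

lemma sem_power3_cmd [simp]:
  assumes "regs_ok m" "4 \<le> y" "y < 100" "y \<noteq> 10" "y \<noteq> 11" "y \<noteq> 12"
    "x < 100" "x \<noteq> 3" "x \<noteq> 10" "x \<noteq> 11" "x \<noteq> 12" "x \<noteq> y" "trinomial_exponent (m x) \<le> m 2"
  shows "sem inp (power3_cmd y x) m y = 3 ^ trinomial_exponent (m x)"
proof -
  let ?c = "CAdd 10 y y ;; CSub 12 x 10 ;; CIf 12 (CAdd y 10 y) CSkip"
  let ?m = "m(y := 1, 3 := 0, 11 := m 2)" and ?q = "trinomial_exponent (m x)"
  have "(\<lambda>u m'. \<exists>l. m' y = 3 ^ l \<and> l \<le> ?q \<and> ?q \<le> l + u) 0 (sem inp (CFor 11 ?c) ?m)"
  proof (rule sem_for_rule[where P = "\<lambda>u m'. \<exists>l. m' y = 3 ^ l \<and> l \<le> ?q \<and> ?q \<le> l + u"])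
    fix u m' assume *: "u < ?m 11" "regs_ok m'" "m' 2 = ?m 2"
      "\<And>a. a < 100 \<Longrightarrow> a \<notin> insert 3 (insert 11 (written ?c)) \<Longrightarrow> m' a = ?m a"
      "m' 11 = u" "\<exists>l. m' y = 3 ^ l \<and> l \<le> ?q \<and> ?q \<le> l + Suc u"
    then obtain l where l: "m' y = 3 ^ l" "l \<le> ?q" "?q \<le> l + Suc u" by blast
    have x: "m' x = m x" using *(4)[of x] assms by simp
    have iff: "m x - 2 * 3 ^ l \<noteq> 0 \<longleftrightarrow> \<not> ?q \<le> l"
      by (simp add: trinomial_exponent_le_iff)
    show "\<exists>l. sem inp ?c m' y = 3 ^ l \<and> l \<le> ?q \<and> ?q \<le> l + u"
    proof (cases "?q \<le> l")
      case True
      then show ?thesis using l x iff regs_okD(2)[OF *(2)] assms(2-12) by (intro exI[of _ l]) (auto simp: mult_2)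
    next
      case False
      then show ?thesis using l x iff regs_okD(2)[OF *(2)] assms(2-12) by (intro exI[of _ "Suc l"]) (auto simp: mult_2)
    qed
  next
    show "\<exists>l. m' y = 3 ^ l \<and> l \<le> ?q \<and> ?q \<le> l + ?m 11"
      if "\<And>a. a < 100 \<Longrightarrow> a \<noteq> 3 \<Longrightarrow> m' a = ?m a" for m'
      using that[of y] assms by (intro exI[of _ 0]) simp
  qed (use assms in auto)
  then show ?thesis
    using assms by (auto simp: power3_cmd_def)
qed

subsection \<open>Evaluating the small-bias generator\<close>

text \<open>Polynomials over the field with two elements are represented by natural numbers: their coefficients,
  lifted to natural numbers, are the digits in base \<open>2 ^ w\<close>. Products of such numbers are only reduced
  modulo \<open>2\<close> and modulo the trinomial at the very end.\<close>

definition seed_number :: "nat list \<Rightarrow> nat \<Rightarrow> nat \<Rightarrow> nat \<Rightarrow> nat" where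
  "seed_number inp w d ofs = (\<Sum>b<d. of_bool (nth_default 0 inp (ofs + b) \<noteq> 0) * (2 ^ w) ^ b)"

lemma sum_shift_Suc:
  fixes x :: "'a :: comm_semiring_1"
  shows "(\<Sum>j<Suc d. g (u + j) * x ^ j) = g u + (\<Sum>j<d. g (Suc u + j) * x ^ j) * x"
  unfolding sum_distrib_right by (subst sum.lessThan_Suc_shift) (simp add: mult_ac)

lemma geometric_sum_Suc: "(\<Sum>e<Suc d. a ^ e) = (\<Sum>e<d. a ^ e) * a + 1" for a :: "'a :: comm_semiring_1"
  using sum_shift_Suc[of "\<lambda>_. 1" 0 a d] by (simp only: mult_1 add_0 add.commute)

lemma seed_number_Suc:
  "seed_number inp w (Suc d) ofs = of_bool (nth_default 0 inp ofs \<noteq> 0) + 2 ^ w * seed_number inp w d (Suc ofs)"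
  unfolding seed_number_def
  using sum_shift_Suc[of "\<lambda>j. of_bool (nth_default 0 inp j \<noteq> 0)" ofs "2 ^ w" d]
  by (simp only: mult.commute)

text \<open>The seed number is too large to count a loop, so register 53 is multiplied by it with
  Horner's scheme over the seed bits. Register 57 holds their offset, 28 their number, 60 the digit
  width, and 58 receives the product.\<close>

definition mul_seed_cmd :: cmd where
  "mul_seed_cmd = (CConst 58 0 ;; CMov 62 28 ;;
     CFor 62 (shift_cmd 58 60 63 ;; CAdd 64 57 62 ;; CRead 65 64 ;; CIf 65 (CAdd 58 58 53) CSkip))"

lemma mul_seed_cmd_simps [simp]:
  "written mul_seed_cmd = {3, 58, 62, 63, 64, 65}"
  "output_free mul_seed_cmd" "wf_cmd mul_seed_cmd"
  by (auto simp: mul_seed_cmd_def)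

lemma sem_mul_seed_cmd [simp]:
  assumes "regs_ok m" "m 28 \<le> m 2" "m 60 \<le> m 2"
  shows "sem inp mul_seed_cmd m 58 = m 53 * seed_number inp (m 60) (m 28) (m 57)"
proof -
  let ?c = "shift_cmd 58 60 63 ;; CAdd 64 57 62 ;; CRead 65 64 ;; CIf 65 (CAdd 58 58 53) CSkip"
  let ?m = "m(58 := 0, 3 := 0, 62 := m 28)"
  have "(sem inp (CFor 62 ?c) ?m) 58 = m 53 * seed_number inp (m 60) (m 28 - 0) (m 57 + 0)"
  proof (rule sem_for_rule[where P = "\<lambda>u m'. m' 58 = m 53 * seed_number inp (m 60) (m 28 - u) (m 57 + u)"])
    fix u m' assume *: "u < ?m 62" "regs_ok m'" "m' 2 = ?m 2"
      "\<And>a. a < 100 \<Longrightarrow> a \<notin> insert 3 (insert 62 (written ?c)) \<Longrightarrow> m' a = ?m a"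
      "m' 62 = u" "m' 58 = m 53 * seed_number inp (m 60) (m 28 - Suc u) (m 57 + Suc u)"
    have u: "m 28 - u = Suc (m 28 - Suc u)" using *(1) by simp
    have m': "m' 60 = m 60" "m' 57 = m 57" "m' 53 = m 53" "m' 2 = m 2"
      using *(4)[of 60] *(4)[of 57] *(4)[of 53] *(3) by simp_all
    show "sem inp ?c m' 58 = m 53 * seed_number inp (m 60) (m 28 - u) (m 57 + u)"
      unfolding u seed_number_Suc using *(2,5,6) m' assms by (simp add: algebra_simps)
  qed (use assms in \<open>auto simp: seed_number_def\<close>)
  then show ?thesis
    using assms by (simp add: mul_seed_cmd_def)
qed

text \<open>Horner's scheme in the hash point, over the binary digits of the index from the top. A
  comparison of r with \<open>2 ^ u\<close> is the truncated difference
  \<open>(r + 1) - 2 ^ u\<close>, which is nonzero exactly for \<open>2 ^ u \<le> r\<close>.\<close>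

definition index_cmd :: cmd where
  "index_cmd = (CConst 53 0 ;; CMov 54 50 ;; CMov 55 21 ;;
     CFor 55 (CMov 57 44 ;; mul_seed_cmd ;; CMov 53 58 ;; CConst 66 1 ;; shift_cmd 66 55 67 ;;
       CAdd 68 54 1 ;; CSub 69 68 66 ;; CIf 69 (CSub 54 54 66 ;; CAdd 53 53 51) CSkip))"

lemma index_cmd_simps [simp]:
  "written index_cmd = {3, 53, 54, 55, 57, 58, 62, 63, 64, 65, 66, 67, 68, 69}"
  "output_free index_cmd" "wf_cmd index_cmd"
  by (auto simp: index_cmd_def)

lemma mod_power_Suc_split: "i mod 2 ^ Suc u = i mod 2 ^ u + of_bool (odd (i div 2 ^ u)) * 2 ^ u"
  for i :: nat
  using mod_mult2_eq[of i "2 ^ u" 2] by (simp add: mult.commute odd_iff_mod_2_eq_one of_bool_def)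

lemma sem_index_cmd [simp]:
  assumes "regs_ok m" "m 28 \<le> m 2" "m 60 \<le> m 2" "m 21 \<le> m 2" "m 50 < 2 ^ m 21"
  shows "sem inp index_cmd m 53 = m 51 * index_value (m 21) (m 50) (seed_number inp (m 60) (m 28) (m 44))"
proof -
  let ?c = "CMov 57 44 ;; mul_seed_cmd ;; CMov 53 58 ;; CConst 66 1 ;; shift_cmd 66 55 67 ;;
       CAdd 68 54 1 ;; CSub 69 68 66 ;; CIf 69 (CSub 54 54 66 ;; CAdd 53 53 51) CSkip"
  let ?m = "m(53 := 0, 3 := 0, 54 := m 50, 3 := 0, 55 := m 21)"
  let ?x = "seed_number inp (m 60) (m 28) (m 44)" and ?i = "m 50"
  define g where "g j = (of_bool (odd (?i div 2 ^ j)) :: nat)" for j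
  have "(sem inp (CFor 55 ?c) ?m) 54 = ?i mod 2 ^ 0 \<and>
      (sem inp (CFor 55 ?c) ?m) 53 = m 51 * (\<Sum>j<m 21 - 0. g (0 + j) * ?x ^ j)"
  proof (rule sem_for_rule[where P = "\<lambda>u m'. m' 54 = ?i mod 2 ^ u \<and> m' 53 = m 51 * (\<Sum>j<m 21 - u. g (u + j) * ?x ^ j)"])
    fix u m' assume *: "u < ?m 55" "regs_ok m'" "m' 2 = ?m 2"
      "\<And>a. a < 100 \<Longrightarrow> a \<notin> insert 3 (insert 55 (written ?c)) \<Longrightarrow> m' a = ?m a"
      "m' 55 = u" "m' 54 = ?i mod 2 ^ Suc u \<and> m' 53 = m 51 * (\<Sum>j<m 21 - Suc u. g (Suc u + j) * ?x ^ j)"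
    have u: "m 21 - u = Suc (m 21 - Suc u)" "u \<le> m 2" using *(1) assms by simp_all
    have m': "m' 60 = m 60" "m' 28 = m 28" "m' 44 = m 44" "m' 51 = m 51" "m' 2 = m 2"
      using *(4)[of 60] *(4)[of 28] *(4)[of 44] *(4)[of 51] *(3) by simp_all
    have lt: "Suc (?i mod 2 ^ u) \<le> 2 ^ u" by (rule Suc_leI) simp
    show "sem inp ?c m' 54 = ?i mod 2 ^ u \<and> sem inp ?c m' 53 = m 51 * (\<Sum>j<m 21 - u. g (u + j) * ?x ^ j)"
      unfolding u(1) sum_shift_Suc
      using *(2,5) *(6)[unfolded mod_power_Suc_split] m' assms(1-3) u(2) lt regs_okD(2,3)[OF *(2)]
      by (cases "odd (?i div 2 ^ u)") (simp_all add: g_def algebra_simps)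
  qed (use assms in auto)
  then show ?thesis
    using assms by (simp add: index_cmd_def index_value_def g_def)
qed

text \<open>The geometric sum by Horner: each round multiplies register 51 by the hash value and by
  the second seed number and adds 1. The three seed numbers lie one after the other from the offset
  in register 44.\<close>

definition column_cmd :: cmd where
  "column_cmd = (CConst 51 0 ;; CMov 52 20 ;;
     CFor 52 (index_cmd ;; CAdd 57 44 28 ;; mul_seed_cmd ;; CAdd 51 58 1) ;;
     CMov 53 51 ;; CAdd 57 44 28 ;; CAdd 57 57 28 ;; mul_seed_cmd ;; CMov 56 58)"

lemma column_cmd_simps [simp]:
  "written column_cmd = {3, 51, 52, 53, 54, 55, 56, 57, 58, 62, 63, 64, 65, 66, 67, 68, 69}"
  "output_free column_cmd" "wf_cmd column_cmd"
  by (auto simp: column_cmd_def)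

lemma sem_column_cmd [simp]:
  fixes inp :: "nat list" and m :: "nat \<Rightarrow> nat"
  assumes "regs_ok m" "m 28 \<le> m 2" "m 60 \<le> m 2" "m 21 \<le> m 2" "m 20 \<le> m 2" "m 50 < 2 ^ m 21"
  defines "seed \<equiv> seed_number inp (m 60) (m 28)"
  shows "sem inp column_cmd m 56 = seed (m 44 + m 28 + m 28) *
    power_column (m 20) (m 21) (m 50) (seed (m 44)) (seed (m 44 + m 28))"
proof -
  let ?c = "index_cmd ;; CAdd 57 44 28 ;; mul_seed_cmd ;; CAdd 51 58 1"
  let ?m = "m(51 := 0, 3 := 0, 52 := m 20)"
  let ?a = "index_value (m 21) (m 50) (seed (m 44)) * seed (m 44 + m 28)"
  have "(sem inp (CFor 52 ?c) ?m) 51 = (\<Sum>e<m 20 - 0. ?a ^ e)"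
  proof (rule sem_for_rule[where P = "\<lambda>u m'. m' 51 = (\<Sum>e<m 20 - u. ?a ^ e)"])
    fix u m' assume *: "u < ?m 52" "regs_ok m'" "m' 2 = ?m 2"
      "\<And>a. a < 100 \<Longrightarrow> a \<notin> insert 3 (insert 52 (written ?c)) \<Longrightarrow> m' a = ?m a"
      "m' 52 = u" "m' 51 = (\<Sum>e<m 20 - Suc u. ?a ^ e)"
    have u: "m 20 - u = Suc (m 20 - Suc u)" using *(1) by simp
    have m': "m' 60 = m 60" "m' 28 = m 28" "m' 44 = m 44" "m' 21 = m 21" "m' 50 = m 50" "m' 2 = m 2"
      using *(4)[of 60] *(4)[of 28] *(4)[of 44] *(4)[of 21] *(4)[of 50] *(3) by simp_all
    show "sem inp ?c m' 51 = (\<Sum>e<m 20 - u. ?a ^ e)"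
      unfolding u geometric_sum_Suc using *(2,6) m' assms(1-6) regs_okD(2,3)[OF *(2)] by (simp add: seed_def mult_ac)
  qed (use assms in auto)
  then have r: "sem inp (CFor 52 ?c) ?m 51 = power_column (m 20) (m 21) (m 50) (seed (m 44)) (seed (m 44 + m 28))"
    by (simp add: power_column_def)
  define m1 where "m1 = sem inp (CFor 52 ?c) (sem inp (CMov 52 20) (sem inp (CConst 51 0) m))"
  have m0: "sem inp (CMov 52 20) (sem inp (CConst 51 0) m) = ?m" by simp
  have m1: "regs_ok m1" "m1 28 = m 28" "m1 44 = m 44" "m1 60 = m 60" "m1 2 = m 2"
    unfolding m1_def m0 using assms(1)
    by (simp_all add: regs_ok_sem sem_frame' sem_clip del: sem.simps)
  have eq: "sem inp column_cmd m =
      sem inp (CMov 53 51 ;; CAdd 57 44 28 ;; CAdd 57 57 28 ;; mul_seed_cmd ;; CMov 56 58) m1"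
    unfolding column_cmd_def m1_def by (simp only: sem.simps(8))
  show ?thesis
    unfolding eq using m1 r[folded m0, folded m1_def] assms(2,3) by (simp add: seed_def add.assoc mult.commute)
qed

definition toggle_cmd :: cmd where
  "toggle_cmd = CSub 70 1 70"

text \<open>Strips the top bit off register 56. It toggles the parity in register 70 only if it is
  the lowest bit of its digit (\<open>74\<close> is zero) and the digit index in \<open>73\<close>
  is one of the two good residues, 0 and the field degree in \<open>28\<close>.\<close>

definition digit_cmd :: cmd where
  "digit_cmd = (CSub 71 71 1 ;; CConst 75 1 ;; shift_cmd 75 71 63 ;; CAdd 76 56 1 ;; CSub 77 76 75 ;;
     CIf 77 (CSub 56 56 75 ;;
       CIf 74 CSkip (CIf 73 (CSub 76 73 28 ;; CSub 77 28 73 ;; CAdd 76 76 77 ;; CIf 76 CSkip toggle_cmd) toggle_cmd)) CSkip)"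

lemma digit_cmd_simps [simp]:
  "written digit_cmd = {3, 56, 63, 70, 71, 75, 76, 77}"
  "output_free digit_cmd" "wf_cmd digit_cmd"
  by (auto simp: digit_cmd_def toggle_cmd_def)

lemma one_minus_mod_2: "Suc 0 - x mod 2 = Suc x mod 2"
  by presburger

lemma sem_digit_cmd:
  assumes "regs_ok m" "m 71 = Suc J" "J \<le> m 2" "m 56 = V mod 2 ^ Suc J" "m 70 = p mod 2"
  shows "sem inp digit_cmd m 71 = J" "sem inp digit_cmd m 56 = V mod 2 ^ J"
    "sem inp digit_cmd m 70 =
       (p + of_bool (odd (V div 2 ^ J) \<and> m 74 = 0 \<and> (m 73 = 0 \<or> m 73 = m 28))) mod 2"
proof -
  have lt: "Suc (V mod 2 ^ J) \<le> 2 ^ J" by (rule Suc_leI) simp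
  have m: "m 1 = 1" "m (Suc 0) = 1" using assms(1) by (rule regs_okD)+
  have "sem inp digit_cmd m 71 = J \<and> sem inp digit_cmd m 56 = V mod 2 ^ J \<and> sem inp digit_cmd m 70 =
       (p + of_bool (odd (V div 2 ^ J) \<and> m 74 = 0 \<and> (m 73 = 0 \<or> m 73 = m 28))) mod 2"
    using assms(1-3,5) assms(4)[unfolded mod_power_Suc_split] lt m
    by (cases "odd (V div 2 ^ J)") (auto simp add: digit_cmd_def toggle_cmd_def one_minus_mod_2)
  then show "sem inp digit_cmd m 71 = J" "sem inp digit_cmd m 56 = V mod 2 ^ J"
    "sem inp digit_cmd m 70 =
       (p + of_bool (odd (V div 2 ^ J) \<and> m 74 = 0 \<and> (m 73 = 0 \<or> m 73 = m 28))) mod 2"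
    by blast+
qed

definition digits1_cmd :: cmd where
  "digits1_cmd = (CMov 74 60 ;; CFor 74 digit_cmd)"

lemma digits1_cmd_simps [simp]:
  "written digits1_cmd = {3, 56, 63, 70, 71, 74, 75, 76, 77}"
  "output_free digits1_cmd" "wf_cmd digits1_cmd"
  by (auto simp: digits1_cmd_def)

lemma sem_digits1_cmd:
  assumes "regs_ok m" "m 60 > 0" "m 60 \<le> m 2" "m 71 = J + m 60" "J + m 60 \<le> m 2"
    "m 56 = V mod 2 ^ (J + m 60)" "m 70 = p mod 2"
  shows "sem inp digits1_cmd m 71 = J \<and> sem inp digits1_cmd m 56 = V mod 2 ^ J \<and>
    sem inp digits1_cmd m 70 = (p + of_bool (odd (V div 2 ^ J) \<and> (m 73 = 0 \<or> m 73 = m 28))) mod 2"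
proof -
  let ?m = "m(3 := 0, 74 := m 60)"
  let ?t = "of_bool (odd (V div 2 ^ J) \<and> (m 73 = 0 \<or> m 73 = m 28)) :: nat"
  let ?P = "\<lambda>u m'. m' 71 = J + u \<and> m' 56 = V mod 2 ^ (J + u) \<and> m' 70 = (p + (if u = 0 then ?t else 0)) mod 2"
  have "?P 0 (sem inp (CFor 74 digit_cmd) ?m)"
  proof (rule sem_for_rule[where P = ?P])
    fix u m' assume *: "u < ?m 74" "regs_ok m'" "m' 2 = ?m 2"
      "\<And>a. a < 100 \<Longrightarrow> a \<notin> insert 3 (insert 74 (written digit_cmd)) \<Longrightarrow> m' a = ?m a"
      "m' 74 = u" "?P (Suc u) m'"
    have m': "m' 73 = m 73" "m' 28 = m 28" using *(4)[of 73] *(4)[of 28] by simp_all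
    have "J + u \<le> m' 2" using *(1,3) assms by simp
    note digit = sem_digit_cmd[OF *(2) _ this, of V p inp]
    have "sem inp digit_cmd m' 71 = J + u" "sem inp digit_cmd m' 56 = V mod 2 ^ (J + u)"
      "sem inp digit_cmd m' 70 =
         (p + of_bool (odd (V div 2 ^ (J + u)) \<and> m' 74 = 0 \<and> (m' 73 = 0 \<or> m' 73 = m' 28))) mod 2"
      by (rule digit; use *(6) in simp)+
    then show "?P u (sem inp digit_cmd m')"
      using *(5) m' by (cases "u = 0") auto
  qed (use assms in auto)
  then show ?thesis
    unfolding digits1_cmd_def using assms by simp
qed

definition digits2_cmd :: cmd where
  "digits2_cmd = (CMov 73 78 ;; CFor 73 digits1_cmd)"

lemma digits2_cmd_simps [simp]:
  "written digits2_cmd = {3, 56, 63, 70, 71, 73, 74, 75, 76, 77}"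
  "output_free digits2_cmd" "wf_cmd digits2_cmd"
  by (auto simp: digits2_cmd_def)

lemma sum_split_first: "u < n \<Longrightarrow> (\<Sum>r\<in>{u..<n}. g r) = (g u + (\<Sum>r\<in>{Suc u..<n}. g r) :: nat)"
  by (rule sum.atLeast_Suc_lessThan)

lemma sem_digits2_cmd:
  assumes "regs_ok m" "m 60 > 0" "m 60 \<le> m 2" "m 78 \<le> m 2" "m 71 = J + m 78 * m 60" "J + m 78 * m 60 \<le> m 2"
    "m 56 = V mod 2 ^ (J + m 78 * m 60)" "m 70 = p mod 2"
  shows "sem inp digits2_cmd m 71 = J \<and> sem inp digits2_cmd m 56 = V mod 2 ^ J \<and>
    sem inp digits2_cmd m 70 =
      (p + (\<Sum>r\<in>{0..<m 78}. of_bool (odd (V div 2 ^ (J + r * m 60)) \<and> (r = 0 \<or> r = m 28)))) mod 2"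
proof -
  let ?m = "m(3 := 0, 73 := m 78)"
  let ?t = "\<lambda>r. of_bool (odd (V div 2 ^ (J + r * m 60)) \<and> (r = 0 \<or> r = m 28)) :: nat"
  let ?P = "\<lambda>u m'. m' 71 = J + u * m 60 \<and> m' 56 = V mod 2 ^ (J + u * m 60) \<and> m' 70 = (p + (\<Sum>r\<in>{u..<m 78}. ?t r)) mod 2"
  have "?P 0 (sem inp (CFor 73 digits1_cmd) ?m)"
  proof (rule sem_for_rule[where P = ?P])
    fix u m' assume *: "u < ?m 73" "regs_ok m'" "m' 2 = ?m 2"
      "\<And>a. a < 100 \<Longrightarrow> a \<notin> insert 3 (insert 73 (written digits1_cmd)) \<Longrightarrow> m' a = ?m a"
      "m' 73 = u" "?P (Suc u) m'"
    have m': "m' 60 = m 60" "m' 28 = m 28" using *(4)[of 60] *(4)[of 28] by simp_all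
    have "Suc u * m 60 \<le> m 78 * m 60" using *(1) by (intro mult_le_mono1) simp
    then have le: "(J + u * m 60) + m' 60 \<le> m' 2" using *(3) m' assms(6) by simp
    have step: "sem inp digits1_cmd m' 71 = J + u * m 60 \<and> sem inp digits1_cmd m' 56 = V mod 2 ^ (J + u * m 60) \<and>
      sem inp digits1_cmd m' 70 = ((p + (\<Sum>r\<in>{Suc u..<m 78}. ?t r)) +
        of_bool (odd (V div 2 ^ (J + u * m 60)) \<and> (m' 73 = 0 \<or> m' 73 = m' 28))) mod 2"
      by (rule sem_digits1_cmd[OF *(2) _ _ _ le]) (use *(3,6) m' assms in \<open>simp_all add: ac_simps\<close>)
    have "(\<Sum>r\<in>{u..<m 78}. ?t r) = ?t u + (\<Sum>r\<in>{Suc u..<m 78}. ?t r)"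
      by (rule sum_split_first) (use *(1) in simp)
    with step show "?P u (sem inp digits1_cmd m')"
      using *(5) m' by (simp only: ac_simps)
  qed (use assms in auto)
  then show ?thesis
    unfolding digits2_cmd_def using assms by simp
qed

text \<open>Three nested counters replace division: the period in \<open>72\<close>, the digit
  within the period in \<open>73\<close>, which is the exponent modulo \<open>3 ^ Suc l\<close>, and
  the bit within the digit in \<open>74\<close>.\<close>

definition digits_cmd :: cmd where
  "digits_cmd = (CConst 70 0 ;; CMov 71 79 ;; CMov 72 61 ;; CFor 72 digits2_cmd)"

lemma digits_cmd_simps [simp]:
  "written digits_cmd = {3, 56, 63, 70, 71, 72, 73, 74, 75, 76, 77}"
  "output_free digits_cmd" "wf_cmd digits_cmd"
  by (auto simp: digits_cmd_def)

lemma sem_digits_cmd: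
  assumes "regs_ok m" "m 60 > 0" "m 60 \<le> m 2" "m 78 \<le> m 2" "m 61 \<le> m 2" "m 79 = m 61 * (m 78 * m 60)" "m 79 \<le> m 2"
    "m 56 < 2 ^ m 79" and l: "m 28 = 2 * 3 ^ l" "m 78 = 3 ^ Suc l"
  shows "sem inp digits_cmd m 70 =
    (\<Sum>j<m 61 * m 78. of_bool (good_exponent l j \<and> odd (m 56 div 2 ^ (m 60 * j)))) mod 2"
proof -
  let ?m = "m(70 := 0, 3 := 0, 71 := m 79, 3 := 0, 72 := m 61)" and ?V = "m 56" and ?D = "m 78 * m 60"
  let ?t = "\<lambda>h. \<Sum>r\<in>{0..<m 78}. of_bool (odd (?V div 2 ^ (h * ?D + r * m 60)) \<and> (r = 0 \<or> r = m 28)) :: nat"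
  let ?P = "\<lambda>u m'. m' 71 = u * ?D \<and> m' 56 = ?V mod 2 ^ (u * ?D) \<and> m' 70 = (\<Sum>h\<in>{u..<m 61}. ?t h) mod 2"
  have "?P 0 (sem inp (CFor 72 digits2_cmd) ?m)"
  proof (rule sem_for_rule[where P = ?P])
    fix u m' assume *: "u < ?m 72" "regs_ok m'" "m' 2 = ?m 2"
      "\<And>a. a < 100 \<Longrightarrow> a \<notin> insert 3 (insert 72 (written digits2_cmd)) \<Longrightarrow> m' a = ?m a"
      "m' 72 = u" "?P (Suc u) m'"
    have m': "m' 60 = m 60" "m' 28 = m 28" "m' 78 = m 78" using *(4)[of 60] *(4)[of 28] *(4)[of 78] by simp_all
    have "Suc u * ?D \<le> m 61 * ?D" using *(1) by (intro mult_le_mono1) simp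
    then have le: "u * ?D + m' 78 * m' 60 \<le> m' 2" using *(3) m' assms(6,7) by simp
    have step: "sem inp digits2_cmd m' 71 = u * ?D \<and> sem inp digits2_cmd m' 56 = ?V mod 2 ^ (u * ?D) \<and>
      sem inp digits2_cmd m' 70 = ((\<Sum>h\<in>{Suc u..<m 61}. ?t h) +
        (\<Sum>r\<in>{0..<m' 78}. of_bool (odd (?V div 2 ^ (u * ?D + r * m' 60)) \<and> (r = 0 \<or> r = m' 28)))) mod 2"
      by (rule sem_digits2_cmd[OF *(2) _ _ _ _ le]) (use *(3,6) m' assms in \<open>simp_all add: ac_simps\<close>)
    have "(\<Sum>h\<in>{u..<m 61}. ?t h) = ?t u + (\<Sum>h\<in>{Suc u..<m 61}. ?t h)"
      by (rule sum_split_first) (use *(1) in simp)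
    with step show "?P u (sem inp digits2_cmd m')"
      unfolding m' by (simp only: add.commute)
  next
    show "?P (?m 72) m'" if "\<And>a. a < 100 \<Longrightarrow> a \<noteq> 3 \<Longrightarrow> m' a = ?m a" for m'
      using that[of 71] that[of 56] that[of 70] assms(6,8) by simp
  qed (use assms in auto)
  then have "sem inp digits_cmd m 70 = (\<Sum>h<m 61. ?t h) mod 2"
    unfolding digits_cmd_def using assms(1) by (simp add: lessThan_atLeast0)
  also have "(\<Sum>h<m 61. ?t h) =
      (\<Sum>h<m 61. \<Sum>j\<in>{h * m 78..<h * m 78 + m 78}. of_bool (good_exponent l j \<and> odd (m 56 div 2 ^ (m 60 * j))))"
  proof (rule sum.cong[OF refl])
    fix h
    have "(\<Sum>j\<in>{0 + h * m 78..<m 78 + h * m 78}. of_bool (good_exponent l j \<and> odd (m 56 div 2 ^ (m 60 * j)))) =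
        (\<Sum>r\<in>{0..<m 78}. of_bool (good_exponent l (r + h * m 78) \<and> odd (m 56 div 2 ^ (m 60 * (r + h * m 78)))) :: nat)"
      by (rule sum.shift_bounds_nat_ivl)
    also have "\<dots> = ?t h"
      by (rule sum.cong) (auto simp: good_exponent_def l algebra_simps)
    finally show "?t h = (\<Sum>j\<in>{h * m 78..<h * m 78 + m 78}. of_bool (good_exponent l j \<and> odd (m 56 div 2 ^ (m 60 * j))))"
      by (simp only: add_0 add.commute)
  qed
  also have "\<dots> = (\<Sum>j<m 61 * m 78. of_bool (good_exponent l j \<and> odd (m 56 div 2 ^ (m 60 * j))))"
    by (rule sum.nat_group)
  finally show ?thesis .
qed

subsection \<open>The walk of one coordinate\<close>

text \<open>The triple \<open>(g, D, \<sigma>)\<close> encodes the position \<open>(-1) ^ \<sigma> * (1 - g / D)\<close>. A step of relative size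
  \<open>2 ^ (-a)\<close> multiplies the gap \<open>g / D\<close> by \<open>1 \<mp> 2 ^ (-a)\<close>; the sign changes when the gap exceeds \<open>1\<close>.\<close>

definition gap_step :: "nat \<Rightarrow> nat \<Rightarrow> nat \<times> nat \<times> nat \<Rightarrow> nat \<times> nat \<times> nat" where
  "gap_step a c = (\<lambda>(g, D, \<sigma>).
     if c = \<sigma> then (g * 2 ^ a - g, D * 2 ^ a, \<sigma>)
     else if g * 2 ^ a + g > D * 2 ^ a then (2 * (D * 2 ^ a) - (g * 2 ^ a + g), D * 2 ^ a, 1 - \<sigma>)
     else (g * 2 ^ a + g, D * 2 ^ a, \<sigma>))"

primrec gap_walk :: "nat \<Rightarrow> (nat \<Rightarrow> nat) \<Rightarrow> nat \<Rightarrow> nat \<times> nat \<times> nat" where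
  "gap_walk a \<beta> 0 = (1, 1, 0)"
| "gap_walk a \<beta> (Suc t) = gap_step a (\<beta> t) (gap_walk a \<beta> t)"

definition update_cmd :: cmd where
  "update_cmd = (CMov 47 41 ;; shift_cmd 47 26 63 ;; shift_cmd 42 26 63 ;;
     CSub 76 70 43 ;; CSub 77 43 70 ;; CAdd 76 76 77 ;;
     CIf 76
       (CAdd 41 47 41 ;; CSub 48 41 42 ;; CIf 48 (CAdd 48 42 42 ;; CSub 41 48 41 ;; CSub 43 1 43) CSkip)
       (CSub 41 47 41))"

lemma update_cmd_simps [simp]:
  "written update_cmd = {3, 41, 42, 43, 47, 48, 63, 76, 77}"
  "output_free update_cmd" "wf_cmd update_cmd"
  by (auto simp: update_cmd_def)

lemma sem_update_cmd:
  assumes "regs_ok m" "m 26 \<le> m 2"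
  shows "(sem inp update_cmd m 41, sem inp update_cmd m 42, sem inp update_cmd m 43) =
    gap_step (m 26) (m 70) (m 41, m 42, m 43)"
proof -
  have 1: "m 1 = 1" "m (Suc 0) = Suc 0" using regs_okD[OF assms(1)] by simp_all
  show ?thesis
    using assms 1 by (auto simp: update_cmd_def gap_step_def mult_2)
qed

definition bias_value :: "nat list \<Rightarrow> nat \<Rightarrow> nat \<Rightarrow> nat \<Rightarrow> nat \<Rightarrow> nat \<Rightarrow> nat \<Rightarrow> nat" where
  "bias_value inp w d K L ofs i =
     seed_number inp w d (ofs + d + d) *
     power_column K L i (seed_number inp w d ofs) (seed_number inp w d (ofs + d))"

text \<open>The functional as the machine computes it: \<open>odd (V div 2 ^ (w * j))\<close> is the
  parity of the \<open>j\<close>-th digit of V in base \<open>2 ^ w\<close>.\<close>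

definition bias_bit :: "nat list \<Rightarrow> nat \<Rightarrow> nat \<Rightarrow> nat \<Rightarrow> nat \<Rightarrow> nat \<Rightarrow> nat \<Rightarrow> nat \<Rightarrow> nat" where
  "bias_bit inp w l K L D ofs i =
     (\<Sum>j<D. of_bool (good_exponent l j \<and> odd (bias_value inp w (2 * 3 ^ l) K L ofs i div 2 ^ (w * j)))) mod 2"

lemma geometric_sum_le: "(\<Sum>j<d. A ^ j) < A ^ d" if "A \<ge> 2" for A :: nat
proof (induction d)
  case (Suc d)
  have "A ^ d + A ^ d \<le> A * A ^ d" using that by (simp add: mult_2[symmetric])
  with Suc show ?case by simp
qed simp

lemma seed_number_less:
  assumes "w > 0"
  shows "seed_number inp w d ofs < (2 ^ w) ^ d"
proof -
  have "seed_number inp w d ofs \<le> (\<Sum>b<d. (2 ^ w) ^ b)"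
    unfolding seed_number_def by (intro sum_mono) auto
  moreover have "(2 :: nat) ^ 1 \<le> 2 ^ w" using assms by (intro power_increasing) auto
  then have "(\<Sum>b<d. (2 ^ w) ^ b) < ((2 ^ w) ^ d :: nat)"
    by (intro geometric_sum_le) simp
  ultimately show ?thesis by linarith
qed

text \<open>Seed numbers are below Q = \<open>(2 ^ w) ^ d\<close>. The hash costs \<open>L\<close>
  factors Q, the product with the second seed number \<open>L + 1\<close>, the geometric sum
  \<open>K * (L + 1)\<close>, and the third seed number one more. This fixes how many digits have to
  be inspected.\<close>

lemma bias_value_less:
  assumes w: "w > 0" and d: "d > 0" and L: "L > 0"
  shows "bias_value inp w d K L ofs i < (2 ^ w) ^ (d * (K * (L + 1) + 1))"
proof -
  let ?Q = "(2 ^ w) ^ d :: nat"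
  have "(2 :: nat) ^ 1 \<le> 2 ^ (w * d)" using w d by (intro power_increasing) auto
  then have Q: "?Q \<ge> 2" by (simp add: power_mult)
  define x y u where "x = seed_number inp w d ofs" and "y = seed_number inp w d (ofs + d)"
    and "u = seed_number inp w d (ofs + d + d)"
  have lt: "x < ?Q" "y < ?Q" "u < ?Q"
    unfolding x_def y_def u_def by (rule seed_number_less[OF w])+
  have "index_value L i x \<le> (\<Sum>j<L. ?Q ^ j)"
    unfolding index_value_def
  proof (rule sum_mono)
    fix j
    have "of_bool (odd (i div 2 ^ j)) * x ^ j \<le> 1 * ?Q ^ j"
      using lt by (intro mult_le_mono power_mono) simp_all
    then show "of_bool (odd (i div 2 ^ j)) * x ^ j \<le> ?Q ^ j" by simp
  qed
  also have "\<dots> \<le> ?Q ^ L"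
    using geometric_sum_le[OF Q] by (rule less_imp_le)
  finally have "index_value L i x * y \<le> ?Q ^ L * ?Q"
    using lt by (intro mult_le_mono) auto
  then have "power_column K L i x y \<le> (\<Sum>e<K. (?Q ^ (L + 1)) ^ e)"
    unfolding power_column_def by (intro sum_mono power_mono) (simp_all add: mult.commute)
  also have "(\<Sum>e<K. (?Q ^ (L + 1)) ^ e) \<le> (?Q ^ (L + 1)) ^ K"
  proof (rule less_imp_le, rule geometric_sum_le)
    have "?Q ^ 1 \<le> ?Q ^ (L + 1)" using Q by (intro power_increasing) auto
    with Q show "2 \<le> ?Q ^ (L + 1)" unfolding power_one_right by (rule order_trans)
  qed
  finally have "u * power_column K L i x y \<le> u * (?Q ^ (L + 1)) ^ K"
    by (rule mult_le_mono2)
  also have "\<dots> < ?Q * (?Q ^ (L + 1)) ^ K"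
    using lt Q by (intro mult_less_mono1) simp_all
  also have "\<dots> = (2 ^ w) ^ (d * (K * (L + 1) + 1))"
    by (simp add: power_mult[symmetric] power_add[symmetric] algebra_simps)
  finally show ?thesis
    by (simp add: bias_value_def x_def y_def u_def)
qed

text \<open>The seed starts at input position 4, behind the parameters; each step consumes three
  field elements, whose total length is in register 80.\<close>

definition coordinate_cmd :: cmd where
  "coordinate_cmd = (CConst 41 1 ;; CConst 42 1 ;; CConst 43 0 ;; CConst 44 4 ;; CMov 45 29 ;;
     CFor 45 (column_cmd ;; digits_cmd ;; update_cmd ;; CAdd 44 44 80))"

lemma coordinate_cmd_simps [simp]:
  "written coordinate_cmd = {3, 41, 42, 43, 44, 45, 47, 48, 51, 52, 53, 54, 55, 56, 57, 58, 62, 63, 64, 65, 66, 67, 68, 69,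
     70, 71, 72, 73, 74, 75, 76, 77}"
  "output_free coordinate_cmd" "wf_cmd coordinate_cmd"
  by (auto simp: coordinate_cmd_def)

text \<open>The register layout: 20 number of powers, 21 bits of an index, 26 exponent of the step
  size, 28 field degree, 29 number of steps, 60 digit width, 61 number of periods, 78 digits per
  period, 79 number of bits inspected, 80 seed bits per step.\<close>

definition walk_regs :: "(nat \<Rightarrow> nat) \<Rightarrow> nat \<Rightarrow> bool" where
  "walk_regs m l \<longleftrightarrow> m 28 = 2 * 3 ^ l \<and> m 78 = 3 ^ Suc l \<and> m 80 = 3 * m 28 \<and>
     m 61 = m 20 * (m 21 + 1) + 1 \<and> m 60 = m 61 * m 28 \<and> m 79 = m 61 * (m 78 * m 60) \<and>
     m 21 > 0 \<and> m 20 \<le> m 2 \<and> m 21 \<le> m 2 \<and> m 26 \<le> m 2 \<and> m 28 \<le> m 2 \<and> m 29 \<le> m 2 \<and> m 60 \<le> m 2 \<and> m 61 \<le> m 2 \<and>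
     m 78 \<le> m 2 \<and> m 79 \<le> m 2"

definition coordinate_bit :: "nat list \<Rightarrow> nat \<Rightarrow> nat \<Rightarrow> nat \<Rightarrow> nat \<Rightarrow> nat \<Rightarrow> nat \<Rightarrow> nat" where
  "coordinate_bit inp l K L a T i =
     (let H = K * (L + 1) + 1; d = 2 * 3 ^ l in
       snd (snd (gap_walk a (\<lambda>t. bias_bit inp (H * d) l K L (H * 3 ^ Suc l) (4 + 3 * d * t) i) T)))"

lemma sem_coordinate_cmd:
  assumes m: "regs_ok m" and l: "walk_regs m l" and i: "m 50 < 2 ^ m 21"
  shows "sem inp coordinate_cmd m 43 = coordinate_bit inp l (m 20) (m 21) (m 26) (m 29) (m 50)"
proof -
  let ?c = "column_cmd ;; digits_cmd ;; update_cmd ;; CAdd 44 44 80"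
  let ?m = "m(41 := 1, 42 := 1, 43 := 0, 44 := 4, 3 := 0, 45 := m 29)"
  let ?\<beta> = "\<lambda>t. bias_bit inp (m 60) l (m 20) (m 21) (m 61 * m 78) (4 + m 80 * t) (m 50)"
  let ?P = "\<lambda>u m'. (m' 41, m' 42, m' 43) = gap_walk (m 26) ?\<beta> (m 29 - u) \<and> m' 44 = 4 + m 80 * (m 29 - u)"
  have L: "m 28 = 2 * 3 ^ l" "m 78 = 3 ^ Suc l" "m 80 = 3 * m 28" "m 61 = m 20 * (m 21 + 1) + 1"
    "m 60 = m 61 * m 28" "m 79 = m 61 * (m 78 * m 60)" "m 21 > 0" "m 20 \<le> m 2" "m 21 \<le> m 2" "m 26 \<le> m 2" "m 28 \<le> m 2"
    "m 29 \<le> m 2" "m 60 \<le> m 2" "m 61 \<le> m 2" "m 78 \<le> m 2" "m 79 \<le> m 2"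
    using l unfolding walk_regs_def by blast+
  have pos: "m 28 > 0" "m 61 > 0" "m 60 > 0" using L by simp_all
  have Vlt: "bias_value inp (m 60) (m 28) (m 20) (m 21) ofs (m 50) < 2 ^ m 79" for ofs
  proof -
    have "bias_value inp (m 60) (m 28) (m 20) (m 21) ofs (m 50) < (2 ^ m 60) ^ (m 28 * m 61)"
      unfolding L(4) by (rule bias_value_less[OF pos(3,1) L(7)])
    also have "\<dots> = 2 ^ (m 61 * (m 28 * m 60))" by (simp add: power_mult[symmetric] mult_ac)
    also have "\<dots> \<le> 2 ^ m 79"
      unfolding L(6) by (intro power_increasing mult_le_mono) (simp_all add: L(1,2))
    finally show ?thesis .
  qed
  have "?P 0 (sem inp (CFor 45 ?c) ?m)"
  proof (rule sem_for_rule[where P = ?P])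
    fix u m' assume *: "u < ?m 45" "regs_ok m'" "m' 2 = ?m 2"
      "\<And>a. a < 100 \<Longrightarrow> a \<notin> insert 3 (insert 45 (written ?c)) \<Longrightarrow> m' a = ?m a"
      "m' 45 = u" "?P (Suc u) m'"
    have u: "m 29 - u = Suc (m 29 - Suc u)" using *(1) by simp
    have m': "m' 20 = m 20" "m' 21 = m 21" "m' 26 = m 26" "m' 28 = m 28" "m' 50 = m 50" "m' 60 = m 60" "m' 61 = m 61"
      "m' 78 = m 78" "m' 79 = m 79" "m' 80 = m 80" "m' 2 = m 2"
      using *(4)[of 20] *(4)[of 21] *(4)[of 26] *(4)[of 28] *(4)[of 50] *(4)[of 60] *(4)[of 61] *(4)[of 78]
        *(4)[of 79] *(4)[of 80] *(3) by simp_all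
    define m1 where "m1 = sem inp column_cmd m'"
    have m1: "regs_ok m1" "\<And>a. a < 100 \<Longrightarrow> a \<notin> written column_cmd \<Longrightarrow> m1 a = m' a" "m1 2 = m' 2"
      unfolding m1_def using *(2) by (simp_all del: column_cmd_simps(1))
    have V: "m1 56 = bias_value inp (m 60) (m 28) (m 20) (m 21) (m' 44) (m 50)"
      unfolding m1_def bias_value_def using *(2) m' L i by (subst sem_column_cmd) simp_all
    have m1': "m1 20 = m 20" "m1 21 = m 21" "m1 26 = m 26" "m1 28 = m 28" "m1 60 = m 60" "m1 61 = m 61"
      "m1 78 = m 78" "m1 79 = m 79" "m1 80 = m 80" "m1 2 = m 2" "m1 41 = m' 41" "m1 42 = m' 42" "m1 43 = m' 43" "m1 44 = m' 44"
      using m' by (simp_all add: m1)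
    define m2 where "m2 = sem inp digits_cmd m1"
    have m2: "regs_ok m2" "\<And>a. a < 100 \<Longrightarrow> a \<notin> written digits_cmd \<Longrightarrow> m2 a = m1 a" "m2 2 = m1 2"
      unfolding m2_def using m1(1) by (simp_all del: digits_cmd_simps(1))
    have "m2 70 = (\<Sum>j<m1 61 * m1 78. of_bool (good_exponent l j \<and> odd (m1 56 div 2 ^ (m1 60 * j)))) mod 2"
      unfolding m2_def by (rule sem_digits_cmd[OF m1(1)]) (use pos L Vlt in \<open>simp_all add: m1' V\<close>)
    then have bit: "m2 70 = bias_bit inp (m 60) l (m 20) (m 21) (m 61 * m 78) (m' 44) (m 50)"
      by (simp add: m1' V bias_bit_def L(1))
    have m2': "m2 26 = m 26" "m2 80 = m 80" "m2 2 = m 2" "m2 41 = m' 41" "m2 42 = m' 42" "m2 43 = m' 43" "m2 44 = m' 44"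
      by (simp_all add: m2 m1')
    define m3 where "m3 = sem inp update_cmd m2"
    have gaps: "(m3 41, m3 42, m3 43) = gap_step (m 26) (m2 70) (m' 41, m' 42, m' 43)"
      unfolding m3_def using sem_update_cmd[OF m2(1), of inp] m2' L by simp
    have m3': "m3 44 = m' 44" "m3 80 = m 80"
      unfolding m3_def using m2(1) m2' by simp_all
    have eq: "sem inp ?c m' = m3(44 := m3 44 + m3 80)"
      by (simp add: m1_def m2_def m3_def)
    show "?P u (sem inp ?c m')"
      unfolding eq u using *(6) gaps m3' bit by simp
  qed (use m L in auto)
  then have "sem inp coordinate_cmd m 43 = snd (snd (gap_walk (m 26) ?\<beta> (m 29)))"
    unfolding coordinate_cmd_def by (simp add: prod_eq_iff)
  then show ?thesis
    unfolding coordinate_bit_def Let_def using L by (simp add: mult_ac)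
qed

text \<open>Register 81 is zero for trivial errors, and register 82 if the walk would use at least
  \<open>n\<close> seed bits. The constant 4 skips the parameters in front of the seed.\<close>

definition output_cmd :: cmd where
  "output_cmd = (CMov 50 4 ;; CFor 50 (
     CIf 81
       (CIf 82 (coordinate_cmd ;; CMov 40 43) (CConst 10 4 ;; CAdd 10 10 50 ;; CRead 40 10))
       (CConst 40 0) ;;
     COut 50 40))"

lemma output_cmd_simps [simp]:
  "written output_cmd = {3, 10, 40, 50} \<union> written coordinate_cmd" "wf_cmd output_cmd"
  by (auto simp: output_cmd_def)

lemma sem_output_cmd:
  assumes m: "regs_ok m" and n: "m 4 \<le> m 2" "m 4 \<le> 2 ^ m 21" and l: "m 81 \<noteq> 0 \<Longrightarrow> m 82 \<noteq> 0 \<Longrightarrow> walk_regs m l" and i: "i < m 4"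
  shows "sem inp output_cmd m (100 + i) = (if m 81 = 0 then 0
    else if m 82 = 0 then nth_default 0 inp (4 + i)
    else coordinate_bit inp l (m 20) (m 21) (m 26) (m 29) i)"
proof -
  let ?b = "CIf 81 (CIf 82 (coordinate_cmd ;; CMov 40 43) (CConst 10 4 ;; CAdd 10 10 50 ;; CRead 40 10)) (CConst 40 0)"
  let ?m = "m(3 := 0, 50 := m 4)"
  let ?v = "\<lambda>i. if m 81 = 0 then 0 else if m 82 = 0 then nth_default 0 inp (4 + i)
    else coordinate_bit inp l (m 20) (m 21) (m 26) (m 29) i"
  let ?P = "\<lambda>u m'. \<forall>i. u \<le> i \<longrightarrow> i < m 4 \<longrightarrow> m' (100 + i) = ?v i"
  have "?P 0 (sem inp (CFor 50 (?b ;; COut 50 40)) ?m)"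
  proof (rule sem_for_rule[where P = ?P])
    fix u m' assume *: "u < ?m 50" "regs_ok m'" "m' 2 = ?m 2"
      "\<And>a. a < 100 \<Longrightarrow> a \<notin> insert 3 (insert 50 (written (?b ;; COut 50 40))) \<Longrightarrow> m' a = ?m a"
      "m' 50 = u" "?P (Suc u) m'"
    have m': "m' 4 = m 4" "m' 20 = m 20" "m' 21 = m 21" "m' 26 = m 26" "m' 28 = m 28" "m' 29 = m 29" "m' 60 = m 60" "m' 61 = m 61"
      "m' 78 = m 78" "m' 79 = m 79" "m' 80 = m 80" "m' 81 = m 81" "m' 82 = m 82" "m' 2 = m 2"
      using *(4)[of 4] *(4)[of 20] *(4)[of 21] *(4)[of 26] *(4)[of 28] *(4)[of 29] *(4)[of 60] *(4)[of 61] *(4)[of 78]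
        *(4)[of 79] *(4)[of 80] *(4)[of 81] *(4)[of 82] *(3) by simp_all
    define m1 where "m1 = sem inp ?b m'"
    have wf: "wf_cmd ?b" "output_free ?b" by simp_all
    have m1: "m1 0 = 100" "m1 50 = u" "\<And>j. m1 (100 + j) = m' (100 + j)"
      unfolding m1_def using regs_okD(1)[OF regs_ok_sem[OF wf(1) *(2), of inp]] sem_frame'[OF wf(1) *(2), of 50 inp]
        sem_output_frame[OF wf, of _ inp m'] *(5) by auto
    have v: "m1 40 = ?v u"
    proof (cases "m 81 = 0")
      case True
      then show ?thesis by (simp add: m1_def m')
    next
      case t81: False
      show ?thesis
      proof (cases "m 82 = 0")
        case True
        with t81 show ?thesis by (simp add: m1_def m' *(5))
      next
        case False
        have "walk_regs m' l" using l[OF t81 False] unfolding walk_regs_def m' .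
        moreover have "m' 50 < 2 ^ m' 21" using *(1,5) n m' by simp
        ultimately have "sem inp coordinate_cmd m' 43 = coordinate_bit inp l (m 20) (m 21) (m 26) (m 29) u"
          using sem_coordinate_cmd[OF *(2), of l inp] by (simp add: m' *(5))
        with t81 False show ?thesis by (simp add: m1_def m')
      qed
    qed
    have step: "sem inp (?b ;; COut 50 40) m' = m1(3 := 100 + u, 100 + u := m1 40)"
      by (simp only: sem.simps(7,8) m1_def[symmetric] m1)
    show "?P u (sem inp (?b ;; COut 50 40) m')"
    proof (intro allI impI)
      fix i assume i: "u \<le> i" "i < m 4"
      show "sem inp (?b ;; COut 50 40) m' (100 + i) = ?v i"
      proof (cases "i = u")
        case True
        then show ?thesis unfolding step v by simp
      next
        case False
        then have "Suc u \<le> i" using i by simp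
        with *(6) i(2) have "m' (100 + i) = ?v i" by (elim allE impE) assumption+
        then show ?thesis unfolding step using False m1(3) by simp
      qed
    qed
  qed (use m n in auto)
  then show ?thesis
    unfolding output_cmd_def using i by simp
qed

subsection \<open>Computing the parameters\<close>

lemma clog_mono: "x \<le> y \<Longrightarrow> clog x \<le> clog y"
  by (meson clog_le_iff le_clog order_trans)

lemma clog_le_self: "clog x \<le> x"
  by (simp add: clog_le_iff less_imp_le)

lemma clog_pos: "x \<ge> 2 \<Longrightarrow> clog x > 0"
  using clog_le_iff[of x 0] by simp

lemma clog_add_le: "clog (x + y) \<le> clog x + clog y + 1"
proof -
  have "x + y \<le> 2 ^ clog x + 2 ^ clog y" by (intro add_mono le_clog)
  also have "\<dots> \<le> 2 ^ (clog x + clog y) + 2 ^ (clog x + clog y)" by (intro add_mono power_increasing) auto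
  finally show ?thesis by (simp add: clog_le_iff mult_2)
qed

lemma ceil_div_le_self: "d > 0 \<Longrightarrow> ceil_div x d \<le> x"
  by (simp add: ceil_div_le_iff)

text \<open>The least \<open>a\<close> for which the Taylor errors of all steps stay below a quarter
  of the error; the divisor is \<open>\<kappa> - 2\<close> because the number of steps itself grows
  like \<open>4 ^ a\<close>.\<close>

definition walk_exponent :: "nat \<Rightarrow> nat \<Rightarrow> nat \<Rightarrow> nat \<Rightarrow> nat" where
  "walk_exponent \<kappa> \<nu> \<beta> \<eta> = ceil_div (\<kappa> * (\<beta> + 1) + \<eta> + clog (\<nu> + \<eta>) + 4) (\<kappa> - 2)"

text \<open>Chosen so that the contraction rate \<open>\<alpha>\<^sup>2 / 32\<close> times the
  length is \<open>\<nu> + \<eta>\<close>.\<close>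

definition walk_length :: "nat \<Rightarrow> nat \<Rightarrow> nat \<Rightarrow> nat \<Rightarrow> nat" where
  "walk_length \<kappa> \<nu> \<beta> \<eta> = 32 * (\<nu> + \<eta>) * 4 ^ walk_exponent \<kappa> \<nu> \<beta> \<eta>"

text \<open>Registers 4 to 7 hold \<open>n\<close>, \<open>k\<close>, the rounded \<open>b\<close>
  and the rounded \<open>8 / \<epsilon>\<close>. The minimum arises as
  \<open>(n + 1) - ((n + 1) - k)\<close> in truncated subtraction.\<close>

definition exponent_cmd :: cmd where
  "exponent_cmd = (CAdd 20 4 1 ;; CSub 13 20 5 ;; CSub 20 20 13 ;; clog_cmd 21 4 ;; clog_cmd 22 7 ;; clog_cmd 23 6 ;;
     CAdd 24 21 22 ;; clog_cmd 25 24 ;; CAdd 13 23 1 ;; mul_cmd 14 20 13 15 ;; CAdd 14 14 22 ;; CAdd 14 14 25 ;;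
     CConst 16 4 ;; CAdd 14 14 16 ;; CConst 16 2 ;; CSub 13 20 16 ;; ceil_div_cmd 26 14 13)"

lemma exponent_cmd_simps [simp]:
  "written exponent_cmd = {3, 10, 11, 12, 13, 14, 15, 16, 20, 21, 22, 23, 24, 25, 26}"
  "output_free exponent_cmd" "wf_cmd exponent_cmd"
  by (auto simp: exponent_cmd_def)

lemma sem_exponent_cmd:
  assumes m: "regs_ok m" and k: "m 5 > 2" "m 4 \<ge> 2"
    and clip: "clog (m 4) \<le> m 2" "clog (m 7) \<le> m 2" "clog (m 6) \<le> m 2" "clog (clog (m 4) + clog (m 7)) \<le> m 2" "clog (m 6) + 1 \<le> m 2"
      "walk_exponent (min (m 5) (m 4 + 1)) (clog (m 4)) (clog (m 6)) (clog (m 7)) \<le> m 2"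
  shows "sem inp exponent_cmd m 20 = min (m 5) (m 4 + 1)"
    "sem inp exponent_cmd m 21 = clog (m 4)"
    "sem inp exponent_cmd m 22 = clog (m 7)"
    "sem inp exponent_cmd m 23 = clog (m 6)"
    "sem inp exponent_cmd m 24 = clog (m 4) + clog (m 7)"
    "sem inp exponent_cmd m 25 = clog (clog (m 4) + clog (m 7))"
    "sem inp exponent_cmd m 26 = walk_exponent (min (m 5) (m 4 + 1)) (clog (m 4)) (clog (m 6)) (clog (m 7))"
proof -
  let ?c0 = "CAdd 20 4 1 ;; CSub 13 20 5 ;; CSub 20 20 13 ;; clog_cmd 21 4 ;; clog_cmd 22 7"
  let ?c1 = "clog_cmd 23 6 ;; CAdd 24 21 22 ;; clog_cmd 25 24 ;; CAdd 13 23 1"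
  let ?c2 = "mul_cmd 14 20 13 15 ;; CAdd 14 14 22 ;; CAdd 14 14 25 ;;
     CConst 16 4 ;; CAdd 14 14 16 ;; CConst 16 2 ;; CSub 13 20 16"
  define m0 where "m0 = sem inp ?c0 m"
  define m1 where "m1 = sem inp ?c1 m0"
  define m2 where "m2 = sem inp ?c2 m1"
  have eq: "sem inp exponent_cmd m = sem inp (ceil_div_cmd 26 14 13) m2"
    by (simp only: exponent_cmd_def m1_def m2_def m0_def sem.simps(8))
  have one: "m 1 = 1" "m (Suc 0) = Suc 0" using regs_okD[OF m] by simp_all
  have m0: "regs_ok m0" "m0 2 = m 2" "m0 6 = m 6" "m0 20 = min (m 5) (m 4 + 1)" "m0 21 = clog (m 4)" "m0 22 = clog (m 7)"
    unfolding m0_def using m one clip(1-2) by (simp_all add: min_def)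
  have one0: "m0 1 = 1" "m0 (Suc 0) = Suc 0" using regs_okD[OF m0(1)] by simp_all
  have m1: "regs_ok m1" "m1 2 = m 2" "m1 20 = min (m 5) (m 4 + 1)" "m1 21 = clog (m 4)" "m1 22 = clog (m 7)"
    "m1 23 = clog (m 6)" "m1 24 = clog (m 4) + clog (m 7)" "m1 25 = clog (clog (m 4) + clog (m 7))" "m1 13 = clog (m 6) + 1"
    unfolding m1_def using m0(1) one0 clip(3-5) by (simp_all add: m0(2-))
  have m2: "regs_ok m2" "m2 2 = m 2" "m2 20 = m1 20" "m2 21 = m1 21" "m2 22 = m1 22" "m2 23 = m1 23" "m2 24 = m1 24" "m2 25 = m1 25"
    "m2 14 = m1 20 * m1 13 + m1 22 + m1 25 + 4" "m2 13 = m1 20 - 2"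
    unfolding m2_def using m1(1,2) clip(5) m1(9) by simp_all
  have pos: "m2 13 > 0" using m2 m1 k by simp
  have a: "sem inp (ceil_div_cmd 26 14 13) m2 26 = ceil_div (m2 14) (m2 13)"
    by (rule sem_ceil_div_cmd) (use m2(1) pos clip(6) in \<open>simp_all add: m2 m1 walk_exponent_def\<close>)
  show "sem inp exponent_cmd m 20 = min (m 5) (m 4 + 1)" "sem inp exponent_cmd m 21 = clog (m 4)"
    "sem inp exponent_cmd m 22 = clog (m 7)" "sem inp exponent_cmd m 23 = clog (m 6)"
    "sem inp exponent_cmd m 24 = clog (m 4) + clog (m 7)"
    "sem inp exponent_cmd m 25 = clog (clog (m 4) + clog (m 7))"
    unfolding eq using m2 m1 by simp_all
  show "sem inp exponent_cmd m 26 = walk_exponent (min (m 5) (m 4 + 1)) (clog (m 4)) (clog (m 6)) (clog (m 7))"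
    unfolding eq a walk_exponent_def by (simp add: m2 m1)
qed

text \<open>The field size is the only difference between the two generators; it is described by
  \<open>\<tau> \<kappa> \<nu> \<eta> a\<close>.\<close>

definition computes_target :: "cmd \<Rightarrow> (nat \<Rightarrow> nat \<Rightarrow> nat \<Rightarrow> nat \<Rightarrow> nat) \<Rightarrow> bool" where
  "computes_target c \<tau> \<longleftrightarrow> wf_cmd c \<and> written c \<subseteq> {3, 10, 11, 12, 13, 14, 15, 16, 17} \<and>
     (\<forall>inp m. regs_ok m \<longrightarrow> m 20 \<le> m 2 \<longrightarrow> m 21 < m 2 \<longrightarrow> m 25 = clog (m 21 + m 22) \<longrightarrow>
        sem inp c m 17 = \<tau> (m 20) (m 21) (m 22) (m 26)) \<and>
     (\<forall>\<kappa> \<nu> \<eta> a. \<tau> \<kappa> \<nu> \<eta> a \<le> 8 * \<kappa> * \<nu> + 2 * \<eta> + 2 * \<nu> + 2 * a + \<kappa> + 5)"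

text \<open>Without assumptions on the Fourier mass below level \<open>k\<close>, level j is only
  bounded by n^j; a field of this degree outweighs that bound.\<close>

definition target1 :: "nat \<Rightarrow> nat \<Rightarrow> nat \<Rightarrow> nat \<Rightarrow> nat" where
  "target1 \<kappa> \<nu> \<eta> a = 8 * \<kappa> * \<nu>"

text \<open>The first two summands pay for the factor \<open>\<kappa> * (\<nu> + 1)\<close> of the
  bias, \<open>\<eta>\<close> for the error, and the rest for the number of steps, which is at most
  \<open>32 * 2 ^ clog (\<nu> + \<eta>) * 4 ^ a\<close>.\<close>

definition target2 :: "nat \<Rightarrow> nat \<Rightarrow> nat \<Rightarrow> nat \<Rightarrow> nat" where
  "target2 \<kappa> \<nu> \<eta> a = clog \<kappa> + clog (\<nu> + 1) + \<eta> + clog (\<nu> + \<eta>) + 2 * a + 4"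

lemma target1: "\<exists>c. computes_target c target1"
proof
  show "computes_target (mul_cmd 17 20 21 15 ;; CAdd 17 17 17 ;; CAdd 17 17 17 ;; CAdd 17 17 17) target1"
    by (simp add: computes_target_def target1_def)
qed

lemma target2: "\<exists>c. computes_target c target2"
proof
  have bound: "target2 \<kappa> \<nu> \<eta> a \<le> 8 * \<kappa> * \<nu> + 2 * \<eta> + 2 * \<nu> + 2 * a + \<kappa> + 5" for \<kappa> \<nu> \<eta> a
    using clog_le_self[of \<kappa>] clog_le_self[of "\<nu> + 1"] clog_le_self[of "\<nu> + \<eta>"] by (simp add: target2_def)
  have clip: "clog x \<le> y" if "x \<le> y" for x y
    using clog_le_self[of x] that by simp
  show "computes_target (clog_cmd 13 20 ;; CAdd 14 21 1 ;; clog_cmd 17 14 ;; CAdd 17 17 13 ;; CAdd 17 17 22 ;;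
      CAdd 17 17 25 ;; CAdd 17 17 26 ;; CAdd 17 17 26 ;; CConst 16 4 ;; CAdd 17 17 16) target2"
    unfolding computes_target_def using bound by (auto simp: clip regs_okD) (simp add: target2_def)
qed

definition field_degree :: "nat \<Rightarrow> nat" where
  "field_degree x = 2 * 3 ^ trinomial_exponent x"

lemma field_degree_ge: "x \<le> field_degree x"
  using trinomial_exponent_le_iff[of x "trinomial_exponent x"] by (simp add: field_degree_def)

text \<open>Admissible degrees grow by factors of three, so rounding up costs a constant factor; the
  2 covers the smallest degree.\<close>

lemma field_degree_le: "field_degree x \<le> 3 * x + 2"
proof (cases "trinomial_exponent x")
  case (Suc l)
  then have "\<not> x \<le> 2 * 3 ^ l"
    using trinomial_exponent_le_iff[of x l] by simp
  then show ?thesis by (simp add: field_degree_def Suc)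
qed (simp add: field_degree_def)

text \<open>Five doublings produce the 32 and two shifts the \<open>4 ^ a\<close>. Only the second
  factor of a product drives a loop, so the possibly huge number of steps is placed first.\<close>

definition length_cmd :: cmd where
  "length_cmd = (power3_cmd 27 17 ;; CAdd 28 27 27 ;; CAdd 78 28 27 ;; CAdd 80 28 28 ;; CAdd 80 80 28 ;;
     CMov 29 24 ;; CAdd 29 29 29 ;; CAdd 29 29 29 ;; CAdd 29 29 29 ;; CAdd 29 29 29 ;; CAdd 29 29 29 ;;
     shift_cmd 29 26 15 ;; shift_cmd 29 26 15 ;; mul_cmd 30 29 80 15 ;; CSub 82 4 30 ;;
     CAdd 13 21 1 ;; mul_cmd 61 20 13 15 ;; CAdd 61 61 1 ;; mul_cmd 60 61 28 15 ;;
     mul_cmd 13 78 60 15 ;; mul_cmd 79 61 13 15)"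

lemma length_cmd_simps [simp]:
  "written length_cmd = {3, 10, 11, 12, 13, 15, 27, 28, 29, 30, 60, 61, 78, 79, 80, 82}"
  "output_free length_cmd" "wf_cmd length_cmd"
  by (auto simp: length_cmd_def)

lemma sem_length_cmd:
  assumes m: "regs_ok m"
  defines "l \<equiv> trinomial_exponent (m 17)" and "H \<equiv> m 20 * (m 21 + 1) + 1"
  assumes clip: "l \<le> m 2" "3 ^ Suc l * 2 \<le> m 2" "m 26 \<le> m 2" "m 21 + 1 \<le> m 2"
    "3 ^ Suc l * (H * (2 * 3 ^ l)) \<le> m 2"
  shows "sem inp length_cmd m 28 = 2 * 3 ^ l" "sem inp length_cmd m 78 = 3 ^ Suc l" "sem inp length_cmd m 80 = 6 * 3 ^ l"
    "sem inp length_cmd m 29 = 32 * m 24 * 4 ^ m 26"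
    "sem inp length_cmd m 82 = m 4 - 32 * m 24 * 4 ^ m 26 * (6 * 3 ^ l)"
    "sem inp length_cmd m 61 = H" "sem inp length_cmd m 60 = H * (2 * 3 ^ l)"
    "sem inp length_cmd m 79 = H * (3 ^ Suc l * (H * (2 * 3 ^ l)))"
proof -
  let ?c1 = "power3_cmd 27 17 ;; CAdd 28 27 27 ;; CAdd 78 28 27 ;; CAdd 80 28 28 ;; CAdd 80 80 28 ;;
     CMov 29 24 ;; CAdd 29 29 29 ;; CAdd 29 29 29 ;; CAdd 29 29 29 ;; CAdd 29 29 29 ;; CAdd 29 29 29"
  let ?c2 = "shift_cmd 29 26 15 ;; shift_cmd 29 26 15 ;; mul_cmd 30 29 80 15 ;; CSub 82 4 30 ;;
     CAdd 13 21 1"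
  let ?c3 = "mul_cmd 61 20 13 15 ;; CAdd 61 61 1 ;; mul_cmd 60 61 28 15"
  let ?c4 = "mul_cmd 13 78 60 15 ;; mul_cmd 79 61 13 15"
  define m1 where "m1 = sem inp ?c1 m"
  define m2 where "m2 = sem inp ?c2 m1"
  define m3 where "m3 = sem inp ?c3 m2"
  define m4 where "m4 = sem inp ?c4 m3"
  have eq: "sem inp length_cmd m = m4"
    by (simp only: length_cmd_def m1_def m2_def m3_def m4_def sem.simps(8))
  have m1: "regs_ok m1" "m1 2 = m 2" "m1 4 = m 4" "m1 20 = m 20" "m1 21 = m 21" "m1 26 = m 26" "m1 27 = 3 ^ l" "m1 28 = 2 * 3 ^ l"
    "m1 78 = 3 ^ Suc l" "m1 80 = 6 * 3 ^ l" "m1 29 = 32 * m 24"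
    unfolding m1_def using m clip(1) by (simp_all add: l_def)
  have pow4: "(4 :: nat) ^ m 26 = 2 ^ m 26 * 2 ^ m 26"
    by (simp add: power_mult_distrib[symmetric])
  have one1: "m1 1 = 1" "m1 (Suc 0) = Suc 0" using regs_okD[OF m1(1)] by simp_all
  have m2: "regs_ok m2" "m2 2 = m 2" "m2 20 = m 20" "m2 28 = m1 28" "m2 78 = m1 78" "m2 80 = m1 80"
    "m2 29 = 32 * m 24 * 4 ^ m 26" "m2 82 = m 4 - 32 * m 24 * 4 ^ m 26 * (6 * 3 ^ l)" "m2 13 = m 21 + 1"
    unfolding m2_def using m1(1) one1 clip(2,3)
    by (simp_all add: m1(2-) pow4)
  have one2: "m2 1 = 1" "m2 (Suc 0) = Suc 0" using regs_okD[OF m2(1)] by simp_all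
  have "2 * 3 ^ l \<le> m 2" using clip(2) by simp
  then have m3: "regs_ok m3" "m3 2 = m 2" "m3 28 = m1 28" "m3 78 = m1 78" "m3 80 = m1 80" "m3 29 = m2 29" "m3 82 = m2 82"
    "m3 61 = H" "m3 60 = H * (2 * 3 ^ l)"
    unfolding m3_def using m2(1) one2 clip(4) by (simp_all add: m2(2-) m1(8) H_def)
  have c2: "m3 78 * m3 60 \<le> m3 2"
    unfolding m3 m1(9) using clip(5) .
  have "m3 60 \<le> m3 78 * m3 60"
    unfolding m3 m1(9) by simp
  then have c1: "m3 60 \<le> m3 2"
    using c2 by (rule order_trans)
  have m4: "m4 28 = m3 28" "m4 78 = m3 78" "m4 80 = m3 80" "m4 29 = m3 29" "m4 82 = m3 82"
    "m4 61 = m3 61" "m4 60 = m3 60" "m4 79 = m3 61 * (m3 78 * m3 60)"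
    unfolding m4_def using m3(1) c1 c2 by simp_all
  show "sem inp length_cmd m 28 = 2 * 3 ^ l" "sem inp length_cmd m 78 = 3 ^ Suc l" "sem inp length_cmd m 80 = 6 * 3 ^ l"
    "sem inp length_cmd m 29 = 32 * m 24 * 4 ^ m 26"
    "sem inp length_cmd m 82 = m 4 - 32 * m 24 * 4 ^ m 26 * (6 * 3 ^ l)"
    "sem inp length_cmd m 61 = H" "sem inp length_cmd m 60 = H * (2 * 3 ^ l)"
    "sem inp length_cmd m 79 = H * (3 ^ Suc l * (H * (2 * 3 ^ l)))"
    unfolding eq m4 m3 m2 m1 by (rule refl)+
qed

text \<open>Here \<open>e\<close> stands for \<open>\<lceil>8 / \<epsilon>\<rceil>\<close>. For \<open>n = 2\<close> already errors \<open>\<epsilon> \<ge> 3 / 2\<close> are trivial.\<close>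

definition nontrivial_error :: "nat \<Rightarrow> nat \<Rightarrow> bool" where
  "nontrivial_error n e \<longleftrightarrow> e > 4 \<and> (n > 2 \<or> e > 5)"

definition mode_cmd :: cmd where
  "mode_cmd = (CConst 16 4 ;; CSub 81 7 16 ;;
     CIf 81 (CConst 16 2 ;; CSub 13 4 16 ;; CIf 13 CSkip (CConst 16 5 ;; CSub 81 7 16)) CSkip)"

lemma mode_cmd_simps [simp]:
  "written mode_cmd = {13, 16, 81}" "output_free mode_cmd" "wf_cmd mode_cmd"
  by (auto simp: mode_cmd_def)

lemma sem_mode_cmd: "sem inp mode_cmd m 81 \<noteq> 0 \<longleftrightarrow> nontrivial_error (m 4) (m 7)"
  by (auto simp: mode_cmd_def nontrivial_error_def)

subsection \<open>The whole program\<close>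

definition main_cmd :: "cmd \<Rightarrow> cmd" where
  "main_cmd c = (exponent_cmd ;; c ;; length_cmd ;; mode_cmd ;; output_cmd)"

definition generator_bit ::
    "(nat \<Rightarrow> nat \<Rightarrow> nat \<Rightarrow> nat \<Rightarrow> nat) \<Rightarrow> nat \<Rightarrow> nat \<Rightarrow> nat \<Rightarrow> nat \<Rightarrow> nat list \<Rightarrow> nat \<Rightarrow> nat" where
  "generator_bit \<tau> n k B e inp i =
     (let \<kappa> = min k (n + 1); \<nu> = clog n; \<beta> = clog B; \<eta> = clog e; a = walk_exponent \<kappa> \<nu> \<beta> \<eta>;
        l = trinomial_exponent (\<tau> \<kappa> \<nu> \<eta> a); T = walk_length \<kappa> \<nu> \<beta> \<eta> in
      if \<not> nontrivial_error n e then 0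
      else if T * (6 * 3 ^ l) \<ge> n then nth_default 0 inp (4 + i)
      else coordinate_bit inp l \<kappa> \<nu> a T i)"

text \<open>\<open>W\<close> dominates \<open>n\<close> and the logarithms of the rounded real
  parameters. All loop counts are polynomial in these, except for the number of steps, which matters
  only when the walk is actually run.\<close>

lemma sem_main_cmd:
  assumes c: "computes_target c \<tau>" and m: "regs_ok m" and n: "m 4 \<ge> 2" "m 5 > 2"
    and W: "m 4 + 10 \<le> W" "clog (m 6) \<le> W" "clog (m 7) \<le> W" "W ^ 14 \<le> m 2" and i: "i < m 4"
  shows "sem inp (main_cmd c) m (100 + i) = generator_bit \<tau> (m 4) (m 5) (m 6) (m 7) inp i"
    and "sem inp (main_cmd c) m 0 = 100"
proof -
  define \<kappa> \<nu> \<beta> \<eta> where "\<kappa> = min (m 5) (m 4 + 1)" and "\<nu> = clog (m 4)" and "\<beta> = clog (m 6)" and "\<eta> = clog (m 7)"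
  define a where "a = walk_exponent \<kappa> \<nu> \<beta> \<eta>"
  define l where "l = trinomial_exponent (\<tau> \<kappa> \<nu> \<eta> a)"
  define H where "H = \<kappa> * (\<nu> + 1) + 1"
  have wf: "wf_cmd c" "written c \<subseteq> {3, 10, 11, 12, 13, 14, 15, 16, 17}"
    using c by (simp_all add: computes_target_def)
  have W10: "W \<ge> 10" using W(1) by simp
  have pow: "W ^ p \<le> m 2" if "p \<le> 14" for p
  proof -
    have "W ^ p \<le> W ^ 14" using W10 that by (intro power_increasing) auto
    with W(4) show ?thesis by linarith
  qed
  have pw: "W \<le> m 2" "W ^ 2 \<le> m 2" "W ^ 3 \<le> m 2" "W ^ 4 \<le> m 2" "W ^ 5 \<le> m 2" "W ^ 7 \<le> m 2" "W ^ 12 \<le> m 2"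
    using pow[of 1] pow[of 2] pow[of 3] pow[of 4] pow[of 5] pow[of 7] pow[of 12] by simp_all
  have base: "\<kappa> \<le> W" "\<nu> \<le> W" "\<beta> \<le> W" "\<eta> \<le> W" "\<nu> + 1 \<le> W" "\<kappa> > 2"
    using W clog_le_self[of "m 4"] n by (auto simp: \<kappa>_def \<nu>_def \<beta>_def \<eta>_def)
  have ten: "c * W ^ p \<le> W ^ Suc p" if "c \<le> 10" for c p
    using that W10 by (simp add: mult_le_mono1)
  have WW: "10 * W \<le> W ^ 2" using ten[of 10 1] by (simp add: power2_eq_square)
  have ell: "clog (\<nu> + \<eta>) \<le> 2 * W" using clog_le_self[of "\<nu> + \<eta>"] base by linarith
  have "\<kappa> * (\<beta> + 1) \<le> W * (W + 1)" using base by (intro mult_le_mono) auto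
  then have arg: "\<kappa> * (\<beta> + 1) + \<eta> + clog (\<nu> + \<eta>) + 4 \<le> 2 * W ^ 2"
  proof -
    have "W * (W + 1) = W ^ 2 + W" by (simp add: power2_eq_square)
    then show ?thesis
      using \<open>\<kappa> * (\<beta> + 1) \<le> W * (W + 1)\<close> base ell WW W10 by linarith
  qed
  have a: "a \<le> 2 * W ^ 2"
  proof -
    have "a \<le> \<kappa> * (\<beta> + 1) + \<eta> + clog (\<nu> + \<eta>) + 4"
      unfolding a_def walk_exponent_def using base by (intro ceil_div_le_self) simp
    with arg show ?thesis by linarith
  qed
  have kn: "\<kappa> * \<nu> \<le> W ^ 2" unfolding power2_eq_square using base by (intro mult_le_mono)
  have \<tau>: "\<tau> \<kappa> \<nu> \<eta> a \<le> 20 * W ^ 2"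
  proof -
    have "\<tau> \<kappa> \<nu> \<eta> a \<le> 8 * \<kappa> * \<nu> + 2 * \<eta> + 2 * \<nu> + 2 * a + \<kappa> + 5"
      using c unfolding computes_target_def by blast
    also have "8 * \<kappa> * \<nu> = 8 * (\<kappa> * \<nu>)" by simp
    also have "8 * (\<kappa> * \<nu>) + 2 * \<eta> + 2 * \<nu> + 2 * a + \<kappa> + 5 \<le> 20 * W ^ 2"
      using kn a base WW W10 by linarith
    finally show ?thesis .
  qed
  have W3: "10 * W ^ 2 \<le> W ^ 3" "10 * W ^ 3 \<le> W ^ 4" "10 * W ^ 4 \<le> W ^ 5"
    using ten[of 10 2] ten[of 10 3] ten[of 10 4] by (simp_all add: numeral_eq_Suc)
  have deg: "2 * 3 ^ l \<le> W ^ 4"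
    using field_degree_le[of "\<tau> \<kappa> \<nu> \<eta> a"] \<tau> W3 WW W10 by (simp add: l_def field_degree_def)
  have l_le: "l \<le> m 2"
  proof -
    have "l \<le> 3 ^ l" by (rule less_imp_le, rule less_le_trans[OF less_exp]) (rule power_mono, simp_all)
    also have "\<dots> \<le> 2 * 3 ^ l" by simp
    finally show ?thesis using deg pw by linarith
  qed
  have deg3: "3 ^ Suc l * 2 \<le> W ^ 5" using deg W3 by simp
  have "\<kappa> * (\<nu> + 1) \<le> W ^ 2" unfolding power2_eq_square using base by (intro mult_le_mono)
  then have H: "H \<le> W ^ 3" using W3 WW W10 unfolding H_def by linarith
  have w: "H * (2 * 3 ^ l) \<le> W ^ 7"
    using mult_le_mono[OF H deg] by (simp add: power_add[symmetric])
  have nw: "3 ^ Suc l * (H * (2 * 3 ^ l)) \<le> W ^ 12"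
  proof -
    have "3 ^ Suc l \<le> W ^ 5" using deg3 by simp
    from mult_le_mono[OF this w] show ?thesis by (simp add: power_add[symmetric])
  qed
  define m1 where "m1 = sem inp exponent_cmd m"
  have ex: "m1 20 = \<kappa>" "m1 21 = \<nu>" "m1 22 = \<eta>" "m1 23 = \<beta>" "m1 24 = \<nu> + \<eta>" "m1 25 = clog (\<nu> + \<eta>)" "m1 26 = a"
  proof -
    have clip: "clog (m 4) \<le> m 2" "clog (m 7) \<le> m 2" "clog (m 6) \<le> m 2" "clog (clog (m 4) + clog (m 7)) \<le> m 2" "clog (m 6) + 1 \<le> m 2"
      "walk_exponent (min (m 5) (m 4 + 1)) (clog (m 4)) (clog (m 6)) (clog (m 7)) \<le> m 2"
      using base ell a WW W3 W10 pw unfolding \<kappa>_def \<nu>_def \<beta>_def \<eta>_def a_def by linarith+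
    show "m1 20 = \<kappa>" "m1 21 = \<nu>" "m1 22 = \<eta>" "m1 23 = \<beta>" "m1 24 = \<nu> + \<eta>" "m1 25 = clog (\<nu> + \<eta>)" "m1 26 = a"
      unfolding m1_def \<kappa>_def \<nu>_def \<beta>_def \<eta>_def a_def by (rule sem_exponent_cmd[OF m n(2,1) clip])+
  qed
  have m1: "regs_ok m1" "m1 2 = m 2" "m1 4 = m 4" "m1 7 = m 7"
    unfolding m1_def using m by simp_all
  define m2 where "m2 = sem inp c m1"
  have frame: "m2 r = m1 r" if "r < 100" "r \<notin> {3, 10, 11, 12, 13, 14, 15, 16, 17}" for r
    unfolding m2_def using that wf m1(1) by (intro sem_frame') auto
  have m2: "regs_ok m2" "m2 2 = m 2" "m2 4 = m 4" "m2 7 = m 7" "m2 20 = \<kappa>" "m2 21 = \<nu>" "m2 24 = \<nu> + \<eta>" "m2 26 = a"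
    using frame[of 2] frame[of 4] frame[of 7] frame[of 20] frame[of 21] frame[of 24] frame[of 26] ex m1 wf
    by (simp_all add: m2_def)
  have "m2 17 = \<tau> \<kappa> \<nu> \<eta> a"
  proof -
    have "m1 20 \<le> m1 2" "m1 21 < m1 2" "m1 25 = clog (m1 21 + m1 22)"
      using base pw by (simp_all add: ex m1)
    then have "m2 17 = \<tau> (m1 20) (m1 21) (m1 22) (m1 26)"
      using c m1(1) unfolding computes_target_def m2_def by blast
    then show ?thesis by (simp add: ex)
  qed
  then have l: "trinomial_exponent (m2 17) = l" by (simp add: l_def)
  have H': "m2 20 * (m2 21 + 1) + 1 = H" by (simp add: m2 H_def)
  define m3 where "m3 = sem inp length_cmd m2"
  have len: "m3 28 = 2 * 3 ^ l" "m3 78 = 3 ^ Suc l" "m3 80 = 6 * 3 ^ l" "m3 29 = 32 * m2 24 * 4 ^ m2 26"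
    "m3 82 = m2 4 - 32 * m2 24 * 4 ^ m2 26 * (6 * 3 ^ l)" "m3 61 = H" "m3 60 = H * (2 * 3 ^ l)"
    "m3 79 = H * (3 ^ Suc l * (H * (2 * 3 ^ l)))"
  proof -
    have clip: "l \<le> m2 2" "3 ^ Suc l * 2 \<le> m2 2" "m2 26 \<le> m2 2" "m2 21 + 1 \<le> m2 2" "3 ^ Suc l * (H * (2 * 3 ^ l)) \<le> m2 2"
      unfolding m2 using l_le deg3 a base nw W3 pw by linarith+
    show "m3 28 = 2 * 3 ^ l" "m3 78 = 3 ^ Suc l" "m3 80 = 6 * 3 ^ l" "m3 29 = 32 * m2 24 * 4 ^ m2 26"
      "m3 82 = m2 4 - 32 * m2 24 * 4 ^ m2 26 * (6 * 3 ^ l)" "m3 61 = H" "m3 60 = H * (2 * 3 ^ l)"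
      "m3 79 = H * (3 ^ Suc l * (H * (2 * 3 ^ l)))"
      unfolding m3_def using sem_length_cmd[OF m2(1), of inp, unfolded l H', OF clip] by blast+
  qed
  have m3: "regs_ok m3" "m3 2 = m 2" "m3 4 = m 4" "m3 7 = m 7" "m3 20 = \<kappa>" "m3 21 = \<nu>" "m3 26 = a"
    unfolding m3_def using m2 by simp_all
  define m4 where "m4 = sem inp mode_cmd m3"
  have m4: "regs_ok m4" "m4 2 = m 2" "m4 4 = m 4" "m4 20 = \<kappa>" "m4 21 = \<nu>" "m4 26 = a"
    "m4 28 = m3 28" "m4 78 = m3 78" "m4 80 = m3 80" "m4 29 = m3 29" "m4 82 = m3 82" "m4 61 = m3 61" "m4 60 = m3 60" "m4 79 = m3 79"
    unfolding m4_def using m3 by simp_all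
  have m81: "m4 81 \<noteq> 0 \<longleftrightarrow> nontrivial_error (m 4) (m 7)"
    unfolding m4_def sem_mode_cmd m3 ..
  have T: "m4 29 = walk_length \<kappa> \<nu> \<beta> \<eta>"
    by (simp add: m4 len m2 walk_length_def a_def)
  have m82: "m4 82 = m 4 - walk_length \<kappa> \<nu> \<beta> \<eta> * (6 * 3 ^ l)"
    by (simp add: m4 len m2 walk_length_def a_def)
  have eq: "sem inp (main_cmd c) m = sem inp output_cmd m4"
    by (simp only: main_cmd_def m1_def m2_def m3_def m4_def sem.simps(8))
  \<comment> \<open>A nonzero register 82 means that the seed is shorter than \<open>m 4\<close>;
    this is what makes the number of steps respect the clip.\<close>
  have regs: "walk_regs m4 l" if "m4 82 \<noteq> 0"
  proof -
    have "walk_length \<kappa> \<nu> \<beta> \<eta> * (6 * 3 ^ l) < m 4" using that m82 by simp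
    moreover have "walk_length \<kappa> \<nu> \<beta> \<eta> * 1 \<le> walk_length \<kappa> \<nu> \<beta> \<eta> * (6 * 3 ^ l)"
      by (intro mult_le_mono2) simp
    ultimately have "m4 29 \<le> m 2" using W(1) pw(1) unfolding T by linarith
    \<comment> \<open>The number of bits inspected is the largest count that is estimated, and it
      uses the exponent 14 in full.\<close>
    moreover have "H * (3 ^ Suc l * (H * (2 * 3 ^ l))) \<le> m 2"
    proof -
      have small: "3 ^ Suc l \<le> W ^ 4 + W ^ 4" using deg by simp
      have "3 ^ Suc l * (H * (2 * 3 ^ l)) \<le> (W ^ 4 + W ^ 4) * W ^ 7" by (rule mult_le_mono[OF small w])
      also have "\<dots> = 2 * W ^ 11" by (simp add: power_add[symmetric] distrib_right)
      finally have "H * (3 ^ Suc l * (H * (2 * 3 ^ l))) \<le> H * (2 * W ^ 11)" by (rule mult_le_mono2)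
      also have "\<dots> \<le> 2 * W ^ 2 * (2 * W ^ 11)"
      proof (rule mult_le_mono1)
        show "H \<le> 2 * W ^ 2"
          using \<open>\<kappa> * (\<nu> + 1) \<le> W ^ 2\<close> WW W10 unfolding H_def by linarith
      qed
      also have "\<dots> = 4 * W ^ 13" by (simp add: power_add[symmetric])
      also have "\<dots> \<le> W ^ 14" using ten[of 4 13] by (simp add: numeral_eq_Suc)
      finally show ?thesis using W(4) by linarith
    qed
    moreover have "\<nu> > 0" using clog_pos[OF n(1)] by (simp add: \<nu>_def)
    moreover have "H * (2 * 3 ^ l) \<le> m 2" "H \<le> m 2" "3 ^ Suc l \<le> m 2" "2 * 3 ^ l \<le> m 2" "\<kappa> \<le> m 2" "\<nu> \<le> m 2" "a \<le> m 2"
      using w H deg3 deg base a W3 pw by simp_all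
    ultimately show ?thesis
      unfolding walk_regs_def m4 len H_def by simp
  qed
  have small: "m4 4 \<le> m4 2" "m4 4 \<le> 2 ^ m4 21"
    using W(1) pw le_clog[of "m 4"] by (simp_all add: m4 \<nu>_def)
  have "sem inp (main_cmd c) m (100 + i) = (if m4 81 = 0 then 0
    else if m4 82 = 0 then nth_default 0 inp (4 + i)
    else coordinate_bit inp l (m4 20) (m4 21) (m4 26) (m4 29) i)"
    unfolding eq by (rule sem_output_cmd[OF m4(1) small regs]) (simp_all add: m4 i)
  also have "\<dots> = generator_bit \<tau> (m 4) (m 5) (m 6) (m 7) inp i"
    unfolding generator_bit_def Let_def m4(4-6) T \<kappa>_def[symmetric] \<nu>_def[symmetric] \<beta>_def[symmetric] \<eta>_def[symmetric]
      a_def[symmetric] l_def[symmetric]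
    using m81 m82 by auto
  finally show "sem inp (main_cmd c) m (100 + i) = generator_bit \<tau> (m 4) (m 5) (m 6) (m 7) inp i" .
  show "sem inp (main_cmd c) m 0 = 100"
    unfolding eq using regs_okD(1)[OF regs_ok_sem[OF output_cmd_simps(2) m4(1)]] .
qed

section \<open>Setting up the clip value\<close>

primrec repeat_cmd :: "nat \<Rightarrow> cmd \<Rightarrow> cmd" where
  "repeat_cmd 0 c = CSkip"
| "repeat_cmd (Suc t) c = (c ;; repeat_cmd t c)"

text \<open>It runs while register 2 still holds the base of the power; multiplication by register 2
  itself stays within that clip. The result becomes the clip of the main program.\<close>

definition clip_cmd :: cmd where
  "clip_cmd = (CConst 8 1 ;; repeat_cmd 14 (mul_cmd 9 8 2 15 ;; CMov 8 9))"

lemma repeat_cmd_simps: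
  "written (repeat_cmd t c) \<subseteq> written c" "wf_cmd c \<Longrightarrow> wf_cmd (repeat_cmd t c)"
  by (induction t) auto

lemma clip_cmd_simps [simp]: "wf_cmd clip_cmd" "written clip_cmd \<subseteq> {3, 8, 9, 15}"
  using repeat_cmd_simps[where t = 14 and c = "mul_cmd 9 8 2 15 ;; CMov 8 9"] by (auto simp: clip_cmd_def)

lemma sem_clip_cmd:
  assumes m: "regs_ok m"
  shows "sem inp clip_cmd m 8 = m 2 ^ 14"
proof -
  let ?c = "mul_cmd 9 8 2 15 ;; CMov 8 9"
  have "sem inp (repeat_cmd t ?c) m' 8 = m' 8 * m' 2 ^ t" if "regs_ok m'" for t m'
    using that
  proof (induction t arbitrary: m')
    case (Suc t)
    have "sem inp (repeat_cmd t ?c) (sem inp ?c m') 8 = sem inp ?c m' 8 * sem inp ?c m' 2 ^ t"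
      using Suc.prems by (intro Suc.IH regs_ok_sem) simp_all
    then show ?case using Suc.prems by (simp add: mult_ac)
  qed simp
  from this[of "m(8 := 1)" 14] m show ?thesis by (simp add: clip_cmd_def)
qed

text \<open>Machine code, since \<open>wf_cmd\<close> protects the registers 0 to 2 that are set
  here, and since the logarithm in the first clip value needs a loop that is not yet
  clipped.\<close>

definition prologue :: ram where
  "prologue = Seq (Const 0 100) (Seq (Const 1 1)
     (Seq (Const 3 0) (Seq (Read 4 3) (Seq (Const 3 1) (Seq (Read 5 3) (Seq (Const 3 2) (Seq (Read 6 3) (Seq (Const 3 3) (Seq (Read 7 3)
     (Seq (Const 3 10) (Seq (Add 2 4 3) (Seq (Add 8 5 6) (Seq (Add 8 8 7) (Seq (Const 3 1) (Seq (Sub 9 8 3)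
       (While 9 (Seq (Add 3 3 3) (Seq (Add 2 2 1) (Sub 9 8 3)))))))))))))))))))"

lemma run_log_loop:
  assumes "m 1 = 1" "m 3 = 2 ^ j" "m 9 = m 8 - m 3" "j + d = clog (m 8)"
  shows "\<exists>m'. ram_run inp (While 9 (Seq (Add 3 3 3) (Seq (Add 2 2 1) (Sub 9 8 3)))) m (1 + 4 * d) m' \<and>
    m' 2 = m 2 + d \<and> (\<forall>a. a \<notin> {2, 3, 9} \<longrightarrow> m' a = m a)"
  using assms
proof (induction d arbitrary: m j)
  case 0
  then have "m 8 \<le> m 3" by (metis add_0_right le_clog)
  then have "m 9 = 0" using 0 by simp
  from ram_run.While_False[where r = 9 and m = m, OF this] show ?case by (intro exI[of _ m]) simp
next
  case (Suc d)
  let ?c = "Seq (Add 3 3 3) (Seq (Add 2 2 1) (Sub 9 8 3))"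
  let ?m1 = "m(3 := m 3 + m 3)"
  let ?m2 = "?m1(2 := ?m1 2 + ?m1 1)"
  let ?m3 = "?m2(9 := ?m2 8 - ?m2 3)"
  have "\<not> clog (m 8) \<le> j" using Suc.prems by simp
  then have "m 9 \<noteq> 0" using Suc.prems by (simp add: clog_le_iff)
  have body: "ram_run inp ?c m (1 + (1 + 1)) ?m3"
    by (rule ram_run.Seq[OF ram_run.Add ram_run.Seq[OF ram_run.Add ram_run.Sub]])
  have "?m3 1 = 1" "?m3 3 = 2 ^ Suc j" "?m3 9 = ?m3 8 - ?m3 3" "Suc j + d = clog (?m3 8)"
    using Suc.prems by simp_all
  from Suc.IH[OF this] obtain m' where m': "ram_run inp (While 9 ?c) ?m3 (1 + 4 * d) m'"
    "m' 2 = ?m3 2 + d" "\<forall>a. a \<notin> {2, 3, 9} \<longrightarrow> m' a = ?m3 a"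
    by blast
  have "ram_run inp (While 9 ?c) m (1 + (1 + (1 + 1)) + (1 + 4 * d)) m'"
    by (rule ram_run.While_True[OF \<open>m 9 \<noteq> 0\<close> body m'(1)])
  moreover have "1 + (1 + (1 + 1)) + (1 + 4 * d) = 1 + 4 * Suc d" by simp
  moreover have "m' 2 = m 2 + Suc d" "\<forall>a. a \<notin> {2, 3, 9} \<longrightarrow> m' a = m a"
    using m' Suc.prems(1) by auto
  ultimately show ?case by metis
qed

lemma run_prologue:
  "\<exists>m. ram_run ([n, k, B, e] @ bits) prologue (\<lambda>_. 0) (17 + 4 * clog (k + B + e)) m \<and> regs_ok m \<and>
    m 4 = n \<and> m 5 = k \<and> m 6 = B \<and> m 7 = e \<and> m 2 = n + 10 + clog (k + B + e)"
proof -
  let ?inp = "[n, k, B, e] @ bits"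
  let ?z = "((\<lambda>_. 0) :: nat \<Rightarrow> nat)(0 := 100, 1 := 1, 3 := 0, 4 := n, 3 := 1, 5 := k, 3 := 2, 6 := B, 3 := 3, 7 := e,
    3 := 10, 2 := n + 10, 8 := k + B, 8 := k + B + e, 3 := 1, 9 := k + B + e - 1)"
  have "\<exists>m'. ram_run ?inp (While 9 (Seq (Add 3 3 3) (Seq (Add 2 2 1) (Sub 9 8 3)))) ?z (1 + 4 * clog (k + B + e)) m' \<and>
    m' 2 = ?z 2 + clog (k + B + e) \<and> (\<forall>a. a \<notin> {2, 3, 9} \<longrightarrow> m' a = ?z a)"
    by (rule run_log_loop[where j = 0]) simp_all
  then obtain m' where m': "ram_run ?inp (While 9 (Seq (Add 3 3 3) (Seq (Add 2 2 1) (Sub 9 8 3)))) ?z (1 + 4 * clog (k + B + e)) m'"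
    "m' 2 = ?z 2 + clog (k + B + e)" "\<forall>a. a \<notin> {2, 3, 9} \<longrightarrow> m' a = ?z a"
    by blast
  have const: "ram_run ?inp (Const r x) m 1 m''" if "m'' = m(r := x)" for r x m m''
    unfolding that by (rule ram_run.Const)
  have read: "ram_run ?inp (Read r 3) m 1 m''" if "m'' = m(r := nth_default 0 ?inp (m 3))" for r m m''
    unfolding that by (rule ram_run.Read)
  have add: "ram_run ?inp (Add r p q) m 1 m''" if "m'' = m(r := m p + m q)" for r p q m m''
    unfolding that by (rule ram_run.Add)
  have sub: "ram_run ?inp (Sub r p q) m 1 m''" if "m'' = m(r := m p - m q)" for r p q m m''
    unfolding that by (rule ram_run.Sub)
  let ?s0 = "(\<lambda>_. 0) :: nat \<Rightarrow> nat"
  let ?m1 = "?s0(0 := 100)" let ?m2 = "?m1(1 := 1)" let ?m3 = "?m2(3 := 0)" let ?m4 = "?m3(4 := n)"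
  let ?m5 = "?m4(3 := 1)" let ?m6 = "?m5(5 := k)" let ?m7 = "?m6(3 := 2)" let ?m8 = "?m7(6 := B)"
  let ?m9 = "?m8(3 := 3)" let ?m10 = "?m9(7 := e)" let ?m11 = "?m10(3 := 10)" let ?m12 = "?m11(2 := n + 10)"
  let ?m13 = "?m12(8 := k + B)" let ?m14 = "?m13(8 := k + B + e)" let ?m15 = "?m14(3 := 1)"
  have "ram_run ?inp prologue ?s0 (1 + (1 + (1 + (1 + (1 + (1 + (1 + (1 + (1 + (1 + (1 + (1 + (1 + (1 + (1 + (1 + (1 + 4 * clog (k + B + e)))))))))))))))))) m'"
    unfolding prologue_def
    apply (rule ram_run.Seq[where m' = ?m1], (rule const read add sub; simp add: nth_default_def))
    apply (rule ram_run.Seq[where m' = ?m2], (rule const read add sub; simp add: nth_default_def))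
    apply (rule ram_run.Seq[where m' = ?m3], (rule const read add sub; simp add: nth_default_def))
    apply (rule ram_run.Seq[where m' = ?m4], (rule const read add sub; simp add: nth_default_def))
    apply (rule ram_run.Seq[where m' = ?m5], (rule const read add sub; simp add: nth_default_def))
    apply (rule ram_run.Seq[where m' = ?m6], (rule const read add sub; simp add: nth_default_def))
    apply (rule ram_run.Seq[where m' = ?m7], (rule const read add sub; simp add: nth_default_def))
    apply (rule ram_run.Seq[where m' = ?m8], (rule const read add sub; simp add: nth_default_def))
    apply (rule ram_run.Seq[where m' = ?m9], (rule const read add sub; simp add: nth_default_def))
    apply (rule ram_run.Seq[where m' = ?m10], (rule const read add sub; simp add: nth_default_def))
    apply (rule ram_run.Seq[where m' = ?m11], (rule const read add sub; simp add: nth_default_def))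
    apply (rule ram_run.Seq[where m' = ?m12], (rule const read add sub; simp add: nth_default_def))
    apply (rule ram_run.Seq[where m' = ?m13], (rule const read add sub; simp add: nth_default_def))
    apply (rule ram_run.Seq[where m' = ?m14], (rule const read add sub; simp add: nth_default_def))
    apply (rule ram_run.Seq[where m' = ?m15], (rule const read add sub; simp add: nth_default_def))
    apply (rule ram_run.Seq[where m' = ?z], (rule const read add sub; simp add: nth_default_def))
    apply (rule m'(1))
    done
  moreover have "regs_ok m'" "m' 4 = n" "m' 5 = k" "m' 6 = B" "m' 7 = e" "m' 2 = n + 10 + clog (k + B + e)"
    using m'(2,3) by (simp_all add: regs_ok_def)
  ultimately show ?thesis by (intro exI[of _ m'] conjI) (simp_all add: numeral_eq_Suc)
qed

definition program :: "cmd \<Rightarrow> ram" where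
  "program c = Seq prologue (Seq (compile clip_cmd) (Seq (Const 3 0) (Seq (Add 2 8 3) (compile (main_cmd c)))))"

text \<open>The linear part covers the prologue and the two instructions that install the new clip;
  the main program runs with the 14th power as clip, hence the composition.\<close>

definition time_bound :: "cmd \<Rightarrow> nat poly" where
  "time_bound c = [:19, 4:] + cost clip_cmd + pcompose (cost (main_cmd c)) (monom 1 14)"

lemma main_cmd_wf: "computes_target c \<tau> \<Longrightarrow> wf_cmd (main_cmd c)"
  by (simp add: main_cmd_def computes_target_def)

theorem run_program:
  fixes n k B e :: nat and bits :: "nat list"
  assumes c: "computes_target c \<tau>" and n: "n \<ge> 2" "k > 2"
  defines "W \<equiv> n + 10 + clog (k + B + e)"
  shows "\<exists>t m. ram_run ([n, k, B, e] @ bits) (program c) (\<lambda>_. 0) t m \<and> t \<le> poly (time_bound c) W \<and> m 0 = 100 \<and>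
    (\<forall>i<n. m (100 + i) = generator_bit \<tau> n k B e ([n, k, B, e] @ bits) i)"
proof -
  let ?inp = "[n, k, B, e] @ bits"
  obtain m1 where m1: "ram_run ?inp prologue (\<lambda>_. 0) (17 + 4 * clog (k + B + e)) m1" "regs_ok m1"
    "m1 4 = n" "m1 5 = k" "m1 6 = B" "m1 7 = e" "m1 2 = W"
    using run_prologue[of n k B e bits] unfolding W_def by blast
  define m2 where "m2 = sem ?inp clip_cmd m1"
  obtain t2 where t2: "t2 \<le> poly (cost clip_cmd) W" "ram_run ?inp (compile clip_cmd) m1 t2 m2"
    unfolding m2_def using compile_correct[OF clip_cmd_simps(1) regs_ok_ok[OF m1(2)], of ?inp] m1(7) by auto
  have m2: "regs_ok m2" "m2 8 = W ^ 14" "m2 4 = n" "m2 5 = k" "m2 6 = B" "m2 7 = e"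
    unfolding m2_def using m1 clip_cmd_simps(2) sem_clip_cmd[OF m1(2), of ?inp]
    by (simp_all add: subset_iff) (auto intro!: trans[OF sem_frame'])
  define m3 where "m3 = m2(3 := 0, 2 := W ^ 14)"
  have run3: "ram_run ?inp (Const 3 0) m2 1 (m2(3 := 0))" "ram_run ?inp (Add 2 8 3) (m2(3 := 0)) 1 m3"
    using ram_run.Const[of ?inp 3 0 m2] ram_run.Add[of ?inp 2 8 3 "m2(3 := 0)"] m2 by (simp_all add: m3_def)
  have m3: "regs_ok m3" "m3 2 = W ^ 14" "m3 4 = n" "m3 5 = k" "m3 6 = B" "m3 7 = e"
    using m2 by (simp_all add: m3_def regs_ok_def)
  have W: "n + 10 \<le> W" "clog B \<le> W" "clog e \<le> W"
    using clog_mono[of B "k + B + e"] clog_mono[of e "k + B + e"] by (simp_all add: W_def)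
  define m4 where "m4 = sem ?inp (main_cmd c) m3"
  obtain t4 where t4: "t4 \<le> poly (cost (main_cmd c)) (W ^ 14)" "ram_run ?inp (compile (main_cmd c)) m3 t4 m4"
    unfolding m4_def using compile_correct[OF main_cmd_wf[OF c] regs_ok_ok[OF m3(1)], of ?inp] m3(2) by auto
  have "m4 0 = 100"
    unfolding m4_def by (rule sem_main_cmd(2)[OF c m3(1), where W = W and i = 0]) (use W n m3 in auto)
  moreover have "m4 (100 + i) = generator_bit \<tau> n k B e ?inp i" if "i < n" for i
    unfolding m4_def using sem_main_cmd(1)[OF c m3(1), where W = W and i = i and inp = ?inp] W n m3 that by simp
  moreover have "ram_run ?inp (program c) (\<lambda>_. 0) (17 + 4 * clog (k + B + e) + (t2 + (1 + (1 + t4)))) m4"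
    unfolding program_def by (rule ram_run.Seq m1 t2 run3 t4)+
  moreover have "17 + 4 * clog (k + B + e) + (t2 + (1 + (1 + t4))) \<le> poly (time_bound c) W"
  proof -
    have "clog (k + B + e) \<le> W" by (simp add: W_def)
    then show ?thesis
      using t2(1) t4(1) by (simp add: time_bound_def poly_pcompose poly_monom)
  qed
  ultimately show ?thesis by blast
qed

subsection \<open>From natural numbers to polynomials\<close>

text \<open>Coefficients below \<open>2 ^ w\<close> evaluate without carries, so they are the digits
  in base \<open>2 ^ w\<close>.\<close>

lemma odd_digit:
  fixes P :: "nat poly"
  assumes "\<And>j. coeff P j < 2 ^ w" "w > 0"
  shows "odd (poly P (2 ^ w) div 2 ^ (w * j)) \<longleftrightarrow> odd (coeff P j)"
  using assms(1)
proof (induction P arbitrary: j)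
  case (pCons a P)
  show ?case
  proof (cases j)
    case 0
    then show ?thesis using assms(2) by simp
  next
    case (Suc j')
    have "a < 2 ^ w" using pCons.prems[of 0] by simp
    then have "(a + 2 ^ w * poly P (2 ^ w)) div 2 ^ w = poly P (2 ^ w)" by simp
    moreover have "(a + 2 ^ w * poly P (2 ^ w)) div 2 ^ (w * j) = (a + 2 ^ w * poly P (2 ^ w)) div 2 ^ w div 2 ^ (w * j')"
      by (simp only: Suc mult_Suc_right power_add div_mult2_eq)
    ultimately have "poly (pCons a P) (2 ^ w) div 2 ^ (w * j) = poly P (2 ^ w) div 2 ^ (w * j')"
      by simp
    moreover have "odd (poly P (2 ^ w) div 2 ^ (w * j')) \<longleftrightarrow> odd (coeff P j')"
      using pCons.prems[of "Suc _"] by (intro pCons.IH) simp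
    ultimately show ?thesis by (simp add: Suc)
  qed
qed simp

lemma coeff_le_poly:
  fixes P :: "nat poly"
  shows "coeff P j * q ^ j \<le> poly P q"
proof (cases "j \<le> degree P")
  case True
  then show ?thesis unfolding poly_altdef by (intro member_le_sum) auto
qed (simp add: coeff_eq_0)

definition mod2 :: "nat poly \<Rightarrow> bit poly" where
  "mod2 P = map_poly of_nat P"

lemma coeff_mod2: "coeff (mod2 P) j = of_nat (coeff P j)"
  by (simp add: mod2_def coeff_map_poly)

lemma mod2_add: "mod2 (P + Q) = mod2 P + mod2 Q"
  by (rule poly_eqI) (simp add: coeff_mod2)

lemma mod2_mult: "mod2 (P * Q) = mod2 P * mod2 Q"
  by (rule poly_eqI) (simp only: coeff_mod2 coeff_mult of_nat_sum of_nat_mult)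

lemma mod2_0 [simp]: "mod2 0 = 0" and mod2_1 [simp]: "mod2 1 = 1"
  by (simp_all add: mod2_def)

lemma mod2_power: "mod2 (P ^ k) = mod2 P ^ k"
  by (induction k) (simp_all add: mod2_mult)

lemma mod2_sum: "mod2 (\<Sum>i\<in>S. g i) = (\<Sum>i\<in>S. mod2 (g i))"
  by (induction S rule: infinite_finite_induct) (simp_all add: mod2_add)

lemma mod2_of_bool: "mod2 (of_bool b) = of_bool b"
  by simp

lemma mod2_power_column:
  "mod2 (power_column K L i x y) = power_column K L i (mod2 x) (mod2 y)"
  unfolding power_column_def index_value_def
  by (simp only: mod2_sum mod2_power mod2_mult mod2_of_bool)

lemma poly_power_column:
  "poly (power_column K L i x y) q = power_column K L i (poly x q) (poly y q)"
proof -
  have "poly (of_bool b) q = of_bool b" for b by simp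
  then show ?thesis
    unfolding power_column_def index_value_def by (simp only: poly_sum poly_power poly_mult)
qed

definition bool_poly :: "nat \<Rightarrow> (nat \<Rightarrow> bool) \<Rightarrow> 'a :: comm_semiring_1 poly" where
  "bool_poly d p = (\<Sum>b<d. monom (of_bool (p b)) b)"

lemma coeff_bool_poly: "coeff (bool_poly d p) j = of_bool (j < d \<and> p j)"
  by (simp add: bool_poly_def coeff_sum coeff_monom sum.delta)

lemma mod2_bool_poly: "mod2 (bool_poly d p) = bool_poly d p"
  by (rule poly_eqI) (simp add: coeff_mod2 coeff_bool_poly)

lemma poly_bool_poly: "poly (bool_poly d p) q = (\<Sum>b<d. of_bool (p b) * q ^ b)"
  by (simp add: bool_poly_def poly_sum poly_monom)

lemma of_nat_bit: "(of_nat x :: bit) = of_bool (odd x)"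
  by (induction x) auto

lemma power_column_le:
  fixes x y :: nat
  assumes "A \<ge> 2" "x \<le> A" "y \<le> A"
  shows "power_column K L i x y \<le> (A ^ (L + 1)) ^ K"
proof -
  have "index_value L i x \<le> (\<Sum>j<L. A ^ j)"
    unfolding index_value_def
  proof (rule sum_mono)
    fix j
    have "of_bool (odd (i div 2 ^ j)) * x ^ j \<le> 1 * A ^ j"
      using assms by (intro mult_le_mono power_mono) simp_all
    then show "of_bool (odd (i div 2 ^ j)) * x ^ j \<le> A ^ j" by simp
  qed
  also have "\<dots> \<le> A ^ L"
    using geometric_sum_le[OF assms(1)] by (rule less_imp_le)
  finally have "index_value L i x * y \<le> A ^ L * A"
    using assms by (intro mult_le_mono) auto
  then have "power_column K L i x y \<le> (\<Sum>e<K. (A ^ (L + 1)) ^ e)"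
    unfolding power_column_def by (intro sum_mono power_mono) (simp_all add: mult.commute)
  also have "\<dots> \<le> (A ^ (L + 1)) ^ K"
  proof (rule less_imp_le, rule geometric_sum_le)
    have "A ^ 1 \<le> A ^ (L + 1)" using assms by (intro power_increasing) auto
    with assms(1) show "2 \<le> A ^ (L + 1)" unfolding power_one_right by (rule order_trans)
  qed
  finally show ?thesis .
qed

lemma poly_bool_poly_1_le: "poly (bool_poly d p) 1 \<le> (d :: nat)"
proof -
  have "poly (bool_poly d p) 1 \<le> (\<Sum>b<d. 1 :: nat)"
    unfolding poly_bool_poly by (intro sum_mono) simp
  then show ?thesis by simp
qed

text \<open>The machine evaluates a polynomial with natural coefficients at
  \<open>2 ^ (H * d)\<close>. The coefficients are too small for carries, so the parities of the
  digits are the coefficients of the product over the field with two elements.\<close>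

lemma bias_bit_correct:
  fixes l K L ofs i :: nat and inp :: "nat list"
  defines "d \<equiv> 2 * 3 ^ l" and "H \<equiv> K * (L + 1) + 1"
    and "p \<equiv> \<lambda>j. nth_default 0 inp j \<noteq> 0"
  assumes L: "L > 0"
  shows "of_nat (bias_bit inp (H * d) l K L (H * 3 ^ Suc l) ofs i) =
    bit_functional l (bool_poly d (\<lambda>b. p (ofs + d + d + b)) *
      power_column K L i (bool_poly d (\<lambda>b. p (ofs + b))) (bool_poly d (\<lambda>b. p (ofs + d + b))))"
proof -
  let ?w = "H * d"
  define X Y U :: "nat poly" where "X = bool_poly d (\<lambda>b. p (ofs + b))" and "Y = bool_poly d (\<lambda>b. p (ofs + d + b))"
    and "U = bool_poly d (\<lambda>b. p (ofs + d + d + b))"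
  define P where "P = U * power_column K L i X Y"
  have d: "d \<ge> 2" by (simp add: d_def)
  have w: "?w > 0" using d by (simp add: H_def)
  have eval: "poly P (2 ^ ?w) = bias_value inp ?w d K L ofs i"
    by (simp add: P_def X_def Y_def U_def poly_power_column poly_bool_poly bias_value_def seed_number_def p_def add.assoc)
  \<comment> \<open>At 1 the value is the sum of all coefficients, which bounds each of them; every
    seed polynomial contributes at most \<open>d\<close>.\<close>
  have "poly P 1 \<le> d * (d ^ (L + 1)) ^ K"
    unfolding P_def poly_mult poly_power_column X_def Y_def U_def
    by (intro mult_le_mono power_column_le d poly_bool_poly_1_le)
  also have "\<dots> = d ^ H"
  proof -
    have "(d ^ (L + 1)) ^ K = d ^ (K * (L + 1))"
      unfolding power_mult[symmetric] by (simp only: mult.commute)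
    then show ?thesis by (simp add: H_def)
  qed
  also have "d ^ H < (2 ^ d) ^ H"
    by (rule power_strict_mono) (simp_all add: H_def)
  also have "\<dots> = 2 ^ ?w" by (simp add: power_mult[symmetric] mult.commute)
  finally have "poly P 1 < 2 ^ ?w" .
  then have coeff: "coeff P j < 2 ^ ?w" for j
    using coeff_le_poly[of P j 1] by simp
  \<comment> \<open>A nonzero coefficient of such an order would push the value beyond the size
    bound for \<open>bias_value\<close>.\<close>
  have zero: "coeff P j = 0" if "j \<ge> d * H" for j
  proof (rule ccontr)
    assume "coeff P j \<noteq> 0"
    then have "(2 ^ ?w) ^ j \<le> coeff P j * (2 ^ ?w) ^ j" by simp
    also have "\<dots> \<le> poly P (2 ^ ?w)" by (rule coeff_le_poly)
    also have "\<dots> < (2 ^ ?w) ^ (d * H)"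
      unfolding eval unfolding H_def using d w[unfolded H_def] by (intro bias_value_less L) simp_all
    also have "\<dots> \<le> (2 ^ ?w) ^ j" using that by (intro power_increasing) auto
    finally show False by simp
  qed
  have "d * H < H * 3 ^ Suc l" by (simp add: d_def H_def)
  then have deg: "degree (mod2 P) < H * 3 ^ Suc l"
    using zero by (intro le_less_trans[OF degree_le, of "d * H"]) (simp_all add: coeff_mod2 less_imp_le)
  have "of_nat (bias_bit inp ?w l K L (H * 3 ^ Suc l) ofs i) =
      (of_nat (\<Sum>j<H * 3 ^ Suc l. of_bool (good_exponent l j \<and> odd (bias_value inp ?w d K L ofs i div 2 ^ (?w * j)))) :: bit)"
    unfolding bias_bit_def d_def[symmetric] of_nat_bit by simp
  also have "\<dots> = (\<Sum>j<H * 3 ^ Suc l. of_bool (good_exponent l j) * coeff (mod2 P) j)"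
    unfolding eval[symmetric] odd_digit[OF coeff w] coeff_mod2 of_nat_sum
    by (intro sum.cong refl) (simp add: of_nat_bit)
  also have "\<dots> = bit_functional l (mod2 P)"
    by (rule bit_functional_eq[OF deg, symmetric])
  finally show ?thesis
    by (simp add: P_def X_def Y_def U_def mod2_mult mod2_power_column mod2_bool_poly)
qed

subsection \<open>The bits used in one step\<close>

definition sign_poly :: "nat \<Rightarrow> (nat \<Rightarrow> real) \<Rightarrow> bit poly" where
  "sign_poly d v = bool_poly d (\<lambda>b. v b \<noteq> 1)"

lemma bij_betw_sign_poly: "bij_betw (sign_poly d) (cube d) (bit_polys d)"
proof -
  have inj: "inj_on (sign_poly d) (cube d)"
  proof (rule inj_onI)
    fix u v assume uv: "u \<in> cube d" "v \<in> cube d" "sign_poly d u = sign_poly d v"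
    have "u b = v b" if "b < d" for b
    proof -
      have "coeff (sign_poly d u) b = coeff (sign_poly d v) b" using uv(3) by simp
      then have "u b = 1 \<longleftrightarrow> v b = 1" using that
        by (simp only: sign_poly_def coeff_bool_poly of_bool_eq_iff) simp
      then show ?thesis using cubeD[OF uv(1) that] cubeD[OF uv(2) that] by auto
    qed
    then show "u = v"
      using uv(1,2) unfolding cube_def by (intro PiE_ext) auto
  qed
  have "sign_poly d ` cube d \<subseteq> bit_polys d"
    by (auto simp: sign_poly_def coeff_bool_poly bit_polys_def)
  moreover have "card (sign_poly d ` cube d) = card (bit_polys d)"
    by (simp add: card_image[OF inj] card_cube)
  ultimately have "sign_poly d ` cube d = bit_polys d"
    by (intro card_subset_eq) simp_all
  with inj show ?thesis by (simp add: bij_betw_def)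
qed

definition step_signs :: "nat \<Rightarrow> nat \<Rightarrow> nat \<Rightarrow> nat \<Rightarrow> (nat \<Rightarrow> real) \<Rightarrow> nat \<Rightarrow> real" where
  "step_signs n l K L v = (let d = 2 * 3 ^ l in (\<lambda>i\<in>{..<n}.
     bias_sign l K L (sign_poly d v) (sign_poly d (\<lambda>b. v (d + b))) (sign_poly d (\<lambda>b. v (d + d + b))) i))"

lemma step_signs_cube: "step_signs n l K L v \<in> cube n"
  by (auto simp: step_signs_def Let_def cube_def bias_sign_def bit_sign_def)

lemma sign_poly_cong: "(\<And>b. b < d \<Longrightarrow> u b = v b) \<Longrightarrow> sign_poly d u = sign_poly d v"
  unfolding sign_poly_def bool_poly_def by (intro sum.cong) auto

text \<open>The seed of a step splits into the three field elements of \<open>small_bias\<close>,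
  whose bound is rewritten relative to the number of seeds.\<close>

lemma step_signs_bias:
  assumes n: "n \<le> 2 ^ L" and S: "S \<subseteq> {..<n}" "S \<noteq> {}" "card S \<le> K"
  shows "\<bar>\<Sum>v\<in>cube (3 * (2 * 3 ^ l)). monomial S (step_signs n l K L v)\<bar>
    \<le> real (K * (L + 1)) / 2 ^ (2 * 3 ^ l) * 2 ^ (3 * (2 * 3 ^ l))"
proof -
  let ?d = "2 * 3 ^ l :: nat"
  let ?R = "bit_polys ?d"
  let ?g = "\<lambda>x y u. \<Prod>i\<in>S. bias_sign l K L x y u i"
  have mono: "monomial S (step_signs n l K L v) =
      ?g (sign_poly ?d v) (sign_poly ?d (\<lambda>b. v (?d + b))) (sign_poly ?d (\<lambda>b. v (?d + ?d + b)))" for v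
    unfolding monomial_def step_signs_def Let_def using S(1) by (intro prod.cong) auto
  have "3 * ?d = ?d + (?d + ?d)" by simp
  then have "(\<Sum>v\<in>cube (3 * ?d). monomial S (step_signs n l K L v)) =
      (\<Sum>x\<in>cube ?d. \<Sum>y\<in>cube ?d. \<Sum>u\<in>cube ?d. monomial S (step_signs n l K L (join ?d (?d + ?d) x (join ?d ?d y u))))"
    by (simp only: sum_cube_join)
  also have "\<dots> = (\<Sum>x\<in>cube ?d. \<Sum>y\<in>cube ?d. \<Sum>u\<in>cube ?d. ?g (sign_poly ?d x) (sign_poly ?d y) (sign_poly ?d u))"
  proof (intro sum.cong refl)
    fix x y u
    have "sign_poly ?d (join ?d (?d + ?d) x (join ?d ?d y u)) = sign_poly ?d x"
      "sign_poly ?d (\<lambda>b. join ?d (?d + ?d) x (join ?d ?d y u) (?d + b)) = sign_poly ?d y"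
      "sign_poly ?d (\<lambda>b. join ?d (?d + ?d) x (join ?d ?d y u) (?d + ?d + b)) = sign_poly ?d u"
      by (rule sign_poly_cong; simp add: join_def)+
    then show "monomial S (step_signs n l K L (join ?d (?d + ?d) x (join ?d ?d y u))) =
        ?g (sign_poly ?d x) (sign_poly ?d y) (sign_poly ?d u)"
      by (simp only: mono)
  qed
  also have "\<dots> = (\<Sum>x\<in>?R. \<Sum>y\<in>?R. \<Sum>u\<in>?R. ?g x y u)"
    by (simp only: sum.reindex_bij_betw[OF bij_betw_sign_poly, of "\<lambda>u. ?g _ _ u"]
        sum.reindex_bij_betw[OF bij_betw_sign_poly, of "\<lambda>y. \<Sum>u\<in>?R. ?g _ y u"]
        sum.reindex_bij_betw[OF bij_betw_sign_poly, of "\<lambda>x. \<Sum>y\<in>?R. \<Sum>u\<in>?R. ?g x y u"])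
  finally have eq: "(\<Sum>v\<in>cube (3 * ?d). monomial S (step_signs n l K L v)) = (\<Sum>x\<in>?R. \<Sum>y\<in>?R. \<Sum>u\<in>?R. ?g x y u)" .
  have "S \<subseteq> {..<2 ^ L}" using S(1) n by auto
  then have "\<bar>\<Sum>x\<in>?R. \<Sum>y\<in>?R. \<Sum>u\<in>?R. ?g x y u\<bar> \<le> real (K * (L + 1)) * (2 ^ ?d) ^ 2"
    using small_bias[of S L K l] S by simp
  also have "\<dots> = real (K * (L + 1)) / 2 ^ ?d * 2 ^ (3 * ?d)"
  proof -
    have "(2 :: real) ^ (3 * ?d) = 2 ^ ?d * (2 ^ ?d) ^ 2"
      by (simp add: power_mult[symmetric] power_add[symmetric] mult.commute)
    then show ?thesis by simp
  qed
  finally show ?thesis unfolding eq .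
qed

subsection \<open>The integer walk\<close>

definition sign_of :: "nat \<Rightarrow> real" where
  "sign_of c = (if c = 0 then 1 else -1)"

text \<open>Gaps are dyadic fractions, so the integers follow the real walk exactly and no rounding
  inside the machine has to be analysed.\<close>

lemma gap_walk_position:
  assumes "\<And>t. t < T \<Longrightarrow> \<beta> t \<le> 1" "\<And>t. t < T \<Longrightarrow> \<xi> t i = sign_of (\<beta> t)" "gap_walk a \<beta> T = (g, D, c)"
  shows "g \<le> D \<and> D > 0 \<and> c \<le> 1 \<and> walk (1 / 2 ^ a) \<xi> T i = sign_of c * (1 - real g / real D)"
  using assms
proof (induction T arbitrary: g D c)
  case 0
  then show ?case by (simp add: sign_of_def)
next
  case (Suc T)
  obtain g' D' c' where prev: "gap_walk a \<beta> T = (g', D', c')" by (cases "gap_walk a \<beta> T")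
  have IH: "g' \<le> D'" "D' > 0" "c' \<le> 1" "walk (1 / 2 ^ a) \<xi> T i = sign_of c' * (1 - real g' / real D')"
    using Suc.IH[OF _ _ prev] Suc.prems(1,2) by auto
  define A where "A = (2 :: nat) ^ a"
  have A: "A \<ge> 1" by (simp add: A_def)
  have step: "(g, D, c) = gap_step a (\<beta> T) (g', D', c')" using Suc.prems(3) prev by simp
  have D: "D = D' * A" using step by (auto simp: gap_step_def A_def split: if_splits)
  have le1: "g' \<le> g' * A" "D' \<le> D' * A" using A by simp_all
  have le2: "g' * A \<le> D' * A" using IH by simp
  have \<beta>: "\<beta> T \<le> 1" "\<xi> T i = sign_of (\<beta> T)" using Suc.prems by auto
  have abs: "\<bar>walk (1 / 2 ^ a) \<xi> T i\<bar> = 1 - real g' / real D'"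
    unfolding IH(4) abs_mult using IH by (simp add: sign_of_def)
  have X: "walk (1 / 2 ^ a) \<xi> (Suc T) i = sign_of c' * (1 - real g' / real D') + real g' / real D' * (1 / real A * sign_of (\<beta> T))"
    unfolding walk.simps walk_step_def abs unfolding IH(4) \<beta>(2) by (simp add: A_def)
  have Apos: "real A > 0" "real D' > 0" using A IH by simp_all
  consider (same) "\<beta> T = c'" | (flip) "\<beta> T \<noteq> c'" "g' * A + g' > D' * A" | (keep) "\<beta> T \<noteq> c'" "g' * A + g' \<le> D' * A"
    by linarith
  then show ?case
  proof cases
    case same
    then have gc: "g = g' * A - g'" "c = c'" using step by (auto simp: gap_step_def A_def)
    have "real g = real g' * real A - real g'" using gc le1 by (simp add: of_nat_diff)
    then have "walk (1 / 2 ^ a) \<xi> (Suc T) i = sign_of c * (1 - real g / real D)"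
      unfolding X same gc(2) D using Apos by (simp add: divide_simps) (simp add: algebra_simps)
    then show ?thesis using gc D le1 le2 IH A by (auto intro: order_trans[OF diff_le_self])
  next
    case flip
    then have gc: "g = 2 * (D' * A) - (g' * A + g')" "c = 1 - c'" using step by (auto simp: gap_step_def A_def)
    have "g' * A + g' \<le> 2 * (D' * A)" using le1 le2 IH(1) by linarith
    then have gr: "real g = 2 * (real D' * real A) - (real g' * real A + real g')" using gc by (simp add: of_nat_diff)
    have sg: "sign_of (\<beta> T) = - sign_of c'" "sign_of c = - sign_of c'"
      using flip(1) \<beta>(1) IH(3) gc(2) by (auto simp: sign_of_def)
    have "walk (1 / 2 ^ a) \<xi> (Suc T) i = sign_of c * (1 - real g / real D)"
      unfolding X D gr sg of_nat_mult using Apos by (simp add: divide_simps) (simp add: algebra_simps)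
    then show ?thesis using gc D flip IH A by simp
  next
    case keep
    then have gc: "g = g' * A + g'" "c = c'" using step by (auto simp: gap_step_def A_def)
    moreover have "sign_of (\<beta> T) = - sign_of c'"
      using keep(1) \<beta>(1) IH(3) by (auto simp: sign_of_def)
    ultimately have "walk (1 / 2 ^ a) \<xi> (Suc T) i = sign_of c * (1 - real g / real D)"
      unfolding X D using Apos by (simp add: field_simps)
    then show ?thesis using gc D keep IH A by simp
  qed
qed

definition input_bits :: "nat \<Rightarrow> (nat \<Rightarrow> real) \<Rightarrow> nat list" where
  "input_bits s y = map (\<lambda>i. if y i = 1 then 0 else 1) [0..<s]"

lemma nth_default_input:
  assumes "j < s"
  shows "nth_default 0 ([n, k, B, e] @ input_bits s y) (4 + j) = (if y j = 1 then 0 else 1)"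
  using assms by (simp add: nth_default_def input_bits_def nth_append)

lemma bias_bit_le_1: "bias_bit inp w l K L D ofs i \<le> 1"
  unfolding bias_bit_def by (rule less_Suc_eq_le[THEN iffD1]) simp

lemma bias_bit_sign:
  fixes l K L T t i n :: nat
  defines "d \<equiv> 2 * 3 ^ l" and "H \<equiv> K * (L + 1) + 1"
  assumes L: "L > 0" and t: "t < T" and i: "i < n" and inp: "inp = [n', k, B, e] @ input_bits (3 * d * T) y"
  shows "sign_of (bias_bit inp (H * d) l K L (H * 3 ^ Suc l) (4 + 3 * d * t) i) =
    step_signs n l K L (block (3 * d) t y) i"
proof -
  let ?bb = "bias_bit inp (H * d) l K L (H * 3 ^ Suc l) (4 + 3 * d * t) i"
  let ?p = "\<lambda>j. nth_default 0 inp j \<noteq> 0"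
  have p: "?p (4 + 3 * d * t + j) \<longleftrightarrow> block (3 * d) t y j \<noteq> 1" if "j < 3 * d" for j
  proof -
    have "3 * d * t + j < 3 * d * Suc t" using that by simp
    also have "\<dots> \<le> 3 * d * T" using t by (intro mult_le_mono2) simp
    finally have "3 * d * t + j < 3 * d * T" .
    from nth_default_input[OF this] show ?thesis
      using that by (simp add: inp block_def add.assoc)
  qed
  have sp: "bool_poly d (\<lambda>b. ?p (4 + 3 * d * t + r + b)) = sign_poly d (\<lambda>b. block (3 * d) t y (r + b))" if "r + d \<le> 3 * d" for r
    unfolding sign_poly_def bool_poly_def using that p by (intro sum.cong refl) (simp add: add.assoc)
  have "(of_nat ?bb :: bit) = bit_functional l (bool_poly d (\<lambda>b. ?p (4 + 3 * d * t + d + d + b)) *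
      power_column K L i (bool_poly d (\<lambda>b. ?p (4 + 3 * d * t + b))) (bool_poly d (\<lambda>b. ?p (4 + 3 * d * t + d + b))))"
    unfolding d_def H_def by (rule bias_bit_correct[OF L])
  also have "\<dots> = bit_functional l (sign_poly d (\<lambda>b. block (3 * d) t y (d + d + b)) *
      power_column K L i (sign_poly d (block (3 * d) t y)) (sign_poly d (\<lambda>b. block (3 * d) t y (d + b))))"
    using sp[of "d + d"] sp[of d] sp[of 0] by (simp add: add.assoc)
  finally have "step_signs n l K L (block (3 * d) t y) i = bit_sign (of_nat ?bb)"
    using i by (simp add: step_signs_def Let_def bias_sign_def d_def[symmetric])
  also have "\<dots> = sign_of ?bb"
    using bias_bit_le_1[of inp "H * d" l K L "H * 3 ^ Suc l" "4 + 3 * d * t" i]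
    by (cases "?bb = 0") (auto simp: bit_sign_def sign_of_def of_nat_bit)
  finally show ?thesis ..
qed

text \<open>The integer walk carries the sign of the real one; a gap equal to 1 means position zero,
  where either sign is right.\<close>

lemma coordinate_bit_sign:
  fixes l K L T i n a :: nat
  defines "d \<equiv> 2 * 3 ^ l"
  assumes L: "L > 0" and i: "i < n" and inp: "inp = [n', k, B, e] @ input_bits (3 * d * T) y"
  defines "X \<equiv> walk (1 / 2 ^ a) (\<lambda>t. step_signs n l K L (block (3 * d) t y)) T i"
  shows "X = \<bar>X\<bar> * sign_of (coordinate_bit inp l K L a T i)"
proof -
  define H where "H = K * (L + 1) + 1"
  let ?\<beta> = "\<lambda>t. bias_bit inp (H * d) l K L (H * 3 ^ Suc l) (4 + 3 * d * t) i"
  obtain g D c where gw: "gap_walk a ?\<beta> T = (g, D, c)" by (cases "gap_walk a ?\<beta> T")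
  have "g \<le> D \<and> D > 0 \<and> c \<le> 1 \<and> X = sign_of c * (1 - real g / real D)"
    unfolding X_def
  proof (rule gap_walk_position[OF _ _ gw])
    show "?\<beta> t \<le> 1" for t by (rule bias_bit_le_1)
    show "step_signs n l K L (block (3 * d) t y) i = sign_of (?\<beta> t)" if "t < T" for t
      unfolding d_def H_def by (rule bias_bit_sign[OF L that i inp[unfolded d_def], symmetric])
  qed
  moreover have "coordinate_bit inp l K L a T i = c"
    using gw unfolding coordinate_bit_def Let_def H_def d_def by simp
  ultimately show ?thesis
    by (auto simp: sign_of_def abs_mult)
qed

subsection \<open>Correctness of the generator\<close>

definition generator ::
    "(nat \<Rightarrow> nat \<Rightarrow> nat \<Rightarrow> nat \<Rightarrow> nat) \<Rightarrow> nat \<Rightarrow> nat \<Rightarrow> real \<Rightarrow> real \<Rightarrow> nat \<Rightarrow> (nat \<Rightarrow> real) \<Rightarrow> nat \<Rightarrow> real" where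
  "generator \<tau> n k b \<epsilon> s y = (\<lambda>i\<in>{..<n}.
     sign_of (generator_bit \<tau> n k (nat \<lceil>b\<rceil>) (nat \<lceil>8 / \<epsilon>\<rceil>) (ram_input n k b \<epsilon> s y) i))"

lemma sign_of_cases: "sign_of c = 1 \<or> sign_of c = -1"
  by (simp add: sign_of_def)

lemma generator_cube: "generator \<tau> n k b \<epsilon> s y \<in> cube n"
  by (rule cubeI) (simp_all add: generator_def sign_of_cases)

lemma le_power_floorlog: "x \<le> 2 ^ floorlog 2 x"
  using floorlog_bounds[of x 2] by (cases "x = 0") auto

lemma clog_sum_le: "clog (x + y + z) \<le> floorlog 2 x + floorlog 2 y + floorlog 2 z + 2"
proof -
  have "clog u \<le> floorlog 2 u" for u
    by (simp add: clog_le_iff le_power_floorlog)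
  from this[of x] this[of y] this[of z] show ?thesis
    using clog_add_le[of "x + y" z] clog_add_le[of x y] by linarith
qed

lemma explicit_generator_program:
  assumes c: "computes_target c \<tau>" and n: "n \<ge> 2" "k > 2"
  shows "explicit_generator (program c) (pcompose (time_bound c) [:12, 1:]) n k b \<epsilon> s (generator \<tau> n k b \<epsilon> s)"
  unfolding explicit_generator_def
proof (intro conjI ballI)
  show "generator \<tau> n k b \<epsilon> s \<in> cube s \<rightarrow> cube n"
    by (simp add: generator_cube)
  fix y
  let ?B = "nat \<lceil>b\<rceil>" and ?e = "nat \<lceil>8 / \<epsilon>\<rceil>"
  have inp: "ram_input n k b \<epsilon> s y = [n, k, ?B, ?e] @ input_bits s y"
    by (simp add: ram_input_def input_bits_def)
  obtain t m where run: "ram_run (ram_input n k b \<epsilon> s y) (program c) (\<lambda>_. 0) t m"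
    "t \<le> poly (time_bound c) (n + 10 + clog (k + ?B + ?e))" "m 0 = 100"
    "\<And>i. i < n \<Longrightarrow> m (100 + i) = generator_bit \<tau> n k ?B ?e (ram_input n k b \<epsilon> s y) i"
    using run_program[OF c n, of ?B ?e "input_bits s y"] unfolding inp by blast
  have "n + 10 + clog (k + ?B + ?e) \<le> 12 + (n + s + floorlog 2 k + floorlog 2 ?B + floorlog 2 ?e)"
    using clog_sum_le[of k ?B ?e] by simp
  then have "t \<le> poly (time_bound c) (12 + (n + s + floorlog 2 k + floorlog 2 ?B + floorlog 2 ?e))"
    by (rule order_trans[OF run(2) poly_nat_mono])
  then have "t \<le> poly (pcompose (time_bound c) [:12, 1:]) (n + s + floorlog 2 k + floorlog 2 ?B + floorlog 2 ?e)"
    by (simp add: poly_pcompose)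
  moreover have "generator \<tau> n k b \<epsilon> s y i = (if m (m 0 + i) = 0 then 1 else -1)" if "i < n" for i
    using run(3,4) that by (simp add: generator_def sign_of_def)
  ultimately show "\<exists>t m. ram_run (ram_input n k b \<epsilon> s y) (program c) (\<lambda>_. 0) t m \<and>
      t \<le> poly (pcompose (time_bound c) [:12, 1:]) (n + s + floorlog 2 k + floorlog 2 ?B + floorlog 2 ?e) \<and>
      (\<forall>i<n. generator \<tau> n k b \<epsilon> s y i = (if m (m 0 + i) = 0 then 1 else -1))"
    using run(1) by blast
qed

section \<open>Constant and copying generators\<close>

lemma boolean_function_abs: "f \<in> boolean_functions n \<Longrightarrow> x \<in> cube n \<Longrightarrow> \<bar>f x\<bar> = 1"
  by (fastforce simp: boolean_functions_def PiE_iff)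

text \<open>The summand of \<open>x\<close> itself is zero and the others are at most 2, which
  improves slightly on the obvious bound 2; for \<open>n = 2\<close> it becomes
  \<open>3 / 2\<close>.\<close>

lemma trivial_error_bound:
  assumes f: "f \<in> boolean_functions n" and x: "x \<in> cube n"
  shows "\<bar>f x - fourier n f {}\<bar> \<le> 2 - 2 / 2 ^ n"
proof -
  have "fourier n f {} = (\<Sum>z\<in>cube n. f z) / 2 ^ n"
    by (simp add: fourier_def monomial_def)
  then have "f x - fourier n f {} = (\<Sum>z\<in>cube n. f x - f z) / 2 ^ n"
    by (simp add: sum_subtractf card_cube diff_divide_distrib)
  also have "(\<Sum>z\<in>cube n. f x - f z) = (\<Sum>z\<in>cube n - {x}. f x - f z)"
    using x by (subst sum.remove[OF _ x]) simp_all
  finally have eq: "f x - fourier n f {} = (\<Sum>z\<in>cube n - {x}. f x - f z) / 2 ^ n" .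
  have "\<bar>\<Sum>z\<in>cube n - {x}. f x - f z\<bar> \<le> (\<Sum>z\<in>cube n - {x}. \<bar>f x - f z\<bar>)"
    by (rule sum_abs)
  also have "\<dots> \<le> (\<Sum>z\<in>cube n - {x}. 2)"
  proof (rule sum_mono)
    fix z assume "z \<in> cube n - {x}"
    then show "\<bar>f x - f z\<bar> \<le> 2"
      using boolean_function_abs[OF f x] boolean_function_abs[OF f, of z] by (simp add: abs_if split: if_splits)
  qed
  also have "\<dots> = 2 * (2 ^ n - 1)"
    using x by (simp add: card_Diff_singleton card_cube of_nat_diff)
  finally show ?thesis
    unfolding eq by (simp add: field_simps)
qed

lemma is_prg_trivial:
  assumes F: "F \<subseteq> boolean_functions n" and n: "n \<ge> 2" and \<epsilon>: "\<epsilon> > 0" and tr: "\<not> nontrivial_error n (nat \<lceil>8 / \<epsilon>\<rceil>)"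
    and G: "\<And>y. G y \<in> cube n"
  shows "is_prg n F \<epsilon> (map_pmf G (pmf_of_set (cube 0)))"
proof (rule is_prg_cubeI)
  fix f assume f: "f \<in> F"
  have c0: "cube 0 = {\<lambda>_. undefined}" by (simp add: cube_def)
  have "\<bar>f (G (\<lambda>_. undefined)) - fourier n f {}\<bar> \<le> 2 - 2 / 2 ^ n"
    using trivial_error_bound[of f n] f F G by blast
  also have "\<dots> \<le> \<epsilon>"
  proof (cases "nat \<lceil>8 / \<epsilon>\<rceil> > 4")
    case False
    then have "8 / \<epsilon> \<le> 4" by linarith
    then have "\<epsilon> \<ge> 2" using \<epsilon> by (simp add: field_simps)
    moreover have "2 / 2 ^ n \<ge> (0 :: real)" by simp
    ultimately show ?thesis by linarith
  next
    case True
    then have n2: "n = 2" and "\<not> nat \<lceil>8 / \<epsilon>\<rceil> > 5" using tr n unfolding nontrivial_error_def by linarith+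
    then have "real (nat \<lceil>8 / \<epsilon>\<rceil>) \<le> 5" by linarith
    then have "8 / \<epsilon> \<le> 5" by linarith
    \<comment> \<open>\<open>8 / 5\<close> is the least error with rounded value 5, and it exceeds
      the error \<open>3 / 2\<close> of constants for \<open>n = 2\<close>.\<close>
    then have "\<epsilon> \<ge> 8 / 5" using \<epsilon> by (simp add: field_simps)
    then show ?thesis using n2 by simp
  qed
  finally show "\<bar>(\<Sum>y\<in>cube 0. f (G y)) - 2 ^ 0 * fourier n f {}\<bar> \<le> 2 ^ 0 * \<epsilon>"
    by (simp add: c0)
qed (rule G)

lemma is_prg_identity:
  assumes "\<epsilon> > 0" and G: "\<And>y. y \<in> cube n \<Longrightarrow> G y = y"
  shows "is_prg n F \<epsilon> (map_pmf G (pmf_of_set (cube n)))"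
proof (rule is_prg_cubeI)
  fix f :: "(nat \<Rightarrow> real) \<Rightarrow> real"
  have "(\<Sum>y\<in>cube n. f (G y)) = (\<Sum>y\<in>cube n. f y)" by (simp add: G)
  then show "\<bar>(\<Sum>y\<in>cube n. f (G y)) - 2 ^ n * fourier n f {}\<bar> \<le> 2 ^ n * \<epsilon>"
    using assms(1) by (simp add: fourier_def monomial_def)
qed (simp add: G)

text \<open>For \<open>k > n + 1\<close> the level \<open>n + 1\<close> is empty. The cap allows
  loops up to \<open>min k (n + 1)\<close>, whereas time may depend on \<open>k\<close> only through
  its bit length.\<close>

lemma abs_level_part_le:
  assumes F: "F \<subseteq> boolean_functions n" and h: "h \<in> F" and x: "x \<in> cube n" and M: "M_class n k F \<le> b ^ k" and "b \<ge> 1"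
  shows "\<bar>level_part n h (min k (n + 1)) x\<bar> \<le> b ^ min k (n + 1)"
proof (cases "k \<le> n + 1")
  case True
  have "finite F" by (rule finite_subset[OF F]) simp
  have "\<bar>level_part n h k x\<bar> \<le> M n k h"
    unfolding M_def level_part_def using x by (intro Max_ge) auto
  also have "\<dots> \<le> M_class n k F"
    unfolding M_class_def using h \<open>finite F\<close> by (intro Max_ge) auto
  finally show ?thesis using M True by (simp add: min_def)
next
  case False
  then show ?thesis using \<open>b \<ge> 1\<close> by (simp add: min_def level_part_gt)
qed

lemma real_le_power_clog: "real x \<le> 2 ^ clog x"
  using le_clog[of x] by (metis of_nat_le_iff of_nat_numeral of_nat_power)

context
  fixes n k :: nat and F :: "((nat \<Rightarrow> real) \<Rightarrow> real) set" and b \<epsilon> :: real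
    and \<kappa> \<nu> \<beta> \<eta> a T :: nat
  assumes n: "n \<ge> 2" "k > 2" and F: "F \<subseteq> boolean_functions n" and closed: "closed_under_restrictions n F"
    and b: "b \<ge> 1" and M: "M_class n k F \<le> b ^ k" and \<epsilon>: "\<epsilon> > 0"
    and defs: "\<kappa> = min k (n + 1)" "\<nu> = clog n" "\<beta> = clog (nat \<lceil>b\<rceil>)" "\<eta> = clog (nat \<lceil>8 / \<epsilon>\<rceil>)"
      "a = walk_exponent \<kappa> \<nu> \<beta> \<eta>" "T = walk_length \<kappa> \<nu> \<beta> \<eta>"
begin

lemma parameter_bounds:
  "\<kappa> > 2" "\<nu> > 0" "b \<le> 2 ^ \<beta>" "2 / 2 ^ \<eta> \<le> \<epsilon> / 4" "real n \<le> 2 ^ \<nu>"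
  "\<kappa> * (\<beta> + 1) + \<eta> + clog (\<nu> + \<eta>) + 4 \<le> a * (\<kappa> - 2)" "T = 32 * (\<nu> + \<eta>) * 4 ^ a" "\<beta> + 1 \<le> a"
proof -
  show \<kappa>: "\<kappa> > 2" and "\<nu> > 0" using n defs clog_pos[of n] by auto
  have "b \<le> real (nat \<lceil>b\<rceil>)" by linarith
  also have "\<dots> \<le> 2 ^ \<beta>" unfolding defs(3) by (rule real_le_power_clog)
  finally show "b \<le> 2 ^ \<beta>" .
  have "8 / \<epsilon> \<le> real (nat \<lceil>8 / \<epsilon>\<rceil>)" by linarith
  also have "\<dots> \<le> 2 ^ \<eta>" unfolding defs(4) by (rule real_le_power_clog)
  finally have "8 / \<epsilon> \<le> 2 ^ \<eta>" .
  then show "2 / 2 ^ \<eta> \<le> \<epsilon> / 4" using \<epsilon> by (simp add: field_simps)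
  show "real n \<le> 2 ^ \<nu>" unfolding defs(2) by (rule real_le_power_clog)
  show R: "\<kappa> * (\<beta> + 1) + \<eta> + clog (\<nu> + \<eta>) + 4 \<le> a * (\<kappa> - 2)"
    using ceil_div_le_iff[of "\<kappa> - 2" "\<kappa> * (\<beta> + 1) + \<eta> + clog (\<nu> + \<eta>) + 4" a] \<kappa> defs(5) by (simp add: walk_exponent_def)
  show "T = 32 * (\<nu> + \<eta>) * 4 ^ a" by (simp add: defs(6) walk_length_def defs(5)[symmetric])
  show "\<beta> + 1 \<le> a"
  proof (rule ccontr)
    assume "\<not> \<beta> + 1 \<le> a"
    then have "a * (\<kappa> - 2) \<le> (\<beta> + 1) * \<kappa>" by (intro mult_le_mono) auto
    with R show False by (simp add: mult.commute)
  qed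
qed

lemma walk_length_le: "real T \<le> 32 * 2 ^ clog (\<nu> + \<eta>) * (2 ^ a) ^ 2"
proof -
  have "(4 :: real) ^ a = (2 ^ a) ^ 2" by (simp add: power_mult[symmetric] power_even_eq[symmetric] mult.commute[of a] power_mult)
  then show ?thesis
    using real_le_power_clog[of "\<nu> + \<eta>"] unfolding parameter_bounds(7) by simp
qed

text \<open>Raising \<open>a\<close> by one multiplies the number of steps by 4 and divides the
  error of a step by \<open>2 ^ \<kappa>\<close>, a net gain of \<open>\<kappa> - 2\<close> bits;
  \<open>walk_exponent\<close> provides enough of them.\<close>

lemma taylor_error: "real T * (2 * (1 / 2 ^ a) * b) ^ \<kappa> \<le> \<epsilon> / 4"
proof -
  define X Y Z E V :: real where "X = 2 ^ clog (\<nu> + \<eta>)" and "Y = 2 ^ (\<kappa> * (\<beta> + 1))" and "Z = (2 ^ a) ^ 2"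
    and "E = 2 ^ \<eta>" and "V = 2 ^ (a * (\<kappa> - 2))"
  have pos: "X > 0" "Y > 0" "Z > 0" "E > 0" "V > 0" by (simp_all add: X_def Y_def Z_def E_def V_def)
  have "Y * E * X * 16 = 2 ^ (\<kappa> * (\<beta> + 1) + \<eta> + clog (\<nu> + \<eta>) + 4)"
    by (simp add: X_def Y_def E_def power_add)
  also have "\<dots> \<le> V"
    unfolding V_def by (intro power_increasing parameter_bounds(6)) simp
  finally have V: "Y * E * X * 16 \<le> V" .
  have "(2 * (1 / 2 ^ a) * b) ^ \<kappa> \<le> (2 ^ (\<beta> + 1) / 2 ^ a) ^ \<kappa>"
    using parameter_bounds(3) b by (intro power_mono) (simp_all add: field_simps)
  also have "\<dots> = Y / 2 ^ (a * \<kappa>)"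
    by (simp only: power_divide power_mult[symmetric] Y_def mult.commute)
  also have "(2 :: real) ^ (a * \<kappa>) = Z * V"
  proof -
    have "a * \<kappa> = a * 2 + a * (\<kappa> - 2)" 
    proof -
      obtain r where "\<kappa> = 2 + r" using parameter_bounds(1) by (metis less_imp_add_positive)
      then show ?thesis by (simp add: distrib_left)
    qed
    then show ?thesis by (simp only: Z_def V_def power_add power_mult)
  qed
  finally have "(2 * (1 / 2 ^ a) * b) ^ \<kappa> \<le> Y / (Z * V)" .
  then have "real T * (2 * (1 / 2 ^ a) * b) ^ \<kappa> \<le> (32 * X * Z) * (Y / (Z * V))"
    using walk_length_le b pos by (intro mult_mono) (simp_all add: X_def Z_def)
  also have "\<dots> = 32 * X * Y / V" using pos by (simp add: field_simps)
  also have "\<dots> \<le> 32 * X * Y / (Y * E * X * 16)" using pos V by (intro divide_left_mono) simp_all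
  also have "\<dots> = 2 / E" using pos by (simp add: field_simps)
  also have "\<dots> \<le> \<epsilon> / 4" using parameter_bounds(4) by (simp add: E_def)
  finally show ?thesis .
qed

text \<open>By the choice of \<open>T\<close> the power is at most
  \<open>exp (- real (\<nu> + \<eta>))\<close>; here \<open>2 ^ \<nu>\<close> absorbs
  \<open>n\<close>, and \<open>2 ^ \<eta>\<close> yields the error.\<close>

lemma rounding_error_small: "2 * real n * (1 - (1 / 2 ^ a)\<^sup>2 / 32) ^ T \<le> \<epsilon> / 4"
proof -
  define x :: real where "x = (1 / 2 ^ a)\<^sup>2 / 32"
  have "(4 :: real) ^ a = (2 ^ a)\<^sup>2" by (simp add: power2_eq_square power_mult_distrib[symmetric])
  then have xT: "x * real T = real (\<nu> + \<eta>)"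
    unfolding parameter_bounds(7) by (simp add: x_def power_divide)
  have "(1 / 2 ^ a)\<^sup>2 \<le> (1 :: real)" by (intro power_le_one) simp_all
  then have "x \<le> 1" by (simp add: x_def)
  then have "(1 - x) ^ T \<le> exp (- x) ^ T"
    using exp_ge_add_one_self[of "- x"] by (intro power_mono) simp_all
  also have "\<dots> = exp (- real (\<nu> + \<eta>))"
    by (simp only: exp_of_nat_mult[symmetric] xT[symmetric]) (simp add: mult.commute)
  also have "\<dots> = 1 / exp 1 ^ (\<nu> + \<eta>)"
    using exp_of_nat_mult[of "\<nu> + \<eta>" "1 :: real"] by (simp only: mult_1_right exp_minus inverse_eq_divide)
  also have "\<dots> \<le> 1 / 2 ^ (\<nu> + \<eta>)"
    using exp_ge_add_one_self[of 1] by (intro divide_left_mono power_mono) simp_all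
  finally have "2 * real n * (1 - x) ^ T \<le> 2 * 2 ^ \<nu> * (1 / 2 ^ (\<nu> + \<eta>))"
    using parameter_bounds(5) \<open>x \<le> 1\<close> by (intro mult_mono) simp_all
  also have "\<dots> = 2 / 2 ^ \<eta>" by (simp add: power_add)
  also have "\<dots> \<le> \<epsilon> / 4" by (rule parameter_bounds(4))
  finally show ?thesis by (simp add: x_def)
qed

lemma is_prg_walk:
  fixes A :: real and \<tau> :: "nat \<Rightarrow> nat \<Rightarrow> nat \<Rightarrow> nat \<Rightarrow> nat"
  defines "d \<equiv> field_degree (\<tau> \<kappa> \<nu> \<eta> a)"
  defines "\<delta> \<equiv> real (\<kappa> * (\<nu> + 1)) / 2 ^ d"
  assumes nt: "nontrivial_error n (nat \<lceil>8 / \<epsilon>\<rceil>)" and short: "T * (3 * d) < n"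
    and A: "\<And>h. h \<in> F \<Longrightarrow> (\<Sum>j=1..<\<kappa>. L1 n j h * (1 / 2 ^ a) ^ j) \<le> A"
    and \<delta>: "\<delta> \<le> 1 / 2 ^ a / 16" and TA: "real T * (\<delta> * A) \<le> \<epsilon> / 4"
  shows "is_prg n F \<epsilon> (map_pmf (generator \<tau> n k b \<epsilon> (T * (3 * d))) (pmf_of_set (cube (T * (3 * d)))))"
proof (rule is_prg_cubeI)
  show "generator \<tau> n k b \<epsilon> (T * (3 * d)) y \<in> cube n" for y by (rule generator_cube)
  define l where "l = trinomial_exponent (\<tau> \<kappa> \<nu> \<eta> a)"
  have d: "d = 2 * 3 ^ l" by (simp add: d_def l_def field_degree_def)
  have nle: "n \<le> 2 ^ \<nu>" using le_clog[of n] defs by simp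
  interpret walk_generator n \<kappa> "3 * d" F "1 / 2 ^ a" b \<delta> A "step_signs n l \<kappa> \<nu>"
  proof
    show "\<bar>level_part n h \<kappa> x\<bar> \<le> b ^ \<kappa>" if "h \<in> F" "x \<in> cube n" for h x
      unfolding defs(1) by (rule abs_level_part_le[OF F that M b])
    show "1 < \<kappa>" using parameter_bounds(1) by simp
    have "(2 :: real) ^ 1 \<le> 2 ^ a" using parameter_bounds(8) by (intro power_increasing) auto
    then show "1 / 2 ^ a \<le> (1 / 2 :: real)" by (simp add: field_simps)
    show "\<bar>\<Sum>v\<in>cube (3 * d). monomial S (step_signs n l \<kappa> \<nu> v)\<bar> \<le> \<delta> * 2 ^ (3 * d)"
      if "S \<subseteq> {..<n}" "S \<noteq> {}" "card S < \<kappa>" for S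
      unfolding \<delta>_def d using step_signs_bias[OF nle that(1,2), of \<kappa> l] that(3) by simp
  qed (use closed F A \<delta> in \<open>auto simp: step_signs_cube \<delta>_def\<close>)
  fix f assume f: "f \<in> F"
  let ?s = "T * (3 * d)"
  have s: "?s = 3 * d * T" by simp
  let ?G = "generator \<tau> n k b \<epsilon> ?s"
  have "\<bar>(\<Sum>y\<in>cube (3 * d * T). f (?G y)) - 2 ^ (3 * d * T) * fourier n f {}\<bar>
      \<le> 2 ^ (3 * d * T) * (T * ((2 * (1 / 2 ^ a) * b) ^ \<kappa> + \<delta> * A) + real (2 * n) * (1 - (1 / 2 ^ a)\<^sup>2 / 32) ^ T)"
  proof (rule walk_fools[OF f])
    show "?G y \<in> cube n" for y by (rule generator_cube)
    fix y i assume i: "i < n"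
    have inp: "ram_input n k b \<epsilon> ?s y = [n, k, nat \<lceil>b\<rceil>, nat \<lceil>8 / \<epsilon>\<rceil>] @ input_bits (3 * d * T) y"
      by (simp add: ram_input_def input_bits_def s)
    have "\<not> n \<le> T * (6 * 3 ^ l)" using short by (simp add: d)
    then have "generator_bit \<tau> n k (nat \<lceil>b\<rceil>) (nat \<lceil>8 / \<epsilon>\<rceil>) (ram_input n k b \<epsilon> ?s y) i =
        coordinate_bit (ram_input n k b \<epsilon> ?s y) l \<kappa> \<nu> a T i"
      unfolding generator_bit_def Let_def defs(1)[symmetric] defs(2)[symmetric] defs(3)[symmetric] defs(4)[symmetric]
        defs(5)[symmetric] defs(6)[symmetric] l_def[symmetric]
      using nt by simp
    then have G: "?G y i = sign_of (coordinate_bit (ram_input n k b \<epsilon> ?s y) l \<kappa> \<nu> a T i)"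
      using i by (simp add: generator_def)
    show "position T y i = \<bar>position T y i\<bar> * ?G y i"
      unfolding position_def
      unfolding G
      unfolding d
      by (rule coordinate_bit_sign[OF parameter_bounds(2) i inp[unfolded d]])
  qed
  also have "\<dots> \<le> 2 ^ (3 * d * T) * \<epsilon>"
  proof (rule mult_left_mono)
    \<comment> \<open>Taylor remainder, bias and rounding take a quarter of
      \<open>\<epsilon>\<close> each.\<close>
    have "real T * ((2 * (1 / 2 ^ a) * b) ^ \<kappa> + \<delta> * A) + real (2 * n) * (1 - (1 / 2 ^ a)\<^sup>2 / 32) ^ T \<le> \<epsilon> / 4 + \<epsilon> / 4 + \<epsilon> / 4"
      using taylor_error TA rounding_error_small by (simp add: distrib_left)
    then show "real T * ((2 * (1 / 2 ^ a) * b) ^ \<kappa> + \<delta> * A) + real (2 * n) * (1 - (1 / 2 ^ a)\<^sup>2 / 32) ^ T \<le> \<epsilon>"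
      using \<epsilon> by linarith
  qed simp
  finally show "\<bar>(\<Sum>y\<in>cube ?s. f (?G y)) - 2 ^ ?s * fourier n f {}\<bar> \<le> 2 ^ ?s * \<epsilon>"
    unfolding s .
qed

text \<open>The bias conditions are demanded for \<open>T < n\<close> only, since otherwise the seed
  is copied or the output constant; the field size \<open>target1\<close> depends on this.\<close>

lemma is_prg_generator:
  fixes A :: real and \<tau> :: "nat \<Rightarrow> nat \<Rightarrow> nat \<Rightarrow> nat \<Rightarrow> nat"
  defines "d \<equiv> field_degree (\<tau> \<kappa> \<nu> \<eta> a)"
  defines "\<delta> \<equiv> real (\<kappa> * (\<nu> + 1)) / 2 ^ d"
  defines "s \<equiv> if nontrivial_error n (nat \<lceil>8 / \<epsilon>\<rceil>) then min n (T * (3 * d)) else 0"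
  assumes A: "\<And>h. T < n \<Longrightarrow> h \<in> F \<Longrightarrow> (\<Sum>j=1..<\<kappa>. L1 n j h * (1 / 2 ^ a) ^ j) \<le> A"
    and \<delta>: "T < n \<Longrightarrow> \<delta> \<le> 1 / 2 ^ a / 16" and TA: "T < n \<Longrightarrow> real T * (\<delta> * A) \<le> \<epsilon> / 4"
  shows "is_prg n F \<epsilon> (map_pmf (generator \<tau> n k b \<epsilon> s) (pmf_of_set (cube s)))"
proof (cases "nontrivial_error n (nat \<lceil>8 / \<epsilon>\<rceil>)")
  case False
  then show ?thesis
    unfolding s_def using is_prg_trivial[OF F n(1) \<epsilon> False generator_cube] by simp
next
  case nt: True
  show ?thesis
  proof (cases "T * (3 * d) < n")
    case True
    have "T * 1 \<le> T * (3 * d)" by (intro mult_le_mono2) (simp add: d_def field_degree_def)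
    then have "T < n" using True by linarith
    have s: "s = T * (3 * d)" using nt True by (simp add: s_def)
    show ?thesis
      unfolding s d_def
    proof (rule is_prg_walk[where A = A and \<tau> = \<tau>])
      show "nontrivial_error n (nat \<lceil>8 / \<epsilon>\<rceil>)" by (rule nt)
      show "T * (3 * field_degree (\<tau> \<kappa> \<nu> \<eta> a)) < n" using True by (simp only: d_def)
      show "(\<Sum>j=1..<\<kappa>. L1 n j h * (1 / 2 ^ a) ^ j) \<le> A" if "h \<in> F" for h
        by (rule A[OF \<open>T < n\<close> that])
      show "real (\<kappa> * (\<nu> + 1)) / 2 ^ field_degree (\<tau> \<kappa> \<nu> \<eta> a) \<le> 1 / 2 ^ a / 16"
        using \<delta>[OF \<open>T < n\<close>] unfolding \<delta>_def d_def .
      show "real T * (real (\<kappa> * (\<nu> + 1)) / 2 ^ field_degree (\<tau> \<kappa> \<nu> \<eta> a) * A) \<le> \<epsilon> / 4"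
        using TA[OF \<open>T < n\<close>] unfolding \<delta>_def d_def .
    qed
  next
    case False
    then have s: "s = n" using nt by (simp add: s_def)
    show ?thesis
      unfolding s
    proof (rule is_prg_identity[OF \<epsilon>])
      fix y assume y: "y \<in> cube n"
      have "n \<le> T * (6 * 3 ^ trinomial_exponent (\<tau> \<kappa> \<nu> \<eta> a))" using False by (simp add: d_def field_degree_def)
      then have bit: "generator_bit \<tau> n k (nat \<lceil>b\<rceil>) (nat \<lceil>8 / \<epsilon>\<rceil>) (ram_input n k b \<epsilon> n y) i =
          nth_default 0 (ram_input n k b \<epsilon> n y) (4 + i)" for i
        unfolding generator_bit_def Let_def defs(1)[symmetric] defs(2)[symmetric] defs(3)[symmetric] defs(4)[symmetric]
          defs(5)[symmetric] defs(6)[symmetric]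
        using nt by simp
      have inp: "ram_input n k b \<epsilon> n y = [n, k, nat \<lceil>b\<rceil>, nat \<lceil>8 / \<epsilon>\<rceil>] @ input_bits n y"
        by (simp add: ram_input_def input_bits_def)
      have low: "generator \<tau> n k b \<epsilon> n y i = y i" if "i < n" for i
        using cubeD[OF y that] that nth_default_input[OF that]
        unfolding generator_def bit unfolding inp by (auto simp: sign_of_def)
      show "generator \<tau> n k b \<epsilon> n y = y"
        using generator_cube[of \<tau> n k b \<epsilon> n y] y low unfolding cube_def by (intro PiE_ext) auto
    qed
  qed
qed

lemma step_size_b: "1 / 2 ^ a * b \<le> 1 / 2"
proof -
  have "b \<le> 2 ^ \<beta>" by (rule parameter_bounds(3))
  also have "(2 :: real) ^ \<beta> \<le> 2 ^ (a - 1)" using parameter_bounds(8) by (intro power_increasing) auto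
  finally have "b * 2 \<le> 2 ^ (a - 1) * 2" by simp
  also have "\<dots> = 2 ^ a" using parameter_bounds(8) by (cases a) auto
  finally show ?thesis by (simp add: field_simps)
qed

lemma sum_half_powers_le: "(\<Sum>j=1..<m. (1 / 2 :: real) ^ j) \<le> 1"
proof -
  have "(\<Sum>j=1..<Suc m. (1 / 2 :: real) ^ j) = 1 - (1 / 2) ^ m" for m
    by (induction m) simp_all
  then have "(\<Sum>j=1..<Suc m. (1 / 2 :: real) ^ j) \<le> 1" for m by simp
  then show ?thesis by (cases m) simp_all
qed

lemma columns_le: "real (\<kappa> * (\<nu> + 1)) \<le> 2 ^ (clog \<kappa> + clog (\<nu> + 1))"
  unfolding of_nat_mult power_add by (intro mult_mono real_le_power_clog) simp_all

text \<open>As \<open>b / 2 ^ a \<le> 1 / 2\<close>, the bounds on \<open>L1_class\<close> turn the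
  weighted Fourier mass into a geometric series, so \<open>A = 1\<close> is enough.\<close>

lemma is_prg_generator2:
  assumes L1: "\<And>i. 1 \<le> i \<Longrightarrow> i < k \<Longrightarrow> L1_class n i F \<le> b ^ i"
  defines "s \<equiv> if nontrivial_error n (nat \<lceil>8 / \<epsilon>\<rceil>) then min n (T * (3 * field_degree (target2 \<kappa> \<nu> \<eta> a))) else 0"
  shows "is_prg n F \<epsilon> (map_pmf (generator target2 n k b \<epsilon> s) (pmf_of_set (cube s)))"
  unfolding s_def
proof (rule is_prg_generator[where A = 1])
  let ?d = "field_degree (target2 \<kappa> \<nu> \<eta> a)"
  have "finite F" by (rule finite_subset[OF F]) simp
  fix h assume h: "h \<in> F"
  have "(\<Sum>j=1..<\<kappa>. L1 n j h * (1 / 2 ^ a) ^ j) \<le> (\<Sum>j=1..<\<kappa>. (1 / 2) ^ j)"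
  proof (rule sum_mono)
    fix j assume j: "j \<in> {1..<\<kappa>}"
    have "L1 n j h \<le> L1_class n j F"
      unfolding L1_class_def using h \<open>finite F\<close> by (intro Max_ge) auto
    also have "\<dots> \<le> b ^ j" using L1[of j] j defs(1) by simp
    finally have "L1 n j h * (1 / 2 ^ a) ^ j \<le> b ^ j * (1 / 2 ^ a) ^ j"
      by (intro mult_right_mono) simp_all
    also have "\<dots> = (1 / 2 ^ a * b) ^ j" by (simp add: power_mult_distrib[symmetric] mult.commute)
    also have "\<dots> \<le> (1 / 2) ^ j" using step_size_b b by (intro power_mono) simp_all
    finally show "L1 n j h * (1 / 2 ^ a) ^ j \<le> (1 / 2) ^ j" .
  qed
  also have "\<dots> \<le> 1" by (rule sum_half_powers_le)
  finally show "(\<Sum>j=1..<\<kappa>. L1 n j h * (1 / 2 ^ a) ^ j) \<le> 1" .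
next
  let ?d = "field_degree (target2 \<kappa> \<nu> \<eta> a)" and ?\<mu> = "\<eta> + clog (\<nu> + \<eta>) + 2 * a + 4"
  have "real (\<kappa> * (\<nu> + 1)) * 2 ^ ?\<mu> \<le> 2 ^ (clog \<kappa> + clog (\<nu> + 1)) * 2 ^ ?\<mu>"
    by (intro mult_right_mono columns_le) simp
  also have "\<dots> = 2 ^ target2 \<kappa> \<nu> \<eta> a"
    by (simp only: target2_def power_add[symmetric]) (simp add: add_ac)
  also have "\<dots> \<le> 2 ^ ?d" by (intro power_increasing field_degree_ge) simp
  finally have \<delta>: "real (\<kappa> * (\<nu> + 1)) / 2 ^ ?d \<le> 1 / 2 ^ ?\<mu>"
    by (simp add: field_simps)
  have "(2 :: real) ^ (a + 4) \<le> 2 ^ ?\<mu>" by (intro power_increasing) simp_all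
  then have "1 / 2 ^ ?\<mu> \<le> 1 / (2 :: real) ^ (a + 4)" by (intro divide_left_mono) simp_all
  with \<delta> show "real (\<kappa> * (\<nu> + 1)) / 2 ^ ?d \<le> 1 / 2 ^ a / 16"
    by (simp add: power_add)
  have "real T * (real (\<kappa> * (\<nu> + 1)) / 2 ^ ?d * 1) \<le> (32 * 2 ^ clog (\<nu> + \<eta>) * (2 ^ a) ^ 2) * (1 / 2 ^ ?\<mu>)"
    using \<delta> by (intro mult_mono walk_length_le) simp_all
  also have "\<dots> = 2 / 2 ^ \<eta>"
    by (simp add: power_add power_mult[symmetric] mult.commute[of a])
  also have "\<dots> \<le> \<epsilon> / 4" by (rule parameter_bounds(4))
  finally show "real T * (real (\<kappa> * (\<nu> + 1)) / 2 ^ ?d * 1) \<le> \<epsilon> / 4" .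
qed

lemma abs_fourier_le_1:
  assumes "h \<in> boolean_functions n" "S \<subseteq> {..<n}"
  shows "\<bar>fourier n h S\<bar> \<le> 1"
proof -
  have "\<bar>\<Sum>x\<in>cube n. h x * monomial S x\<bar> \<le> (\<Sum>x\<in>cube n. \<bar>h x * monomial S x\<bar>)"
    by (rule sum_abs)
  also have "\<dots> = (\<Sum>x\<in>cube n. 1)"
  proof (rule sum.cong[OF refl])
    fix x assume x: "x \<in> cube n"
    have "\<bar>monomial S x\<bar> = 1"
      unfolding monomial_def abs_prod using assms(2) cube_abs[OF x] by (intro prod.neutral) auto
    then show "\<bar>h x * monomial S x\<bar> = 1"
      using boolean_function_abs[OF assms(1) x] by (simp add: abs_mult)
  qed
  finally show ?thesis by (simp add: fourier_def card_cube)
qed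

lemma L1_le_power: "h \<in> boolean_functions n \<Longrightarrow> L1 n j h \<le> real n ^ j"
proof -
  assume h: "h \<in> boolean_functions n"
  have "L1 n j h \<le> (\<Sum>S | S \<subseteq> {..<n} \<and> card S = j. 1)"
    unfolding L1_def using abs_fourier_le_1[OF h] by (intro sum_mono) auto
  also have "\<dots> = real (n choose j)"
    using n_subsets[of "{..<n}" j] by simp
  also have "\<dots> \<le> real n ^ j"
    using binomial_le_pow[of j n] by (cases "j \<le> n") (simp_all add: binomial_eq_0 flip: of_nat_power)
  finally show ?thesis .
qed

text \<open>When the walk has fewer than \<open>n\<close> steps, \<open>b\<close> and \<open>1 / \<epsilon>\<close> are so small that a field of size
  \<open>n ^ O(k)\<close> suffices.\<close>

lemma is_prg_generator1:
  defines "s \<equiv> if nontrivial_error n (nat \<lceil>8 / \<epsilon>\<rceil>) then min n (T * (3 * field_degree (target1 \<kappa> \<nu> \<eta> a))) else 0"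
  shows "is_prg n F \<epsilon> (map_pmf (generator target1 n k b \<epsilon> s) (pmf_of_set (cube s)))"
  unfolding s_def
proof (rule is_prg_generator[where A = "2 ^ (\<nu> * \<kappa>)"])
  fix h assume h: "h \<in> F"
  have "(\<Sum>j=1..<\<kappa>. L1 n j h * (1 / 2 ^ a) ^ j) \<le> (\<Sum>j=1..<\<kappa>. 2 ^ (\<nu> * \<kappa>) * (1 / 2) ^ j)"
  proof (intro sum_mono mult_mono power_mono)
    fix j assume j: "j \<in> {1..<\<kappa>}"
    have "L1 n j h \<le> real n ^ j" using h F by (intro L1_le_power) auto
    also have "\<dots> \<le> (2 ^ \<nu>) ^ j" using parameter_bounds(5) by (intro power_mono) simp_all
    also have "\<dots> \<le> (2 ^ \<nu>) ^ \<kappa>" using j by (intro power_increasing) simp_all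
    finally show "L1 n j h \<le> 2 ^ (\<nu> * \<kappa>)" by (simp add: power_mult)
    have "(2 :: real) ^ 1 \<le> 2 ^ a" using parameter_bounds(8) by (intro power_increasing) auto
    then show "1 / 2 ^ a \<le> (1 / 2 :: real)" by (simp add: field_simps)
  qed simp_all
  also have "\<dots> = 2 ^ (\<nu> * \<kappa>) * (\<Sum>j=1..<\<kappa>. (1 / 2) ^ j)" by (rule sum_distrib_left[symmetric])
  also have "\<dots> \<le> 2 ^ (\<nu> * \<kappa>) * 1" by (intro mult_left_mono sum_half_powers_le) simp
  finally show "(\<Sum>j=1..<\<kappa>. L1 n j h * (1 / 2 ^ a) ^ j) \<le> 2 ^ (\<nu> * \<kappa>)" by simp
next
  assume Tn: "T < n"
  let ?d = "field_degree (target1 \<kappa> \<nu> \<eta> a)"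
  have \<kappa>: "\<kappa> \<ge> 3" and \<nu>: "\<nu> \<ge> 1" using parameter_bounds(1,2) by simp_all
  have "(4 :: nat) ^ a * 1 \<le> 4 ^ a * (32 * (\<nu> + \<eta>))" using \<nu> by (intro mult_le_mono2) simp
  then have "4 ^ a \<le> T" unfolding parameter_bounds(7) by (simp only: mult_1_right mult.commute)
  then have "(2 :: nat) ^ (2 * a) \<le> T" by (simp only: power_mult) simp
  \<comment> \<open>Fewer than \<open>n\<close> steps force \<open>4 ^ a < 2 ^ \<nu>\<close>, so the
    step size is not too small.\<close>
  also have "T < 2 ^ \<nu>" using Tn le_clog[of n] defs(2) by simp
  finally have a: "2 * a \<le> \<nu>" by (simp add: power_less_imp_less_exp less_imp_le)
  \<comment> \<open>The choice of \<open>a\<close> includes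
    \<open>\<eta> \<le> a * (\<kappa> - 2)\<close>, so the bound on \<open>a\<close> also bounds
    \<open>1 / \<epsilon>\<close>.\<close>
  have \<eta>: "2 * \<eta> \<le> \<nu> * \<kappa>"
  proof -
    have "\<eta> \<le> a * (\<kappa> - 2)" using parameter_bounds(6) by linarith
    then have "2 * \<eta> \<le> 2 * a * (\<kappa> - 2)" by simp
    also have "\<dots> \<le> \<nu> * \<kappa>" using a by (intro mult_le_mono) simp_all
    finally show ?thesis .
  qed
  have kn: "3 * \<nu> \<le> \<nu> * \<kappa>" "\<kappa> \<le> \<nu> * \<kappa>" "3 \<le> \<nu> * \<kappa>"
    using mult_le_mono2[OF \<kappa>, of \<nu>] mult_le_mono1[OF \<nu>, of \<kappa>] mult_le_mono[OF \<nu> \<kappa>] by (simp_all add: mult.commute)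
  have cols: "real (\<kappa> * (\<nu> + 1)) \<le> 2 ^ (\<nu> * \<kappa> + \<nu> + 1)"
  proof -
    have "clog \<kappa> + clog (\<nu> + 1) \<le> \<nu> * \<kappa> + \<nu> + 1"
      using clog_le_self[of \<kappa>] clog_le_self[of "\<nu> + 1"] kn by linarith
    then have "(2 :: real) ^ (clog \<kappa> + clog (\<nu> + 1)) \<le> 2 ^ (\<nu> * \<kappa> + \<nu> + 1)"
      by (intro power_increasing) simp_all
    with columns_le show ?thesis by linarith
  qed
  have d: "8 * (\<nu> * \<kappa>) \<le> ?d"
    using field_degree_ge[of "target1 \<kappa> \<nu> \<eta> a"] by (simp add: target1_def mult_ac)
  have "real (\<kappa> * (\<nu> + 1)) * 2 ^ (a + 4) \<le> 2 ^ (\<nu> * \<kappa> + \<nu> + 1) * 2 ^ (a + 4)"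
    by (intro mult_right_mono cols) simp
  also have "\<dots> = 2 ^ (\<nu> * \<kappa> + \<nu> + 1 + (a + 4))" by (simp only: power_add)
  also have "\<dots> \<le> 2 ^ ?d"
  proof -
    have "\<nu> * \<kappa> + \<nu> + 1 + (a + 4) \<le> ?d" using a kn d by linarith
    then show ?thesis by (rule power_increasing) simp
  qed
  finally show "real (\<kappa> * (\<nu> + 1)) / 2 ^ ?d \<le> 1 / 2 ^ a / 16"
    by (simp add: field_simps power_add)
  have "real T * (real (\<kappa> * (\<nu> + 1)) * 2 ^ (\<nu> * \<kappa>)) * 2 ^ \<eta> \<le> 2 ^ \<nu> * (2 ^ (\<nu> * \<kappa> + \<nu> + 1) * 2 ^ (\<nu> * \<kappa>)) * 2 ^ \<eta>"
    using \<open>T < 2 ^ \<nu>\<close> cols by (intro mult_mono) (simp_all add: less_imp_le flip: of_nat_less_iff)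
  also have "\<dots> = 2 ^ (\<nu> + (\<nu> * \<kappa> + \<nu> + 1 + \<nu> * \<kappa>) + \<eta>)" by (simp only: power_add)
  also have "\<dots> \<le> 2 ^ (?d + 1)"
  proof -
    have "\<nu> + (\<nu> * \<kappa> + \<nu> + 1 + \<nu> * \<kappa>) + \<eta> \<le> ?d + 1" using \<eta> kn d by linarith
    then show ?thesis by (rule power_increasing) simp
  qed
  finally have "real T * (real (\<kappa> * (\<nu> + 1)) / 2 ^ ?d * 2 ^ (\<nu> * \<kappa>)) \<le> 2 / 2 ^ \<eta>"
    by (simp add: field_simps)
  also have "\<dots> \<le> \<epsilon> / 4" by (rule parameter_bounds(4))
  finally show "real T * (real (\<kappa> * (\<nu> + 1)) / 2 ^ ?d * 2 ^ (\<nu> * \<kappa>)) \<le> \<epsilon> / 4" .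
qed

end

subsection \<open>The seed length\<close>

lemma two_power_clog_le: "x \<ge> 1 \<Longrightarrow> 2 ^ clog x \<le> 2 * real x"
proof -
  assume x: "x \<ge> 1"
  show ?thesis
  proof (cases "clog x")
    case 0
    then show ?thesis using x by simp
  next
    case (Suc m)
    then have "\<not> clog x \<le> m" by simp
    then have "2 ^ m < x" by (simp add: clog_le_iff not_le)
    then have "(2 :: real) ^ m < real x" by (metis of_nat_less_iff of_nat_numeral of_nat_power)
    then show ?thesis by (simp add: Suc)
  qed
qed

lemma clog_le_log: "x \<ge> 1 \<Longrightarrow> real (clog x) \<le> log 2 x + 1"
proof -
  assume x: "x \<ge> 1"
  have "real (clog x) = log 2 (2 ^ clog x)" by simp
  also have "\<dots> \<le> log 2 (2 * real x)" using two_power_clog_le[OF x] by (intro log_mono) simp_all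
  also have "\<dots> = log 2 x + 1" using x by (simp add: log_mult)
  finally show ?thesis .
qed

lemma powr_ge_1_8:
  fixes Q p :: real
  assumes "Q \<ge> 1 / 8" "0 \<le> p" "p \<le> 2"
  shows "Q powr p \<ge> 1 / 64"
proof (cases "Q \<ge> 1")
  case True
  then have "Q powr p \<ge> 1" using assms(2) by (rule ge_one_powr_ge_zero)
  then show ?thesis by simp
next
  case False
  have "1 / 64 = (1 / 8 :: real) powr 2" by (simp add: powr_numeral power2_eq_square)
  also have "\<dots> \<le> Q powr 2" using assms by (intro powr_mono2) simp_all
  also have "\<dots> \<le> Q powr p" using False assms by (intro powr_mono') simp_all
  finally show ?thesis .
qed

text \<open>With R the numerator in \<open>walk_exponent\<close>, \<open>4 ^ a\<close> is at most
  \<open>4 * (2 ^ R) powr p\<close>. The identity \<open>\<kappa> * p = 2 + 2 * p\<close> then turns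
  \<open>b powr (\<kappa> * p)\<close> into \<open>b\<^sup>2 * (b\<^sup>2) powr p\<close>, the shape
  of the claimed length.\<close>

lemma walk_length_le_real:
  fixes b \<epsilon> \<Lambda> p :: real
  assumes \<kappa>: "\<kappa> > 2" and p: "p = 2 / (real \<kappa> - 2)" and b: "b \<ge> 1" "2 ^ \<beta> \<le> 4 * b"
    and \<epsilon>: "\<epsilon> > 0" "2 ^ \<eta> \<le> 20 / \<epsilon>" and \<Lambda>: "real (\<nu> + \<eta>) \<le> 25 * \<Lambda>" and \<nu>: "\<nu> > 0"
  shows "real (walk_length \<kappa> \<nu> \<beta> \<eta>) \<le> 204800 * 1024000\<^sup>2 * (b\<^sup>2 * \<Lambda> * (b\<^sup>2 * \<Lambda> / \<epsilon>) powr p)"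
proof -
  define R a where "R = \<kappa> * (\<beta> + 1) + \<eta> + clog (\<nu> + \<eta>) + 4" and "a = walk_exponent \<kappa> \<nu> \<beta> \<eta>"
  have \<Lambda>0: "\<Lambda> > 0" using \<Lambda> \<nu> by simp
  have p0: "0 \<le> p" "p \<le> 2" using \<kappa> by (simp_all add: p field_simps)
  have \<kappa>p: "real \<kappa> * p = 2 + 2 * p" using \<kappa> by (simp add: p field_simps)
  have "real a \<le> real R / (real \<kappa> - 2) + 1"
  proof (cases a)
    case 0
    then show ?thesis using \<kappa> by simp
  next
    case (Suc c)
    then have "\<not> ceil_div R (\<kappa> - 2) \<le> c" by (simp add: a_def R_def walk_exponent_def)
    then have "c * (\<kappa> - 2) < R" using \<kappa> by (simp add: ceil_div_le_iff)
    then have "real (c * (\<kappa> - 2)) < real R" by (simp only: of_nat_less_iff)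
    then have "real c * (real \<kappa> - 2) < real R" using \<kappa> by (simp add: of_nat_diff)
    then show ?thesis using \<kappa> Suc by (simp add: field_simps)
  qed
  moreover have "real R * p = 2 * (real R / (real \<kappa> - 2))" by (simp add: p)
  ultimately have "2 * real a \<le> 2 + real R * p" by linarith
  then have "2 powr (2 * real a) \<le> 2 powr (2 + real R * p)" by (intro powr_mono) simp_all
  also have "2 powr (2 * real a) = 4 ^ a"
  proof -
    have "2 powr (2 * real a) = 2 powr real (2 * a)" by simp
    also have "\<dots> = 2 ^ (2 * a)" by (rule powr_realpow) simp
    finally show ?thesis by (simp only: power_mult) simp
  qed
  also have "2 powr (2 + real R * p) = 4 * (2 ^ R) powr p"
    by (simp add: powr_add powr_powr powr_realpow[symmetric])
  finally have a: "4 ^ a \<le> 4 * (2 ^ R :: real) powr p" .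
  have "2 ^ clog (\<nu> + \<eta>) \<le> 50 * \<Lambda>"
    using two_power_clog_le[of "\<nu> + \<eta>"] \<Lambda> \<nu> by simp
  moreover have "(2 ^ \<beta> * 2) ^ \<kappa> \<le> (8 * b) ^ \<kappa>" using b by (intro power_mono) simp_all
  ultimately have "(2 ^ \<beta> * 2) ^ \<kappa> * 2 ^ \<eta> * 2 ^ clog (\<nu> + \<eta>) * 16 \<le> (8 * b) ^ \<kappa> * (20 / \<epsilon>) * (50 * \<Lambda>) * 16"
    using b \<epsilon> by (intro mult_right_mono mult_mono) simp_all
  also have "(2 ^ \<beta> * 2) ^ \<kappa> * 2 ^ \<eta> * 2 ^ clog (\<nu> + \<eta>) * 16 = (2 :: real) ^ R"
  proof -
    have "(2 ^ \<beta> * 2 :: real) ^ \<kappa> = 2 ^ (\<kappa> * (\<beta> + 1))"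
      unfolding mult.commute[of \<kappa>] power_mult by (simp add: mult.commute)
    then show ?thesis by (simp add: R_def power_add)
  qed
  \<comment> \<open>\<open>16000 = 20 * 50 * 16\<close>, from rounding \<open>\<epsilon>\<close>,
    from \<open>\<nu> + \<eta>\<close> and from the 4 extra bits in \<open>R\<close>; below,
    \<open>1024000 = 8\<^sup>2 * 16000\<close>.\<close>
  also have "(8 * b) ^ \<kappa> * (20 / \<epsilon>) * (50 * \<Lambda>) * 16 = (8 * b) ^ \<kappa> * (16000 * \<Lambda> / \<epsilon>)" by simp
  finally have "(2 ^ R) powr p \<le> ((8 * b) ^ \<kappa> * (16000 * \<Lambda> / \<epsilon>)) powr p"
    by (intro powr_mono2 p0) simp_all
  also have "\<dots> = ((8 * b) ^ \<kappa>) powr p * (16000 * \<Lambda> / \<epsilon>) powr p"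
    by (rule powr_mult)
  also have "((8 * b) ^ \<kappa>) powr p = (8 * b)\<^sup>2 * ((8 * b)\<^sup>2) powr p"
  proof -
    have "((8 * b) ^ \<kappa>) powr p = (8 * b) powr (2 + 2 * p)"
    proof -
      have "(8 * b) ^ \<kappa> = (8 * b) powr real \<kappa>" using b by (intro powr_realpow[symmetric]) simp
      then show ?thesis by (simp only: powr_powr \<kappa>p)
    qed
    also have "\<dots> = (8 * b) powr 2 * ((8 * b) powr 2) powr p"
      by (simp only: powr_add powr_powr)
    finally show ?thesis using b by (simp add: powr_numeral)
  qed
  also have "(8 * b)\<^sup>2 * ((8 * b)\<^sup>2) powr p * (16000 * \<Lambda> / \<epsilon>) powr p =
      (8 * b)\<^sup>2 * (1024000 powr p * (b\<^sup>2 * \<Lambda> / \<epsilon>) powr p)"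
  proof -
    have "((8 * b)\<^sup>2) powr p * (16000 * \<Lambda> / \<epsilon>) powr p = ((8 * b)\<^sup>2 * (16000 * \<Lambda> / \<epsilon>)) powr p"
      by (rule powr_mult[symmetric])
    also have "(8 * b)\<^sup>2 * (16000 * \<Lambda> / \<epsilon>) = 1024000 * (b\<^sup>2 * \<Lambda> / \<epsilon>)"
      by (simp add: power_mult_distrib)
    also have "(1024000 * (b\<^sup>2 * \<Lambda> / \<epsilon>)) powr p = 1024000 powr p * (b\<^sup>2 * \<Lambda> / \<epsilon>) powr p"
      by (rule powr_mult)
    finally show ?thesis by (simp only: mult.assoc)
  qed
  also have "\<dots> \<le> (8 * b)\<^sup>2 * (1024000\<^sup>2 * (b\<^sup>2 * \<Lambda> / \<epsilon>) powr p)"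
  proof (intro mult_left_mono mult_right_mono)
    \<comment> \<open>\<open>p \<le> 2\<close> because \<open>\<kappa> \<ge> 3\<close>, so constants
      raised to \<open>p\<close> stay bounded.\<close>
    have "1024000 powr p \<le> (1024000 :: real) powr 2" using p0 by (intro powr_mono) simp_all
    also have "\<dots> = 1024000\<^sup>2" by (rule powr_numeral) simp
    finally show "1024000 powr p \<le> (1024000 :: real)\<^sup>2" .
  qed simp_all
  finally have R: "(2 ^ R) powr p \<le> (8 * b)\<^sup>2 * (1024000\<^sup>2 * (b\<^sup>2 * \<Lambda> / \<epsilon>) powr p)" .
  have "real (walk_length \<kappa> \<nu> \<beta> \<eta>) = 32 * real (\<nu> + \<eta>) * 4 ^ a"
    by (simp add: walk_length_def a_def)
  also have "\<dots> \<le> 32 * (25 * \<Lambda>) * (4 * ((8 * b)\<^sup>2 * (1024000\<^sup>2 * (b\<^sup>2 * \<Lambda> / \<epsilon>) powr p)))"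
    using a R \<Lambda> \<Lambda>0 by (intro mult_mono) simp_all
  also have "\<dots> = 204800 * 1024000\<^sup>2 * (b\<^sup>2 * \<Lambda> * (b\<^sup>2 * \<Lambda> / \<epsilon>) powr p)"
    by (simp add: power_mult_distrib)
  finally show ?thesis .
qed

context
  fixes n k :: nat and b \<epsilon> :: real and \<kappa> \<nu> \<beta> \<eta> :: nat and \<Lambda> :: real
  assumes n: "n \<ge> 2" and k: "k > 2" and b: "b \<ge> 1" and \<epsilon>: "\<epsilon> > 0"
    and nt: "nontrivial_error n (nat \<lceil>8 / \<epsilon>\<rceil>)"
    and defs: "\<kappa> = min k (n + 1)" "\<nu> = clog n" "\<beta> = clog (nat \<lceil>b\<rceil>)" "\<eta> = clog (nat \<lceil>8 / \<epsilon>\<rceil>)"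
      "\<Lambda> = log 2 (n / \<epsilon>)"
begin

text \<open>This is why \<open>nontrivial_error\<close> treats \<open>n = 2\<close> separately:
  otherwise \<open>n / \<epsilon>\<close> could come arbitrarily close to 1, and the claimed length
  to 0, with a nonempty seed.\<close>

lemma nontrivial_bounds: "\<epsilon> < 2" "\<Lambda> \<ge> 1 / 4"
proof -
  have "nat \<lceil>8 / \<epsilon>\<rceil> > 4" and cases: "n > 2 \<or> nat \<lceil>8 / \<epsilon>\<rceil> > 5"
    using nt unfolding nontrivial_error_def by blast+
  then have "8 / \<epsilon> > 4" by linarith
  then show \<epsilon>2: "\<epsilon> < 2" using \<epsilon> by (simp add: field_simps)
  have "real n / \<epsilon> \<ge> 5 / 4"
  proof (cases "n > 2")
    case True
    then have "real n \<ge> 3" by simp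
    then show ?thesis using \<epsilon> \<epsilon>2 by (simp add: field_simps)
  next
    case False
    then have "8 / \<epsilon> > 5" using cases by linarith
    then have "\<epsilon> < 8 / 5" using \<epsilon> by (simp add: field_simps)
    moreover have "real n \<ge> 2" using n by simp
    ultimately show ?thesis using \<epsilon> by (simp add: field_simps)
  qed
  then have "log 2 (5 / 4) \<le> \<Lambda>" unfolding defs by (intro log_mono) simp_all
  \<comment> \<open>The bound \<open>1 / 4\<close> comes from
    \<open>(5 / 4) ^ 4 \<ge> 2\<close>.\<close>
  moreover have "1 \<le> log 2 ((5 / 4 :: real) ^ 4)"
    by (subst le_log_iff) (simp_all add: eval_nat_numeral)
  then have "1 \<le> 4 * log 2 (5 / 4 :: real)" by (subst (asm) log_nat_power) simp_all
  ultimately show "\<Lambda> \<ge> 1 / 4" by linarith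
qed

lemma rounding_bounds:
  "2 ^ \<beta> \<le> 4 * b" "2 ^ \<eta> \<le> 20 / \<epsilon>" "real \<beta> \<le> log 2 b + 2" "real \<eta> \<le> log 2 (1 / \<epsilon>) + 5"
  "real (\<nu> + \<eta>) \<le> 25 * \<Lambda>"
proof -
  have B: "real (nat \<lceil>b\<rceil>) \<le> 2 * b" "nat \<lceil>b\<rceil> \<ge> 1" using b by linarith+
  have "2 ^ \<beta> \<le> 2 * real (nat \<lceil>b\<rceil>)" unfolding defs by (rule two_power_clog_le[OF B(2)])
  with B show \<beta>: "2 ^ \<beta> \<le> 4 * b" by linarith
  have "8 / \<epsilon> > 4" using nontrivial_bounds \<epsilon> by (simp add: field_simps)
  then have e: "nat \<lceil>8 / \<epsilon>\<rceil> \<ge> 1" "real (nat \<lceil>8 / \<epsilon>\<rceil>) \<le> 8 / \<epsilon> + 1" by linarith+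
  \<comment> \<open>Rounding up \<open>8 / \<epsilon>\<close> adds at most
    \<open>2 / \<epsilon>\<close>, and \<open>clog\<close> at most doubles, hence 20.\<close>
  have "1 \<le> 2 / \<epsilon>" using nontrivial_bounds \<epsilon> by (simp add: field_simps)
  moreover have "8 / \<epsilon> + 2 / \<epsilon> = 10 / \<epsilon>" "2 * (10 / \<epsilon>) = 20 / \<epsilon>" by (simp_all add: add_divide_distrib[symmetric])
  moreover have "2 ^ \<eta> \<le> 2 * real (nat \<lceil>8 / \<epsilon>\<rceil>)" unfolding defs by (rule two_power_clog_le[OF e(1)])
  ultimately show \<eta>: "2 ^ \<eta> \<le> 20 / \<epsilon>" using e(2) by linarith
  have "real \<beta> = log 2 (2 ^ \<beta>)" by simp
  also have "\<dots> \<le> log 2 (2 ^ 2 * b)" using \<beta> by (intro log_mono) simp_all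
  also have "\<dots> = log 2 b + 2" using b by (subst log_mult) (simp_all del: power2_eq_square power_numeral add: log_nat_power)
  finally show "real \<beta> \<le> log 2 b + 2" .
  have "real \<eta> = log 2 (2 ^ \<eta>)" by simp
  also have "\<dots> \<le> log 2 (2 ^ 5 * (1 / \<epsilon>))"
  proof (intro log_mono)
    have "20 / \<epsilon> \<le> 2 ^ 5 * (1 / \<epsilon>)" using \<epsilon> by (simp add: divide_right_mono)
    with \<eta> show "2 ^ \<eta> \<le> 2 ^ 5 * (1 / \<epsilon>)" by linarith
  qed simp_all
  also have "\<dots> = log 2 (2 ^ 5) + log 2 (1 / \<epsilon>)" using \<epsilon> by (subst log_mult) simp_all
  also have "log 2 ((2 :: real) ^ 5) = 5" by (subst log_nat_power) simp_all
  finally show le: "real \<eta> \<le> log 2 (1 / \<epsilon>) + 5" by simp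
  have "real \<nu> \<le> log 2 n + 1" unfolding defs using n by (intro clog_le_log) simp
  moreover have "\<Lambda> = log 2 n + log 2 (1 / \<epsilon>)"
    unfolding defs using n \<epsilon> by (simp add: log_divide)
  \<comment> \<open>The sum is at most \<open>\<Lambda> + 6\<close>, and
    \<open>6 \<le> 24 * \<Lambda>\<close>.\<close>
  ultimately show "real (\<nu> + \<eta>) \<le> 25 * \<Lambda>" using le nontrivial_bounds by simp
qed

text \<open>The walk uses \<open>\<kappa>\<close>, but the claim has \<open>k\<close>. They differ
  only for \<open>k > n + 1\<close>, where the exponent \<open>q\<close> of the walk exceeds
  \<open>p\<close>. Then either a seed of length \<open>n\<close> is short enough, or
  \<open>b\<^sup>2\<close>, \<open>\<Lambda>\<close> and \<open>1 / \<epsilon>\<close> are at most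
  \<open>2 ^ n\<close>, and \<open>q\<close>, of order \<open>1 / n\<close>, makes the power a
  constant.\<close>

lemma seed_length_le:
  fixes D p :: real
  defines "p \<equiv> 2 / (real k - 2)"
  assumes D: "D \<ge> 1 / 2" and \<tau>: "\<tau> \<ge> 1" "real \<tau> \<le> 160 * D"
  shows "real (min n (walk_length \<kappa> \<nu> \<beta> \<eta> * (3 * field_degree \<tau>)))
    \<le> 10 ^ 27 * (b\<^sup>2 * \<Lambda> * (b\<^sup>2 * \<Lambda> / \<epsilon>) powr p * D)"
proof -
  let ?T = "walk_length \<kappa> \<nu> \<beta> \<eta>" and ?Q = "b\<^sup>2 * \<Lambda> / \<epsilon>" and ?s = "min n (walk_length \<kappa> \<nu> \<beta> \<eta> * (3 * field_degree \<tau>))"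
  define q K where "q = 2 / (real \<kappa> - 2)" and "K = (204800 * 1024000\<^sup>2 :: real)"
  have \<Lambda>: "\<Lambda> \<ge> 1 / 4" and \<epsilon>2: "\<epsilon> < 2" using nontrivial_bounds by blast+
  have b2: "b\<^sup>2 \<ge> 1" using b by simp
  have p: "0 \<le> p" "p \<le> 2" using k by (simp_all add: p_def field_simps)
  have \<kappa>: "\<kappa> > 2" using k n defs(1) by simp
  have \<nu>: "\<nu> > 0" unfolding defs using n by (simp add: clog_pos)
  have T: "real ?T \<le> K * (b\<^sup>2 * \<Lambda> * ?Q powr q)"
    unfolding K_def by (rule walk_length_le_real[OF \<kappa> q_def b rounding_bounds(1) \<epsilon> rounding_bounds(2,5) \<nu>])
  \<comment> \<open>A step reads three field elements of at most
    \<open>3 * \<tau> + 2 \<le> 5 * \<tau>\<close> bits; below,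
    \<open>2400 = 15 * 160\<close>.\<close>
  have "3 * field_degree \<tau> \<le> 15 * \<tau>" using field_degree_le[of \<tau>] \<tau>(1) by linarith
  then have "real (3 * field_degree \<tau>) \<le> real (15 * \<tau>)" by (simp only: of_nat_le_iff)
  then have fd: "real (3 * field_degree \<tau>) \<le> 2400 * D" using \<tau>(2) by simp
  have s: "real ?s \<le> real ?T * (2400 * D)"
  proof -
    have "real ?s \<le> real (?T * (3 * field_degree \<tau>))" by (simp only: of_nat_le_iff min.cobounded2)
    also have "\<dots> = real ?T * real (3 * field_degree \<tau>)" by (rule of_nat_mult)
    also have "\<dots> \<le> real ?T * (2400 * D)" by (rule mult_left_mono[OF fd]) simp
    finally show ?thesis .
  qed
  \<comment> \<open>\<open>262144 = 4096 * 64\<close>: the first factor bounds the power with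
    \<open>q\<close>, the second makes up for the power with \<open>p\<close>, which is at least
    \<open>1 / 64\<close>.\<close>
  have key: "real ?s \<le> 10 ^ 27 * (b\<^sup>2 * \<Lambda> * ?Q powr p * D)"
    if T': "real ?T \<le> K * (262144 * (b\<^sup>2 * \<Lambda> * ?Q powr p))"
  proof -
    have "real ?T * (2400 * D) \<le> K * (262144 * (b\<^sup>2 * \<Lambda> * ?Q powr p)) * (2400 * D)"
      using T' D by (intro mult_right_mono) simp_all
    also have "\<dots> = (K * 262144 * 2400) * (b\<^sup>2 * \<Lambda> * ?Q powr p * D)" by (simp only: mult_ac)
    \<comment> \<open>The product of the constants is about \<open>1.4 * 10 ^ 26\<close>.\<close>
    also have "\<dots> \<le> 10 ^ 27 * (b\<^sup>2 * \<Lambda> * ?Q powr p * D)"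
      using \<Lambda> D by (intro mult_right_mono) (simp_all add: K_def)
    finally show ?thesis using s by linarith
  qed
  have Q8: "?Q \<ge> 1 / 8"
  proof -
    have "1 * (1 / 4) / 2 \<le> ?Q" using b2 \<Lambda> \<epsilon> \<epsilon>2 by (intro frac_le mult_mono) simp_all
    then show ?thesis by simp
  qed
  have Qp: "?Q powr p \<ge> 1 / 64" using Q8 p by (rule powr_ge_1_8)
  show ?thesis
  proof (cases "k \<le> n + 1")
    case True
    then have "q = p" by (simp add: q_def p_def defs(1))
    moreover have "0 \<le> b\<^sup>2 * \<Lambda> * ?Q powr p" using \<Lambda> by simp
    ultimately show ?thesis using T by (intro key) (simp add: K_def)
  next
    case False
    then have \<kappa>n: "\<kappa> = n + 1" by (simp add: defs(1))
    define Y where "Y = b\<^sup>2 * \<Lambda> * D"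
    show ?thesis
    proof (cases "real n \<le> 10 * Y")
      case True
      have "Y \<ge> 0" using \<Lambda> D by (simp add: Y_def)
      have "real ?s \<le> real n" by simp
      also have "\<dots> \<le> 640 * (Y * (1 / 64))" using True by simp
      also have "\<dots> \<le> 640 * (Y * ?Q powr p)"
        using Qp \<open>Y \<ge> 0\<close> by (intro mult_left_mono) simp_all
      also have "\<dots> \<le> 10 ^ 27 * (Y * ?Q powr p)"
        using \<open>Y \<ge> 0\<close> by (intro mult_right_mono) simp_all
      also have "\<dots> = 10 ^ 27 * (b\<^sup>2 * \<Lambda> * ?Q powr p * D)" by (simp only: Y_def mult_ac)
      finally show ?thesis .
    next
      case False
      have "b\<^sup>2 * (1 / 4) * (1 / 2) \<le> Y" unfolding Y_def using \<Lambda> D by (intro mult_mono) simp_all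
      then have bn: "b\<^sup>2 \<le> real n" using False b2 by linarith
      have "1 * \<Lambda> * (1 / 2) \<le> Y" unfolding Y_def using \<Lambda> D b2 by (intro mult_mono) simp_all
      then have \<Lambda>n: "\<Lambda> \<le> real n" using False \<Lambda> by linarith
      have n2: "real n \<le> 2 ^ n" by (metis less_exp less_imp_le of_nat_le_iff of_nat_numeral of_nat_power)
      have "real n / \<epsilon> = 2 powr \<Lambda>" unfolding defs(5) using n \<epsilon> by simp
      also have "\<dots> \<le> 2 powr real n" using \<Lambda>n by (intro powr_mono) simp_all
      also have "\<dots> = 2 ^ n" by (rule powr_realpow) simp
      finally have "1 * (1 / \<epsilon>) \<le> 2 ^ n"
        using mult_right_mono[of 1 "real n" "1 / \<epsilon>"] n \<epsilon> by simp
      then have "b\<^sup>2 * \<Lambda> * (1 / \<epsilon>) \<le> 2 ^ n * 2 ^ n * 2 ^ n"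
        using order_trans[OF bn n2] order_trans[OF \<Lambda>n n2] \<Lambda> \<epsilon> by (intro mult_mono) simp_all
      also have "\<dots> = 2 powr (3 * real n)"
        by (simp add: powr_add powr_realpow[symmetric] flip: powr_add)
      finally have "?Q powr q \<le> (2 powr (3 * real n)) powr q"
        using order_trans[OF _ Q8, of 0] \<kappa> by (intro powr_mono2) (simp_all add: q_def)
      also have "\<dots> = 2 powr (3 * real n * q)" by (rule powr_powr)
      \<comment> \<open>\<open>3 * n * q = 6 * n / (n - 1) \<le> 12\<close> for
        \<open>n \<ge> 2\<close>.\<close>
      also have "\<dots> \<le> 2 powr 12"
        using n by (intro powr_mono) (simp_all add: q_def \<kappa>n field_simps)
      also have "\<dots> = 4096" by (simp add: powr_numeral)
      finally have "b\<^sup>2 * \<Lambda> * ?Q powr q \<le> b\<^sup>2 * \<Lambda> * 4096"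
        using \<Lambda> by (intro mult_left_mono) simp_all
      also have "\<dots> = 262144 * (b\<^sup>2 * \<Lambda> * (1 / 64))" by simp
      also have "\<dots> \<le> 262144 * (b\<^sup>2 * \<Lambda> * ?Q powr p)"
        using Qp \<Lambda> by (intro mult_left_mono) simp_all
      finally have "K * (b\<^sup>2 * \<Lambda> * ?Q powr q) \<le> K * (262144 * (b\<^sup>2 * \<Lambda> * ?Q powr p))"
        by (rule mult_left_mono) (simp add: K_def)
      with T show ?thesis by (intro key) linarith
    qed
  qed
qed

lemma target1_le: "target1 \<kappa> \<nu> \<eta> a \<ge> 1" "real (target1 \<kappa> \<nu> \<eta> a) \<le> 160 * (real k * log 2 n)" "real k * log 2 n \<ge> 1 / 2"
proof -
  have \<nu>: "\<nu> > 0" unfolding defs using n by (simp add: clog_pos)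
  show "target1 \<kappa> \<nu> \<eta> a \<ge> 1" using \<nu> k n by (simp add: target1_def defs(1) Suc_le_eq)
  have "log 2 2 \<le> log 2 (real n)" using n by (intro log_mono) simp_all
  then have log: "1 \<le> log 2 n" by simp
  moreover have "real \<nu> \<le> log 2 n + 1" unfolding defs using n by (intro clog_le_log) simp
  ultimately have "real \<nu> \<le> 2 * log 2 n" by linarith
  moreover have "real \<kappa> \<le> real k" by (simp add: defs(1))
  ultimately have "real \<kappa> * real \<nu> \<le> real k * (2 * log 2 n)" by (intro mult_mono) simp_all
  moreover have "0 \<le> real k * log 2 n" using log by simp
  ultimately show "real (target1 \<kappa> \<nu> \<eta> a) \<le> 160 * (real k * log 2 n)" by (simp add: target1_def)
  have "3 * 1 \<le> real k * log 2 n" using log k by (intro mult_mono) simp_all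
  then show "real k * log 2 n \<ge> 1 / 2" by simp
qed

text \<open>The term with \<open>\<epsilon>\<close> may be negative but is at least -1, while
  \<open>log 2 k \<ge> 3 / 2\<close> because \<open>3\<^sup>2 \<ge> 2 ^ 3\<close>. So
  \<open>D\<close> stays above a positive constant and absorbs the additive terms.\<close>

lemma target2_le:
  fixes D :: real
  defines "D \<equiv> log 2 (log 2 n) + log 2 k + log 2 (b / \<epsilon>)"
  shows "target2 \<kappa> \<nu> \<eta> a \<ge> 1" "real (target2 \<kappa> \<nu> \<eta> (walk_exponent \<kappa> \<nu> \<beta> \<eta>)) \<le> 160 * D" "D \<ge> 1 / 2"
proof -
  let ?a = "walk_exponent \<kappa> \<nu> \<beta> \<eta>"
  show "target2 \<kappa> \<nu> \<eta> a \<ge> 1" by (simp add: target2_def)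
  have \<nu>: "\<nu> > 0" unfolding defs using n by (simp add: clog_pos)
  have \<kappa>: "\<kappa> > 2" using k n defs(1) by simp
  have "log 2 2 \<le> log 2 (real n)" using n by (intro log_mono) simp_all
  then have log: "1 \<le> log 2 n" by simp
  have "real \<nu> \<le> log 2 n + 1" unfolding defs using n by (intro clog_le_log) simp
  then have "log 2 (real \<nu>) \<le> log 2 (2 * log 2 n)" using log \<nu> by (intro log_mono) simp_all
  also have "\<dots> = 1 + log 2 (log 2 n)" using log by (subst log_mult) simp_all
  finally have c\<nu>: "real (clog \<nu>) \<le> log 2 (log 2 n) + 2" using clog_le_log[of \<nu>] \<nu> by linarith
  have "log 2 (real \<kappa>) \<le> log 2 (real k)" using \<kappa> by (intro log_mono) (simp_all add: defs(1))
  then have c\<kappa>: "real (clog \<kappa>) \<le> log 2 k + 1" using clog_le_log[of \<kappa>] \<kappa> by linarith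
  have ll: "0 \<le> log 2 (log 2 n)" using log by simp
  have lk: "3 / 2 \<le> log 2 k"
  proof -
    have "3 \<le> log 2 ((3 :: real) ^ 2)" by (subst le_log_iff) (simp_all add: powr_numeral)
    then have "3 \<le> 2 * log 2 (3 :: real)" by (subst (asm) log_nat_power) simp_all
    moreover have "log 2 3 \<le> log 2 (real k)" using k by (intro log_mono) simp_all
    ultimately show ?thesis by linarith
  qed
  have lb: "0 \<le> log 2 b" using b by simp
  have l\<epsilon>: "-1 \<le> log 2 (1 / \<epsilon>)"
  proof -
    have "log 2 (1 / 2) \<le> log 2 (1 / \<epsilon>)" using \<epsilon> nontrivial_bounds by (intro log_mono) (simp_all add: field_simps)
    then show ?thesis by (simp add: log_divide)
  qed
  have D: "D = log 2 (log 2 n) + log 2 k + log 2 b + log 2 (1 / \<epsilon>)"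
    unfolding D_def using b \<epsilon> by (simp add: log_divide)
  show D2: "D \<ge> 1 / 2" unfolding D using ll lk lb l\<epsilon> by linarith
  have \<ell>: "clog (\<nu> + \<eta>) \<le> clog \<nu> + \<eta> + 1" "clog (\<nu> + 1) \<le> clog \<nu> + 2"
    using clog_add_le[of \<nu> \<eta>] clog_le_self[of \<eta>] clog_add_le[of \<nu> 1] clog_le_self[of 1] by linarith+
  \<comment> \<open>As \<open>\<kappa> \<ge> 3\<close>, the quotients of \<open>\<kappa>\<close> and
    of 1 by \<open>\<kappa> - 2\<close> are at most 3 and 1.\<close>
  have "?a \<le> 3 * (\<beta> + 1) + \<eta> + clog (\<nu> + \<eta>) + 4"
  proof -
    obtain r where r: "\<kappa> = 2 + Suc r" using \<kappa> less_imp_Suc_add[OF \<kappa>] by auto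
    show ?thesis
      unfolding walk_exponent_def by (subst ceil_div_le_iff) (simp_all add: r algebra_simps)
  qed
  with \<ell> have "target2 \<kappa> \<nu> \<eta> ?a \<le> clog \<kappa> + 4 * clog \<nu> + 6 * \<eta> + 6 * \<beta> + 23"
    unfolding target2_def by presburger
  then have "real (target2 \<kappa> \<nu> \<eta> ?a) \<le> real (clog \<kappa> + 4 * clog \<nu> + 6 * \<eta> + 6 * \<beta> + 23)"
    by (simp only: of_nat_le_iff)
  also have "\<dots> = real (clog \<kappa>) + 4 * real (clog \<nu>) + 6 * real \<eta> + 6 * real \<beta> + 23" by simp
  also have "\<dots> \<le> 160 * D"
  proof -
    have "real (clog \<kappa>) + 4 * real (clog \<nu>) + 6 * real \<eta> + 6 * real \<beta> + 23 \<le>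
        (log 2 k + 1) + 4 * (log 2 (log 2 n) + 2) + 6 * (log 2 (1 / \<epsilon>) + 5) + 6 * (log 2 b + 2) + 23"
      by (intro add_mono mult_left_mono c\<nu> c\<kappa> rounding_bounds(3,4)) simp_all
    \<comment> \<open>\<open>D \<ge> 1 / 2\<close> gives \<open>154 * D \<ge> 77\<close>, which
      covers the constant 74.\<close>
    also have "\<dots> \<le> 6 * D + 74" unfolding D using ll lk by simp
    finally show ?thesis using D2 by linarith
  qed
  finally show "real (target2 \<kappa> \<nu> \<eta> ?a) \<le> 160 * D" .
qed

lemma seed_length_formula:
  fixes D :: real
  assumes "D \<ge> 0"
  shows "\<bar>b powr (2 + 4 / (real k - 2)) * D * \<Lambda> powr (1 + 2 / (real k - 2)) / \<epsilon> powr (2 / (real k - 2))\<bar> =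
    b\<^sup>2 * \<Lambda> * (b\<^sup>2 * \<Lambda> / \<epsilon>) powr (2 / (real k - 2)) * D"
proof -
  define p where "p = 2 / (real k - 2)"
  have \<Lambda>: "\<Lambda> > 0" using nontrivial_bounds by linarith
  have "b powr (2 + 4 / (real k - 2)) = b powr (2 + 2 * p)" by (simp add: p_def)
  also have "\<dots> = b powr 2 * (b powr 2) powr p" by (simp only: powr_add powr_powr)
  also have "b powr 2 = b\<^sup>2" using b by (simp add: powr_numeral)
  finally have 1: "b powr (2 + 4 / (real k - 2)) = b\<^sup>2 * (b\<^sup>2) powr p" .
  have 2: "\<Lambda> powr (1 + p) = \<Lambda> * \<Lambda> powr p" using \<Lambda> by (simp add: powr_add)
  have 3: "(b\<^sup>2 * \<Lambda> / \<epsilon>) powr p = (b\<^sup>2) powr p * \<Lambda> powr p / \<epsilon> powr p"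
    using \<Lambda> \<epsilon> by (simp add: powr_mult powr_divide)
  have "b powr (2 + 4 / (real k - 2)) * D * \<Lambda> powr (1 + p) / \<epsilon> powr p = b\<^sup>2 * \<Lambda> * (b\<^sup>2 * \<Lambda> / \<epsilon>) powr p * D"
    unfolding 1 2 3 by (simp add: mult_ac)
  moreover have "0 \<le> b\<^sup>2 * \<Lambda> * (b\<^sup>2 * \<Lambda> / \<epsilon>) powr p * D" using \<Lambda> assms by simp
  ultimately show ?thesis unfolding p_def[symmetric] by simp
qed

end

theorem theorem4p3:
  shows "(\<exists>(C::real) P q. \<forall>(n::nat) F (b::real) (k::nat).
      n \<ge> 2 \<and> F \<subseteq> boolean_functions n \<and> closed_under_restrictions n F \<and>
      b \<ge> 1 \<and> k > 2 \<and> M_class n k F \<le> b ^ k \<longrightarrow>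
      (\<forall>\<epsilon>>0. \<exists>s G.
         explicit_generator P q n k b \<epsilon> s G \<and>
         is_prg n F \<epsilon> (map_pmf G (pmf_of_set (cube s))) \<and>
         real s \<le> C * \<bar>b powr (2 + 4 / (real k - 2)) * (real k * log 2 n)
                      * log 2 (n / \<epsilon>) powr (1 + 2 / (real k - 2))
                      / \<epsilon> powr (2 / (real k - 2))\<bar>)) \<and>
    (\<exists>(C::real) P q. \<forall>(n::nat) F (b::real) (k::nat).
      n \<ge> 2 \<and> F \<subseteq> boolean_functions n \<and> closed_under_restrictions n F \<and>
      b \<ge> 1 \<and> k > 2 \<and> M_class n k F \<le> b ^ k \<and>
      (\<forall>i. 1 \<le> i \<and> i < k \<longrightarrow> L1_class n i F \<le> b ^ i) \<longrightarrow>
      (\<forall>\<epsilon>>0. \<exists>s G.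
         explicit_generator P q n k b \<epsilon> s G \<and>
         is_prg n F \<epsilon> (map_pmf G (pmf_of_set (cube s))) \<and>
         real s \<le> C * \<bar>b powr (2 + 4 / (real k - 2))
                      * (log 2 (log 2 n) + log 2 k + log 2 (b / \<epsilon>))
                      * log 2 (n / \<epsilon>) powr (1 + 2 / (real k - 2))
                      / \<epsilon> powr (2 / (real k - 2))\<bar>))"
proof (intro conjI)
  obtain c where c: "computes_target c target1" using target1 by blast
  show "\<exists>(C::real) P q. \<forall>(n::nat) F (b::real) (k::nat).
      n \<ge> 2 \<and> F \<subseteq> boolean_functions n \<and> closed_under_restrictions n F \<and>
      b \<ge> 1 \<and> k > 2 \<and> M_class n k F \<le> b ^ k \<longrightarrow>
      (\<forall>\<epsilon>>0. \<exists>s G.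
         explicit_generator P q n k b \<epsilon> s G \<and>
         is_prg n F \<epsilon> (map_pmf G (pmf_of_set (cube s))) \<and>
         real s \<le> C * \<bar>b powr (2 + 4 / (real k - 2)) * (real k * log 2 n)
                      * log 2 (n / \<epsilon>) powr (1 + 2 / (real k - 2))
                      / \<epsilon> powr (2 / (real k - 2))\<bar>)"
  proof (rule exI[of _ "10 ^ 27"], rule exI[of _ "program c"], rule exI[of _ "pcompose (time_bound c) [:12, 1:]"],
      intro allI impI, elim conjE)
    fix n k :: nat and F and b \<epsilon> :: real
    assume A: "n \<ge> 2" "F \<subseteq> boolean_functions n" "closed_under_restrictions n F" "b \<ge> 1" "k > 2"
      "M_class n k F \<le> b ^ k" "\<epsilon> > 0"
    let ?\<kappa> = "min k (n + 1)" and ?\<nu> = "clog n" and ?\<beta> = "clog (nat \<lceil>b\<rceil>)" and ?\<eta> = "clog (nat \<lceil>8 / \<epsilon>\<rceil>)"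
    let ?\<tau> = "target1 ?\<kappa> ?\<nu> ?\<eta> (walk_exponent ?\<kappa> ?\<nu> ?\<beta> ?\<eta>)"
    define s where "s = (if nontrivial_error n (nat \<lceil>8 / \<epsilon>\<rceil>)
      then min n (walk_length ?\<kappa> ?\<nu> ?\<beta> ?\<eta> * (3 * field_degree ?\<tau>)) else 0)"
    show "\<exists>s G. explicit_generator (program c) (pcompose (time_bound c) [:12, 1:]) n k b \<epsilon> s G \<and>
         is_prg n F \<epsilon> (map_pmf G (pmf_of_set (cube s))) \<and>
         real s \<le> 10 ^ 27 * \<bar>b powr (2 + 4 / (real k - 2)) * (real k * log 2 n)
                      * log 2 (n / \<epsilon>) powr (1 + 2 / (real k - 2))
                      / \<epsilon> powr (2 / (real k - 2))\<bar>"
    proof (intro exI conjI)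
      show "explicit_generator (program c) (pcompose (time_bound c) [:12, 1:]) n k b \<epsilon> s (generator target1 n k b \<epsilon> s)"
        by (rule explicit_generator_program[OF c A(1,5)])
      show "is_prg n F \<epsilon> (map_pmf (generator target1 n k b \<epsilon> s) (pmf_of_set (cube s)))"
        unfolding s_def by (rule is_prg_generator1[OF A(1,5,2,3,4,6,7) refl refl refl refl refl refl])
      show "real s \<le> 10 ^ 27 * \<bar>b powr (2 + 4 / (real k - 2)) * (real k * log 2 n)
                      * log 2 (n / \<epsilon>) powr (1 + 2 / (real k - 2))
                      / \<epsilon> powr (2 / (real k - 2))\<bar>"
      proof (cases "nontrivial_error n (nat \<lceil>8 / \<epsilon>\<rceil>)")
        case True
        note params = A(1,5,4,7) True refl refl refl refl refl
        note D = target1_le[OF params]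
        have "real k * log 2 n \<ge> 0" using D(3) by linarith
        show ?thesis
          unfolding seed_length_formula[OF params \<open>real k * log 2 n \<ge> 0\<close>] s_def if_P[OF True]
          by (rule seed_length_le[OF params D(3,1,2)])
      next
        \<comment> \<open>The seed is empty, so the bound holds for every value of the formula,
          which may vanish for trivial errors.\<close>
        case False
        then show ?thesis by (simp add: s_def)
      qed
    qed
  qed
next
  obtain c where c: "computes_target c target2" using target2 by blast
  show "\<exists>(C::real) P q. \<forall>(n::nat) F (b::real) (k::nat).
      n \<ge> 2 \<and> F \<subseteq> boolean_functions n \<and> closed_under_restrictions n F \<and>
      b \<ge> 1 \<and> k > 2 \<and> M_class n k F \<le> b ^ k \<and>
      (\<forall>i. 1 \<le> i \<and> i < k \<longrightarrow> L1_class n i F \<le> b ^ i) \<longrightarrow>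
      (\<forall>\<epsilon>>0. \<exists>s G.
         explicit_generator P q n k b \<epsilon> s G \<and>
         is_prg n F \<epsilon> (map_pmf G (pmf_of_set (cube s))) \<and>
         real s \<le> C * \<bar>b powr (2 + 4 / (real k - 2))
                      * (log 2 (log 2 n) + log 2 k + log 2 (b / \<epsilon>))
                      * log 2 (n / \<epsilon>) powr (1 + 2 / (real k - 2))
                      / \<epsilon> powr (2 / (real k - 2))\<bar>)"
  proof (rule exI[of _ "10 ^ 27"], rule exI[of _ "program c"], rule exI[of _ "pcompose (time_bound c) [:12, 1:]"],
      intro allI impI, elim conjE)
    fix n k :: nat and F and b \<epsilon> :: real
    assume A: "n \<ge> 2" "F \<subseteq> boolean_functions n" "closed_under_restrictions n F" "b \<ge> 1" "k > 2"
      "M_class n k F \<le> b ^ k" "\<epsilon> > 0" and L1: "\<forall>i. 1 \<le> i \<and> i < k \<longrightarrow> L1_class n i F \<le> b ^ i"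
    let ?\<kappa> = "min k (n + 1)" and ?\<nu> = "clog n" and ?\<beta> = "clog (nat \<lceil>b\<rceil>)" and ?\<eta> = "clog (nat \<lceil>8 / \<epsilon>\<rceil>)"
    let ?\<tau> = "target2 ?\<kappa> ?\<nu> ?\<eta> (walk_exponent ?\<kappa> ?\<nu> ?\<beta> ?\<eta>)" and ?D = "log 2 (log 2 n) + log 2 k + log 2 (b / \<epsilon>)"
    define s where "s = (if nontrivial_error n (nat \<lceil>8 / \<epsilon>\<rceil>)
      then min n (walk_length ?\<kappa> ?\<nu> ?\<beta> ?\<eta> * (3 * field_degree ?\<tau>)) else 0)"
    show "\<exists>s G. explicit_generator (program c) (pcompose (time_bound c) [:12, 1:]) n k b \<epsilon> s G \<and>
         is_prg n F \<epsilon> (map_pmf G (pmf_of_set (cube s))) \<and>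
         real s \<le> 10 ^ 27 * \<bar>b powr (2 + 4 / (real k - 2)) * ?D
                      * log 2 (n / \<epsilon>) powr (1 + 2 / (real k - 2))
                      / \<epsilon> powr (2 / (real k - 2))\<bar>"
    proof (intro exI conjI)
      show "explicit_generator (program c) (pcompose (time_bound c) [:12, 1:]) n k b \<epsilon> s (generator target2 n k b \<epsilon> s)"
        by (rule explicit_generator_program[OF c A(1,5)])
      show "is_prg n F \<epsilon> (map_pmf (generator target2 n k b \<epsilon> s) (pmf_of_set (cube s)))"
        unfolding s_def
        by (rule is_prg_generator2[OF A(1,5,2,3,4,6,7) refl refl refl refl refl refl]) (use L1 in blast)
      show "real s \<le> 10 ^ 27 * \<bar>b powr (2 + 4 / (real k - 2)) * ?D
                      * log 2 (n / \<epsilon>) powr (1 + 2 / (real k - 2))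
                      / \<epsilon> powr (2 / (real k - 2))\<bar>"
      proof (cases "nontrivial_error n (nat \<lceil>8 / \<epsilon>\<rceil>)")
        case True
        note params = A(1,5,4,7) True refl refl refl refl refl
        note D = target2_le[OF params]
        have "?D \<ge> 0" using D(3) by linarith
        show ?thesis
          unfolding seed_length_formula[OF params \<open>?D \<ge> 0\<close>] s_def if_P[OF True]
          by (rule seed_length_le[OF params D(3,1,2)])
      next
        case False
        then show ?thesis by (simp add: s_def)
      qed
    qed
  qed
qed

end
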